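(* Let $s<0$ and let $\omega\in\mathbb{R}$, $\omega\neq0$. Let $Q$ be any one of the three nonlinearities $$ Q(u)=u^2,\qquad Q(u)=\bar u^2,\qquad Q(u)=|u|^2-\mu(|u|^2). $$ Then there exists $u\in C^0([0,1],H^s(\mathbb{T}))$ which is a weak solution in the extended sense of the Cauchy problem $$ iu_t+u_{xx}+\omega\,Q(u)=0,\qquad u(0,x)=u_0(x), $$ does not vanish identically, and has initial datum $u_0\equiv0$. Moreover, $\lim_{N\to\infty}e^{-it\Delta}Q(\mathcal{P}_Nu)$ exists in the $C^{-1}([0,1],H^s)$ norm for any sequence $(\mathcal{P}_N)_{N\in\mathbb{N}}$ of Fourier cutoff operators.
   Context: $\mathbb{T}=\mathbb{R}/2\pi\mathbb{Z}$; $t\in[0,1]$, $x\in\mathbb{T}$. $\mu(f)=(2\pi)^{-1}\int_{\mathbb{T}}f(x)\,dx$, applied at each fixed time $t$. The partial Fourier transform is $\widehat f(t,n)=(2\pi)^{-1}\int_{\mathbb{T}}f(t,x)e^{-inx}\,dx$, $n\in\mathbb{Z}$, extended to distributions by continuity. $H^s(\mathbb{T})$ has norm $\|f\|_{H^s}=\big(\sum_n|\widehat f(n)|^2(1+n^2)^s\big)^{1/2}$. $\Delta=\partial_x^2$, and $e^{-it\Delta}$ acts by $\widehat{(e^{-it\Delta}f)}(t,n)=e^{in^2t}\widehat f(t,n)$. Fourier cutoff operators: a sequence of Fourier cutoff operators is any sequence $(\mathcal{P}_N)_{N\in\mathbb{N}}$ of linear operators on $\mathcal{D}'(\mathbb{T})$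 of the form $\widehat{\mathcal{P}_Nf}(n)=m_N(n)\widehat f(n)$, where the functions $m_N:\mathbb{Z}\to\mathbb{C}$ each have finite support, are uniformly bounded (in $N$ and $n$), and satisfy $\lim_{N\to\infty}m_N(k)=1$ for all $k\in\mathbb{Z}$. They act on functions of $(t,x)$ in the $x$ variable. Existence of the nonlinear term: for $u\in\mathcal{D}'((0,1)\times\mathbb{T})$, $Q(u)$ is said to exist and to equal $v\in\mathcal{D}'((0,1)\times\mathbb{T})$ if for every sequence $(\mathcal{P}_N)$ of Fourier cutoff operators, $\lim_{N\to\infty}Q(\mathcal{P}_Nu)=v$ in the topology of $\mathcal{D}'((0,1)\times\mathbb{T})$. Weak solution in the extended sense: $u\in C^0([0,1],H^s(\mathbb{T}))$ is a weak solution of the Cauchy problem in the extended sense if $u(0,\cdot)=u_0$, $Q(u)$ exists in the sense that there is $v\in\mathcal{D}'((0,1)\times\mathbb{T})$ with $\lim_{N\to\infty}Q(\mathcal{P}_Nu)=v$ in the topology of $\mathcal{D}'((0,1)\times\mathbb{T})$ for every sequence $(\mathcal{P}_N)$ of Fourier cutoff operators, and $iu_t+u_{xx}+\omega Q(u)=0$ holds in the sense of distributions on $(0,1)\times\mathbb{T}$ with $Q(u)$ interpreted as this limit $v$. For a function space $\mathcal{H}=\mathcal{H}(\mathbb{T})$, $C^{-1}([0,1],\mathcal{H})$ is the space of space-time distributions $F$ such that $\tilde F(t,x)=\int_0^tF(s,x)\,ds$ belongs to $C^0([0,1],\mathcal{H})$ (i.e. $F=\partial_t\tilde F$ with $\tilde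 F\in C^0([0,1],\mathcal{H})$, $\tilde F(0)=0$), with norm $\|F\|_{C^{-1}([0,1],\mathcal{H})}=\max_{t\in[0,1]}\|\tilde F(t,\cdot)\|_{\mathcal{H}}$. *)

theory Defs
  imports "HOL-Analysis.Analysis"
begin

text \<open>Functions on the torus are \<open>2 * pi\<close>-periodic functions of a real variable.  Distributions
  are functionals on all such functions, but only their values on test functions are meaningful:
  equality and convergence of distributions are always tested on test functions.\<close>

subsection \<open>Distributions on the torus\<close>

definition periodic :: "(real \<Rightarrow> complex) \<Rightarrow> bool" where
  "periodic f \<longleftrightarrow> (\<forall>x. f (x + 2 * pi) = f x)"

definition Dx :: "(real \<Rightarrow> complex) \<Rightarrow> real \<Rightarrow> complex" where
  "Dx f = (\<lambda>x. vector_derivative f (at x))"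

definition torus_test :: "(real \<Rightarrow> complex) set" where
  "torus_test = {f. periodic f \<and> (\<forall>k x. (Dx ^^ k) f differentiable (at x))}"

type_synonym torus_functional = "(real \<Rightarrow> complex) \<Rightarrow> complex"

text \<open>The continuity clause is continuity for the Frechet topology of \<open>C\<^sup>\<infinity>\<close>:
  \<open>T f\<close> is bounded by a constant times the maximum of the sup norms of finitely many derivatives.\<close>

definition torus_distribution :: "torus_functional \<Rightarrow> bool" where
  "torus_distribution T \<longleftrightarrow>
     (\<forall>f\<in>torus_test. \<forall>g\<in>torus_test. T (\<lambda>x. f x + g x) = T f + T g) \<and>
     (\<forall>c. \<forall>f\<in>torus_test. T (\<lambda>x. c * f x) = c * T f) \<and>
     (\<exists>C m. \<forall>f\<in>torus_test. \<forall>B. (\<forall>k\<le>m. \<forall>x. norm ((Dx ^^ k) f x) \<le> B) \<longrightarrow> norm (T f) \<le> C * B)"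

definition torus_dist :: "(real \<Rightarrow> complex) \<Rightarrow> torus_functional" where
  "torus_dist f = (\<lambda>g. integral {0..2 * pi} (\<lambda>x. f x * g x))"

definition character :: "int \<Rightarrow> real \<Rightarrow> complex" where
  "character n x = exp (\<i> * of_int n * of_real x)"

definition fourier_coeff :: "torus_functional \<Rightarrow> int \<Rightarrow> complex" where
  "fourier_coeff T n = T (character (- n)) / (2 * of_real pi)"

text \<open>The operator on distributions that multiplies the \<open>n\<close>-th Fourier coefficient by \<open>m n\<close>, given by
  its Fourier series.  The series converges absolutely for bounded \<open>m\<close>, a distribution \<open>T\<close> and
  a test function \<open>g\<close>.\<close>

definition fourier_multiplier :: "(int \<Rightarrow> complex) \<Rightarrow> torus_functional \<Rightarrow> torus_functional" where
  "fourier_multiplier m T =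
     (\<lambda>g. \<Sum>\<^sub>\<infinity>n. m n * fourier_coeff T n * torus_dist (character n) g)"

text \<open>The operator \<open>exp (- i t \<Delta>)\<close>, where \<open>\<Delta>\<close> is the second derivative in \<open>x\<close>.\<close>

definition free_propagator :: "real \<Rightarrow> torus_functional \<Rightarrow> torus_functional" where
  "free_propagator t = fourier_multiplier (\<lambda>n. exp (\<i> * of_int (n\<^sup>2) * of_real t))"

subsection \<open>Sobolev spaces\<close>

definition Hs_norm :: "real \<Rightarrow> torus_functional \<Rightarrow> real" where
  "Hs_norm s T = sqrt (\<Sum>\<^sub>\<infinity>n. (norm (fourier_coeff T n))\<^sup>2 * (1 + (of_int n)\<^sup>2) powr s)"

definition Hs :: "real \<Rightarrow> torus_functional set" where
  "Hs s = {T. torus_distribution T \<and>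
     (\<lambda>n. (norm (fourier_coeff T n))\<^sup>2 * (1 + (of_int n)\<^sup>2) powr s) summable_on UNIV}"

definition C0_Hs :: "real \<Rightarrow> (real \<Rightarrow> torus_functional) set" where
  "C0_Hs s = {u. (\<forall>t\<in>{0..1}. u t \<in> Hs s) \<and>
     (\<forall>t\<in>{0..1}. ((\<lambda>r. Hs_norm s (\<lambda>g. u r g - u t g)) \<longlongrightarrow> 0) (at t within {0..1}))}"

subsection \<open>Space-time distributions on \<open>(0,1)\<close> times the torus\<close>

definition ST_Dt :: "(real \<Rightarrow> real \<Rightarrow> complex) \<Rightarrow> real \<Rightarrow> real \<Rightarrow> complex" where
  "ST_Dt f = (\<lambda>t x. vector_derivative (\<lambda>r. f r x) (at t))"

definition ST_Dx :: "(real \<Rightarrow> real \<Rightarrow> complex) \<Rightarrow> real \<Rightarrow> real \<Rightarrow> complex" where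
  "ST_Dx f = (\<lambda>t x. vector_derivative (f t) (at x))"

primrec ST_Ck :: "nat \<Rightarrow> (real \<Rightarrow> real \<Rightarrow> complex) \<Rightarrow> bool" where
  "ST_Ck 0 f \<longleftrightarrow> continuous_on UNIV (\<lambda>(t, x). f t x)"
| "ST_Ck (Suc k) f \<longleftrightarrow>
     continuous_on UNIV (\<lambda>(t, x). f t x) \<and>
     (\<forall>t x. (\<lambda>r. f r x) differentiable (at t) \<and> f t differentiable (at x)) \<and>
     ST_Ck k (ST_Dt f) \<and> ST_Ck k (ST_Dx f)"

definition ST_test_on :: "real \<Rightarrow> real \<Rightarrow> (real \<Rightarrow> real \<Rightarrow> complex) set" where
  "ST_test_on a b = {f. (\<forall>k. ST_Ck k f) \<and> (\<forall>t. periodic (f t)) \<and>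
     (\<forall>t x. t \<notin> {a..b} \<longrightarrow> f t x = 0)}"

text \<open>Test functions are extended by zero to all times.\<close>

definition ST_test :: "(real \<Rightarrow> real \<Rightarrow> complex) set" where
  "ST_test = {f. \<exists>a b. 0 < a \<and> b < 1 \<and> f \<in> ST_test_on a b}"

type_synonym ST_functional = "(real \<Rightarrow> real \<Rightarrow> complex) \<Rightarrow> complex"

definition ST_distribution :: "ST_functional \<Rightarrow> bool" where
  "ST_distribution F \<longleftrightarrow>
     (\<forall>f\<in>ST_test. \<forall>g\<in>ST_test. F (\<lambda>t x. f t x + g t x) = F f + F g) \<and>
     (\<forall>c. \<forall>f\<in>ST_test. F (\<lambda>t x. c * f t x) = c * F f) \<and>
     (\<forall>a b. 0 < a \<longrightarrow> b < 1 \<longrightarrow>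
        (\<exists>C m. \<forall>f\<in>ST_test_on a b. \<forall>B.
           (\<forall>j\<le>m. \<forall>k\<le>m. \<forall>t x. norm ((ST_Dt ^^ j) ((ST_Dx ^^ k) f) t x) \<le> B)
             \<longrightarrow> norm (F f) \<le> C * B))"

text \<open>Convergence of sequences in the space of space-time distributions.  Pointwise convergence on
  test functions is weak-star convergence; for sequences it is the same as convergence in the
  strong dual topology.\<close>

definition ST_tendsto :: "(nat \<Rightarrow> ST_functional) \<Rightarrow> ST_functional \<Rightarrow> bool" where
  "ST_tendsto Fs F \<longleftrightarrow> (\<forall>f\<in>ST_test. (\<lambda>N. Fs N f) \<longlonglongrightarrow> F f)"

definition dist_dt :: "ST_functional \<Rightarrow> ST_functional" where
  "dist_dt F = (\<lambda>f. - F (ST_Dt f))"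

definition dist_dx :: "ST_functional \<Rightarrow> ST_functional" where
  "dist_dx F = (\<lambda>f. - F (ST_Dx f))"

text \<open>The space-time distribution given by a curve of distributions on the torus.\<close>

definition ST_dist :: "(real \<Rightarrow> torus_functional) \<Rightarrow> ST_functional" where
  "ST_dist u = (\<lambda>f. integral {0..1} (\<lambda>t. u t (f t)))"

subsection \<open>The space \<open>C\<^sup>-\<^sup>1([0,1], H\<^sup>s)\<close>\<close>

text \<open>\<open>G\<close> is the time primitive of \<open>F\<close> vanishing at time \<open>0\<close>; as an element of
  \<open>C\<^sup>0([0,1], H\<^sup>s)\<close> it is unique, and \<open>F\<close> belongs to \<open>C\<^sup>-\<^sup>1([0,1], H\<^sup>s)\<close> if and only if it exists.\<close>

definition Cm1_primitive :: "real \<Rightarrow> ST_functional \<Rightarrow> (real \<Rightarrow> torus_functional) \<Rightarrow> bool" where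
  "Cm1_primitive s F G \<longleftrightarrow>
     ST_distribution F \<and> G \<in> C0_Hs s \<and> (\<forall>g\<in>torus_test. G 0 g = 0) \<and>
     (\<forall>f\<in>ST_test. F f = dist_dt (ST_dist G) f)"

text \<open>Convergence in norm, the norm of \<open>Fs N - F\<close> being the maximum over \<open>[0,1]\<close> of the \<open>H\<^sup>s\<close> norm
  of its primitive \<open>Gs N - G\<close>.\<close>

definition Cm1_tendsto :: "real \<Rightarrow> (nat \<Rightarrow> ST_functional) \<Rightarrow> ST_functional \<Rightarrow> bool" where
  "Cm1_tendsto s Fs F \<longleftrightarrow>
     (\<exists>Gs G. (\<forall>N. Cm1_primitive s (Fs N) (Gs N)) \<and> Cm1_primitive s F G \<and>
        (\<lambda>N. SUP t\<in>{0..1}. Hs_norm s (\<lambda>g. Gs N t g - G t g)) \<longlonglongrightarrow> 0)"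

subsection \<open>Cutoff operators, nonlinearities and weak solutions\<close>

definition cutoff_sequence :: "(nat \<Rightarrow> int \<Rightarrow> complex) \<Rightarrow> bool" where
  "cutoff_sequence m \<longleftrightarrow>
     (\<forall>N. finite {n. m N n \<noteq> 0}) \<and>
     (\<exists>C. \<forall>N n. norm (m N n) \<le> C) \<and>
     (\<forall>k. (\<lambda>N. m N k) \<longlonglongrightarrow> 1)"

text \<open>For a finitely supported symbol \<open>m\<close>, the distribution \<open>fourier_multiplier m T\<close> is a
  trigonometric polynomial.  The following is this polynomial as a function
  (see \<open>torus_dist_cutoff\<close> below), so that nonlinear operations can be applied to it.\<close>

definition cutoff :: "(int \<Rightarrow> complex) \<Rightarrow> torus_functional \<Rightarrow> real \<Rightarrow> complex" where
  "cutoff m T = (\<lambda>x. \<Sum>n | m n \<noteq> 0. m n * fourier_coeff T n * character n x)"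

definition torus_mean :: "(real \<Rightarrow> complex) \<Rightarrow> complex" where
  "torus_mean f = integral {0..2 * pi} f / (2 * of_real pi)"

text \<open>Nonlinearities act on functions on the torus, at each fixed time.\<close>

definition Q_square :: "(real \<Rightarrow> complex) \<Rightarrow> real \<Rightarrow> complex" where
  "Q_square f = (\<lambda>x. (f x)\<^sup>2)"

definition Q_cnj_square :: "(real \<Rightarrow> complex) \<Rightarrow> real \<Rightarrow> complex" where
  "Q_cnj_square f = (\<lambda>x. (cnj (f x))\<^sup>2)"

definition Q_abs_square :: "(real \<Rightarrow> complex) \<Rightarrow> real \<Rightarrow> complex" where
  "Q_abs_square f = (\<lambda>x. of_real ((norm (f x))\<^sup>2) - torus_mean (\<lambda>y. of_real ((norm (f y))\<^sup>2)))"

text \<open>\<open>Q (P u)\<close> as a curve of distributions on the torus, where \<open>P\<close> is the cutoff operator with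
  symbol \<open>m\<close>.\<close>

definition Q_cutoff ::
  "((real \<Rightarrow> complex) \<Rightarrow> real \<Rightarrow> complex) \<Rightarrow> (int \<Rightarrow> complex) \<Rightarrow> (real \<Rightarrow> torus_functional)
     \<Rightarrow> real \<Rightarrow> torus_functional" where
  "Q_cutoff Q m u = (\<lambda>t. torus_dist (Q (cutoff m (u t))))"

definition Q_exists_as ::
  "((real \<Rightarrow> complex) \<Rightarrow> real \<Rightarrow> complex) \<Rightarrow> (real \<Rightarrow> torus_functional) \<Rightarrow> ST_functional \<Rightarrow> bool" where
  "Q_exists_as Q u v \<longleftrightarrow> ST_distribution v \<and>
     (\<forall>m. cutoff_sequence m \<longrightarrow> ST_tendsto (\<lambda>N. ST_dist (Q_cutoff Q (m N) u)) v)"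

definition extended_weak_solution ::
  "real \<Rightarrow> real \<Rightarrow> ((real \<Rightarrow> complex) \<Rightarrow> real \<Rightarrow> complex) \<Rightarrow> torus_functional
     \<Rightarrow> (real \<Rightarrow> torus_functional) \<Rightarrow> bool" where
  "extended_weak_solution s \<omega> Q u0 u \<longleftrightarrow>
     u \<in> C0_Hs s \<and>
     (\<forall>g\<in>torus_test. u 0 g = u0 g) \<and>
     (\<exists>v. Q_exists_as Q u v \<and>
        (\<forall>f\<in>ST_test. \<i> * dist_dt (ST_dist u) f + dist_dx (dist_dx (ST_dist u)) f
                       + of_real \<omega> * v f = 0))"

subsection \<open>Consistency of the Fourier conventions\<close>

lemma torus_dist_character:
  "torus_dist (character k) (character n) = (if n = - k then 2 * of_real pi else 0)"
proof (cases "n = - k")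
  case True
  then have "torus_dist (character k) (character n) = integral {0..2 * pi} (\<lambda>x. 1)"
    by (simp add: torus_dist_def character_def exp_minus)
  then show ?thesis
    using True by (simp add: scaleR_conv_of_real)
next
  case False
  define a where "a = \<i> * complex_of_int (k + n)"
  have a: "a \<noteq> 0"
    using False by (simp add: a_def add_eq_0_iff2 flip: of_int_add)
  have "((\<lambda>x. exp (a * of_real x)) has_integral
          exp (a * of_real (2 * pi)) / a - exp (a * of_real 0) / a) {0..2 * pi}"
    using a by (intro fundamental_theorem_of_calculus)
      (auto intro!: derivative_eq_intros has_vector_derivative_real_field)
  moreover have "exp (a * of_real (2 * pi)) = 1"
    unfolding exp_eq_1 a_def by (auto intro!: exI[of _ "k + n"])
  moreover have "(\<lambda>x. character k x * character n x) = (\<lambda>x. exp (a * of_real x))"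
    by (simp add: character_def a_def fun_eq_iff exp_add[symmetric] algebra_simps)
  ultimately have "((\<lambda>x. character k x * character n x) has_integral 0) {0..2 * pi}"
    by simp
  then show ?thesis
    using False by (simp add: torus_dist_def integral_unique)
qed

lemma fourier_coeff_multiplier:
  "fourier_coeff (fourier_multiplier m T) n = m n * fourier_coeff T n"
proof -
  have "fourier_multiplier m T (character (- n)) =
      (\<Sum>\<^sub>\<infinity>k\<in>{n}. m k * fourier_coeff T k * (2 * of_real pi))"
    unfolding fourier_multiplier_def
    by (rule infsum_cong_neutral) (auto simp: torus_dist_character)
  then show ?thesis
    by (simp add: fourier_coeff_def[of "fourier_multiplier m T"])
qed

lemma torus_dist_cutoff:
  assumes "finite {n. m n \<noteq> 0}" and "g \<in> torus_test"
  shows "torus_dist (cutoff m T) g = fourier_multiplier m T g"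
proof -
  have "(Dx ^^ 0) g differentiable (at x)" for x
    using assms(2) unfolding torus_test_def by blast
  then have g: "continuous_on A g" for A
    by (auto intro!: continuous_at_imp_continuous_on differentiable_imp_continuous_within)
  have "torus_dist (cutoff m T) g = integral {0..2 * pi}
      (\<lambda>x. \<Sum>n | m n \<noteq> 0. m n * fourier_coeff T n * (character n x * g x))"
    by (simp add: torus_dist_def cutoff_def sum_distrib_right mult.assoc)
  also have "\<dots> = (\<Sum>n | m n \<noteq> 0. integral {0..2 * pi}
      (\<lambda>x. m n * fourier_coeff T n * (character n x * g x)))"
    unfolding character_def
    by (intro integral_sum assms(1) integrable_continuous_interval continuous_intros g)
  also have "\<dots> = (\<Sum>n | m n \<noteq> 0. m n * fourier_coeff T n * torus_dist (character n) g)"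
    by (simp add: torus_dist_def)
  also have "\<dots> = fourier_multiplier m T g"
    unfolding fourier_multiplier_def infsum_finite[OF assms(1), symmetric]
    by (rule infsum_cong_neutral) auto
  finally show ?thesis .
qed

end

theory Submission
  imports Defs
begin

text \<open>For \<open>s < 0\<close> a Fourier mode of high frequency \<open>k\<close> costs only \<open>\<bar>k\<bar>\<^sup>s\<close> times its amplitude, so
  modes of bounded amplitude can be added to an approximate solution at almost no cost, provided
  that their frequencies are high enough.  Their quadratic interactions are mostly of high frequency
  and equally cheap.  The exception is a pair of modes \<open>k\<close>, \<open>l\<close> that interact at a given low
  frequency \<open>n\<close>: the product of their amplitudes is a forcing in the mode \<open>n\<close> that can be chosen
  freely.  It is chosen to cancel the error of the approximate solution in that mode.  The solution
  is the limit of infinitely many such corrections, and it starts from zero because every mode does.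

  Let \<open>a n t\<close> be \<open>exp (i n\<^sup>2 t)\<close> times the \<open>n\<close>-th Fourier coefficient of \<open>u\<close> at time \<open>t\<close>.
  In these terms and after integration in time, the equation reads
  \<open>i a n t + \<omega> (sum of the primitives of the interactions at frequency n) = 0\<close>.  The left-hand side,
  with the sum restricted to finitely many modes, is \<open>defect\<close> below.  Only the time primitive of an
  error is ever measured, and this is where the space \<open>C\<^sup>-\<^sup>1\<close> enters: the new modes oscillate fast in time,
  and their time derivatives, which are errors of the equation at their own frequencies, are huge.

  The proof has three parts.

  \<^item> \<open>cancel_defect\<close> makes the defect in one mode as small as desired.  For the pair it uses a slow
    amplitude \<open>\<beta>\<close> and an amplitude \<open>\<gamma>\<close> whose phase undoes that of the interaction, and
    \<open>approximate_by_primitive_of_product\<close> provides \<open>\<beta>\<close> and \<open>\<gamma>\<close>.  For \<open>|u|\<^sup>2\<close> the nonlinearity is real, which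
    forces a relation between the modes \<open>n\<close> and \<open>- n\<close> of any solution; the modes \<open>- k\<close> and \<open>- l\<close> that
    have to be added on this account are small, because the phases in this relation do not match theirs.

  \<^item> \<open>coefficients_exist\<close> iterates this step, visiting every frequency infinitely often.  A resonant
    interaction is about as large as the defect that it cancels, so the new interactions of each step are
    bounded by the decrease of the total defect, up to an error as small as desired.  These decreases
    telescope: the interactions are absolutely summable over pairs of modes.

  \<^item> \<open>solution_from_coefficients\<close> returns to distributions.  A cutoff multiplies the
    interactions by bounded factors that tend to \<open>1\<close>, so absolute summability gives the same limit of
    the nonlinear term for all cutoff sequences (\<open>cutoff_primitive_tendsto\<close>).

  The mode \<open>1\<close> is \<open>t\<close> at the start and is never changed, so the solution does not vanish.\<close>

section \<open>Weights, suprema in time, and series\<close>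

text \<open>The square root of the weight in the \<open>H\<^sup>s\<close> norm.  Everything is estimated in the weighted \<open>l\<^sup>1\<close> norm with
  this weight, which dominates the \<open>H\<^sup>s\<close> norm and adds up over pairs of interacting modes.\<close>

definition weight :: "real \<Rightarrow> int \<Rightarrow> real" where
  "weight s n = (1 + (of_int n)\<^sup>2) powr (s / 2)"

definition snorm :: "(real \<Rightarrow> complex) \<Rightarrow> real" where
  "snorm f = (SUP t\<in>{0..1}. norm (f t))"

lemma weight_pos: "weight s n > 0"
proof -
  have "1 + (real_of_int n)\<^sup>2 > 0" by (rule add_pos_nonneg) auto
  then show ?thesis unfolding weight_def by simp
qed

lemma weight_nonneg [simp]: "weight s n \<ge> 0"
  using weight_pos less_imp_le by blast

lemma weight_square: "(weight s n)\<^sup>2 = (1 + (of_int n)\<^sup>2) powr s"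
  unfolding weight_def power2_eq_square by (simp flip: powr_add)

lemma weight_le_one:
  assumes "s < 0" shows "weight s n \<le> 1"
proof -
  have "(1 + (real_of_int n)\<^sup>2) powr (s / 2) \<le> 1 powr (s/2)"
    by (rule powr_mono2') (use assms in auto)
  then show ?thesis by (simp add: weight_def)
qed

lemma weight_le_powr:
  assumes "s < 0" "L > 0" "L \<le> \<bar>real_of_int n\<bar>" shows "weight s n \<le> L powr s"
proof -
  have "L\<^sup>2 \<le> (real_of_int n)\<^sup>2"
    using assms power_mono[of L "\<bar>real_of_int n\<bar>" 2] by simp
  then have "weight s n \<le> (L\<^sup>2) powr (s / 2)"
    unfolding weight_def by (intro powr_mono2') (use assms in auto)
  also have "\<dots> = L powr s"
    using assms by (simp add: powr_powr flip: powr_numeral)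
  finally show ?thesis .
qed

lemma snorm_upper:
  assumes "continuous_on {0..1} f" "t \<in> {0..1}"
  shows "norm (f t) \<le> snorm f"
proof -
  have "bdd_above ((\<lambda>t. norm (f t)) ` {0..1})"
    by (intro bounded_imp_bdd_above compact_imp_bounded compact_continuous_image
        continuous_intros assms) auto
  then show ?thesis unfolding snorm_def using assms by (intro cSUP_upper) auto
qed

lemma snorm_least:
  assumes "\<And>t. t \<in> {0..1} \<Longrightarrow> norm (f t) \<le> B" shows "snorm f \<le> B"
  unfolding snorm_def by (rule cSUP_least) (use assms in auto)

lemma snorm_nonneg: "continuous_on {0..1} f \<Longrightarrow> 0 \<le> snorm f"
  using snorm_upper[of f 0] norm_ge_zero[of "f 0"] by (meson atLeastAtMost_iff order_trans order_refl zero_le_one)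

lemma snorm_cong:
  assumes "\<And>t. t \<in> {0..1} \<Longrightarrow> norm (f t) = norm (g t)" shows "snorm f = snorm g"
  unfolding snorm_def using assms by (intro SUP_cong) auto

lemma snorm_zero: "(\<And>t. t \<in> {0..1} \<Longrightarrow> f t = 0) \<Longrightarrow> snorm f = 0"
  by (subst snorm_cong[of f "\<lambda>_. 0"]) (auto simp: snorm_def)

lemma snorm_add_le:
  assumes "continuous_on {0..1} f" "continuous_on {0..1} g"
  shows "snorm (\<lambda>t. f t + g t) \<le> snorm f + snorm g"
proof (rule snorm_least)
  fix t :: real assume "t \<in> {0..1}"
  then show "norm (f t + g t) \<le> snorm f + snorm g"
    using norm_triangle_ineq[of "f t" "g t"] snorm_upper[OF assms(1), of t]
      snorm_upper[OF assms(2), of t] by linarith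
qed

lemma snorm_cmult_le:
  assumes "continuous_on {0..1} f"
  shows "snorm (\<lambda>t. c * f t) \<le> norm c * snorm f"
  by (rule snorm_least) (auto simp: norm_mult intro!: mult_left_mono snorm_upper assms)

lemma snorm_sum_le:
  assumes "\<And>x. x \<in> A \<Longrightarrow> continuous_on {0..1} (f x)"
  shows "snorm (\<lambda>t. \<Sum>x\<in>A. f x t) \<le> (\<Sum>x\<in>A. snorm (f x))"
proof (rule snorm_least)
  fix t :: real assume t: "t \<in> {0..1}"
  have "norm (\<Sum>x\<in>A. f x t) \<le> (\<Sum>x\<in>A. norm (f x t))" by (rule norm_sum)
  also have "\<dots> \<le> (\<Sum>x\<in>A. snorm (f x))" by (intro sum_mono snorm_upper assms t)
  finally show "norm (\<Sum>x\<in>A. f x t) \<le> (\<Sum>x\<in>A. snorm (f x))" .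
qed

text \<open>Tannery's theorem: dominated convergence for series.\<close>

lemma infsum_tendsto_dominated:
  fixes f :: "'b \<Rightarrow> 'a \<Rightarrow> 'c::banach"
  assumes lim: "\<And>n. n \<in> A \<Longrightarrow> ((\<lambda>x. f x n) \<longlongrightarrow> g n) F"
    and bound: "\<forall>\<^sub>F x in F. \<forall>n\<in>A. norm (f x n) \<le> h n"
    and h: "h summable_on A"
  shows "((\<lambda>x. \<Sum>\<^sub>\<infinity>n\<in>A. f x n) \<longlongrightarrow> (\<Sum>\<^sub>\<infinity>n\<in>A. g n)) F"
proof (cases "F = bot")
  case False
  define Y where "Y = {x. \<forall>n\<in>A. norm (f x n) \<le> h n}"
  have ev: "\<forall>\<^sub>F x in F. x \<in> Y" using bound by (simp add: Y_def)
  have unif: "uniform_limit Y (\<lambda>X x. \<Sum>n\<in>X. f x n) (\<lambda>x. \<Sum>\<^sub>\<infinity>n\<in>A. f x n) (finite_subsets_at_top A)"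
    by (rule Weierstrass_m_test_general[OF _ h]) (auto simp: Y_def)
  have gle: "norm (g n) \<le> h n" if "n \<in> A" for n
    by (rule tendsto_upperbound[OF tendsto_norm[OF lim[OF that]] _ False])
      (use ev that in \<open>auto simp: Y_def elim!: eventually_mono\<close>)
  have "(\<lambda>n. norm (g n)) summable_on A"
    by (rule Infinite_Sum.abs_summable_on_comparison_test'[OF h gle])
  then have "g summable_on A" by (rule abs_summable_summable)
  then have gs: "((\<lambda>X. \<Sum>n\<in>X. g n) \<longlongrightarrow> (\<Sum>\<^sub>\<infinity>n\<in>A. g n)) (finite_subsets_at_top A)"
    by (rule infsum_tendsto)
  show ?thesis
  proof (rule swap_uniform_limit'[where F="finite_subsets_at_top A" and g="\<lambda>X. \<Sum>n\<in>X. g n" and S=Y])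
    show "\<forall>\<^sub>F X in finite_subsets_at_top A. ((\<lambda>x. \<Sum>n\<in>X. f x n) \<longlongrightarrow> (\<Sum>n\<in>X. g n)) F"
      by (rule eventually_finite_subsets_at_top_weakI) (intro tendsto_sum lim, auto)
  qed (use gs unif ev in auto)
qed auto

section \<open>Characters and test functions on the torus\<close>

lemma continuous_on_character [continuous_intros]: "continuous_on A (character n)"
  unfolding character_def by (intro continuous_intros)

lemma norm_character [simp]: "norm (character n x) = 1"
proof -
  have "character n x = cis (of_int n * x)"
    unfolding character_def cis_conv_exp by (simp add: algebra_simps)
  then show ?thesis by simp
qed

lemma character_mult: "character k x * character l x = character (k + l) x"
  by (simp add: character_def algebra_simps flip: exp_add)

lemma cnj_character: "cnj (character n x) = character (- n) x"
  by (simp add: character_def exp_cnj)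

lemma character_periodic: "character n (x + 2 * pi) = character n x"
proof -
  have "exp (2 * (of_int n * (of_real pi * \<i>))) = 1"
    using exp_integer_2pi[of "of_int n"] by (simp add: algebra_simps)
  then show ?thesis
    unfolding character_def by (simp add: distrib_left exp_add mult_ac)
qed

lemma has_vector_derivative_character:
  "(character n has_vector_derivative \<i> * of_int n * character n x) (at x within A)"
  unfolding character_def
  by (rule has_vector_derivative_real_field) (auto intro!: derivative_eq_intros)

lemma Dx_funpow_character: "(Dx ^^ k) (character n) = (\<lambda>x. (\<i> * of_int n) ^ k * character n x)"
proof (induction k)
  case (Suc k)
  have "((\<lambda>x. (\<i> * of_int n) ^ k * character n x) has_vector_derivative
      (\<i> * of_int n) ^ k * (\<i> * of_int n * character n x)) (at x)" for x
    by (intro has_vector_derivative_mult_right has_vector_derivative_character)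
  then show ?case
    unfolding funpow.simps o_def Suc unfolding Dx_def
    by (intro ext vector_derivative_at) (simp add: mult_ac)
qed simp

lemma character_in_torus_test: "character n \<in> torus_test"
proof -
  have "(Dx ^^ k) (character n) differentiable at x" for k x
    unfolding Dx_funpow_character
    by (rule differentiableI_vector[OF has_vector_derivative_mult_right[OF
          has_vector_derivative_character]])
  then show ?thesis
    by (simp add: torus_test_def periodic_def character_periodic)
qed

lemma torus_test_has_derivative:
  assumes "g \<in> torus_test" shows "(g has_vector_derivative Dx g x) (at x)"
proof -
  have "(Dx ^^ 0) g differentiable at x" using assms unfolding torus_test_def by blast
  then show ?thesis unfolding Dx_def by (simp add: vector_derivative_works)
qed

lemma torus_test_continuous: "g \<in> torus_test \<Longrightarrow> continuous_on A g"
  by (meson continuous_at_imp_continuous_on has_vector_derivative_continuous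
      torus_test_has_derivative)

lemma periodic_vector_derivative:
  assumes "periodic g" "\<And>x. g differentiable at x"
  shows "periodic (\<lambda>x. vector_derivative g (at x))"
  unfolding periodic_def
proof
  fix x
  have "(g has_vector_derivative vector_derivative g (at (x + 2 * pi))) (at (x + 2 * pi))"
    using assms(2) vector_derivative_works by blast
  then have "((g \<circ> (\<lambda>y. y + 2 * pi)) has_vector_derivative
      1 *\<^sub>R vector_derivative g (at (x + 2 * pi))) (at x)"
    by (intro vector_diff_chain_at) (auto intro!: derivative_eq_intros)
  moreover have "g \<circ> (\<lambda>y. y + 2 * pi) = g"
    using assms(1) by (auto simp: periodic_def)
  ultimately show "vector_derivative g (at (x + 2 * pi)) = vector_derivative g (at x)"
    by (simp add: vector_derivative_at)
qed

lemma torus_test_Dx: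
  assumes "g \<in> torus_test" shows "Dx g \<in> torus_test"
proof -
  have d: "(Dx ^^ k) g differentiable at x" for k x
    using assms unfolding torus_test_def by blast
  have "(Dx ^^ k) (Dx g) differentiable at x" for k x
    using d[of "Suc k" x] by (simp add: funpow_Suc_right del: funpow.simps)
  moreover have "periodic (Dx g)"
    unfolding Dx_def by (rule periodic_vector_derivative) (use assms d[of 0] in \<open>auto simp: torus_test_def\<close>)
  ultimately show ?thesis by (simp add: torus_test_def)
qed

lemma torus_test_Dx_funpow: "g \<in> torus_test \<Longrightarrow> (Dx ^^ k) g \<in> torus_test"
  by (induction k) (auto simp: torus_test_Dx)

lemma torus_dist_character_integrable:
  "g \<in> torus_test \<Longrightarrow> (\<lambda>x. character n x * g x) integrable_on {0..2 * pi}"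
  by (intro integrable_continuous_interval continuous_intros torus_test_continuous)

lemma torus_dist_character_add:
  assumes "f \<in> torus_test" "g \<in> torus_test"
  shows "torus_dist (character n) (\<lambda>x. f x + g x) =
    torus_dist (character n) f + torus_dist (character n) g"
  unfolding torus_dist_def distrib_left
  by (rule integral_add; rule torus_dist_character_integrable; fact)

lemma torus_dist_character_cmult:
  "torus_dist (character n) (\<lambda>x. c * g x) = c * torus_dist (character n) g"
proof -
  have "(\<lambda>x. character n x * (c * g x)) = (\<lambda>x. c * (character n x * g x))"
    by (simp add: mult_ac)
  then show ?thesis by (simp add: torus_dist_def)
qed

lemma norm_torus_dist_character_le:
  assumes "continuous_on {0..2 * pi} g" "\<And>x. x \<in> {0..2 * pi} \<Longrightarrow> norm (g x) \<le> B"
  shows "norm (torus_dist (character n) g) \<le> 2 * pi * B"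
proof -
  have "norm (integral {0..2 * pi} (\<lambda>x. character n x * g x)) \<le> B * (2 * pi - 0)"
    by (rule integral_bound) (use assms in \<open>auto simp: norm_mult intro!: continuous_intros\<close>)
  then show ?thesis by (simp add: torus_dist_def mult_ac)
qed

lemma torus_dist_character_Dx:
  assumes "g \<in> torus_test"
  shows "torus_dist (character n) (Dx g) = - (\<i> * of_int n) * torus_dist (character n) g"
proof -
  have "((\<lambda>x. character n x * Dx g x + \<i> * of_int n * (character n x * g x)) has_integral
      character n (2 * pi) * g (2 * pi) - character n 0 * g 0) {0..2 * pi}"
  proof (rule fundamental_theorem_of_calculus)
    fix x
    have "((\<lambda>x. character n x * g x) has_vector_derivative
        character n x * Dx g x + (\<i> * of_int n * character n x) * g x) (at x within {0..2*pi})"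
      by (intro has_vector_derivative_mult has_vector_derivative_character
          has_vector_derivative_at_within[OF torus_test_has_derivative[OF assms]])
    then show "((\<lambda>x. character n x * g x) has_vector_derivative
        character n x * Dx g x + \<i> * of_int n * (character n x * g x)) (at x within {0..2*pi})"
      by (simp add: mult_ac)
  qed simp
  moreover have "character n (2 * pi) * g (2 * pi) = character n 0 * g 0"
    using character_periodic[of n 0] assms
    by (simp add: torus_test_def periodic_def) (metis add_0)
  ultimately have "integral {0..2 * pi}
      (\<lambda>x. character n x * Dx g x + \<i> * of_int n * (character n x * g x)) = 0"
    by (simp add: integral_unique)
  moreover have "integral {0..2 * pi}
      (\<lambda>x. character n x * Dx g x + \<i> * of_int n * (character n x * g x)) =
      torus_dist (character n) (Dx g) + \<i> * of_int n * torus_dist (character n) g"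
    unfolding torus_dist_def
    by (subst integral_add)
      (auto intro!: integrable_on_mult_right torus_dist_character_integrable torus_test_Dx assms)
  ultimately show ?thesis by (simp add: eq_neg_iff_add_eq_0)
qed

lemma torus_dist_character_Dx_funpow:
  assumes "g \<in> torus_test"
  shows "torus_dist (character n) ((Dx ^^ k) g) = (- (\<i> * of_int n)) ^ k * torus_dist (character n) g"
proof (induction k)
  case (Suc k)
  then show ?case
    using torus_dist_character_Dx[OF torus_test_Dx_funpow[OF assms], of n k] by simp
qed simp

text \<open>A bound on the \<open>n\<close>-th Fourier coefficient, and on \<open>n\<^sup>2\<^sup>m\<close> times it for \<open>m = weight_order s\<close>,
  makes it dominated by \<open>weight s n\<close>, since \<open>2 m \<ge> - s\<close>.\<close>

definition weight_order :: "real \<Rightarrow> nat" where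
  "weight_order s = nat \<lceil>- s\<rceil>"

lemma weight_ge_decay:
  fixes G :: real
  assumes "G \<le> C" "\<bar>of_int n\<bar> ^ (2 * weight_order s) * G \<le> C" "0 \<le> G"
  shows "G \<le> 2 ^ weight_order s * C * weight s n"
proof -
  define m where "m = weight_order s"
  define q where "q = 1 + (real_of_int n)\<^sup>2"
  have q1: "q \<ge> 1" by (simp add: q_def)
  have C: "C \<ge> 0" using assms by linarith
  have ms: "- s \<le> real m"
    unfolding m_def weight_order_def by linarith
  have "q ^ m * G \<le> 2 ^ m * C"
  proof (cases "n = 0")
    case True
    then have "q ^ m * G = G" by (simp add: q_def)
    also have "\<dots> \<le> C" by fact
    also have "C = 1 * C" by simp
    also have "\<dots> \<le> 2 ^ m * C" by (intro mult_right_mono C) simp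
    finally show ?thesis .
  next
    case False
    then have "(1::int) \<le> n\<^sup>2" by (metis int_one_le_iff_zero_less zero_less_power2)
    then have "1 \<le> (real_of_int n)\<^sup>2" by (metis of_int_1 of_int_le_iff of_int_power)
    then have "q ^ m \<le> (2 * (real_of_int n)\<^sup>2) ^ m"
      by (intro power_mono) (auto simp: q_def)
    also have "\<dots> = 2 ^ m * \<bar>real_of_int n\<bar> ^ (2 * m)"
      by (simp add: power_mult_distrib power_mult)
    finally have "q ^ m * G \<le> 2 ^ m * \<bar>real_of_int n\<bar> ^ (2 * m) * G"
      using assms(3) by (rule mult_right_mono)
    also have "\<dots> \<le> 2 ^ m * C"
      using assms(2) by (simp add: m_def mult.assoc)
    finally show ?thesis .
  qed
  then have "G \<le> 2 ^ m * C / q ^ m"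
    using q1 by (simp add: field_simps)
  also have "\<dots> = 2 ^ m * C * q powr (- real m)"
    using q1 by (simp add: powr_minus powr_realpow divide_inverse)
  also have "\<dots> \<le> 2 ^ m * C * q powr (s / 2)"
    by (intro mult_left_mono powr_mono) (use q1 ms C in auto)
  finally show ?thesis by (simp add: m_def q_def weight_def)
qed

lemma torus_dist_character_decay:
  assumes g: "g \<in> torus_test"
    and B: "\<And>x. x \<in> {0..2 * pi} \<Longrightarrow> norm (g x) \<le> B"
      "\<And>x. x \<in> {0..2 * pi} \<Longrightarrow> norm ((Dx ^^ (2 * weight_order s)) g x) \<le> B"
  shows "norm (torus_dist (character n) g) \<le> 2 ^ weight_order s * (2 * pi * B) * weight s n"
proof (rule weight_ge_decay)
  show "norm (torus_dist (character n) g) \<le> 2 * pi * B"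
    by (intro norm_torus_dist_character_le torus_test_continuous g B)
  have "norm (torus_dist (character n) ((Dx ^^ (2 * weight_order s)) g)) \<le> 2 * pi * B"
    by (intro norm_torus_dist_character_le torus_test_continuous torus_test_Dx_funpow g B)
  then show "\<bar>of_int n\<bar> ^ (2 * weight_order s) * norm (torus_dist (character n) g) \<le> 2 * pi * B"
    by (simp add: torus_dist_character_Dx_funpow[OF g] norm_mult norm_power)
qed simp

text \<open>Test functions have Fourier coefficients dominated by the weight, hence pair with every sequence
  of coefficients in weighted \<open>l\<^sup>1\<close>.\<close>

lemma torus_test_decay:
  assumes "g \<in> torus_test"
  shows "\<exists>C\<ge>0. \<forall>n. norm (torus_dist (character n) g) \<le> C * weight s n"
proof -
  have "\<exists>B\<ge>0. \<forall>x\<in>{0..2 * pi}. norm (h x) \<le> B" if "h \<in> torus_test" for h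
  proof -
    have "bounded (h ` {0..2 * pi})"
      by (intro compact_imp_bounded compact_continuous_image torus_test_continuous that) auto
    then show ?thesis
      using bounded_pos by (metis imageI less_imp_le)
  qed
  from this[OF assms] this[OF torus_test_Dx_funpow[OF assms]]
  obtain B1 B2 where "B1 \<ge> 0" "B2 \<ge> 0" "\<forall>x\<in>{0..2 * pi}. norm (g x) \<le> B1"
    "\<forall>x\<in>{0..2 * pi}. norm ((Dx ^^ (2 * weight_order s)) g x) \<le> B2" by metis
  then have "norm (torus_dist (character n) g)
      \<le> 2 ^ weight_order s * (2 * pi * max B1 B2) * weight s n" for n
    by (intro torus_dist_character_decay assms) (auto simp: le_max_iff_disj)
  then show ?thesis
    using \<open>B1 \<ge> 0\<close> by (intro exI[of _ "2 ^ weight_order s * (2 * pi * max B1 B2)"]) auto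
qed

section \<open>Space-time test functions\<close>

lemma ST_test_on_continuous: "f \<in> ST_test_on a b \<Longrightarrow> continuous_on UNIV (\<lambda>(t, x). f t x)"
  unfolding ST_test_on_def by (auto dest: spec[of _ 0])

lemma ST_test_on_Ck: "f \<in> ST_test_on a b \<Longrightarrow> ST_Ck k f"
  unfolding ST_test_on_def by auto

lemma ST_Ck_Suc_derivatives:
  assumes "ST_Ck (Suc k) f"
  shows "((\<lambda>r. f r x) has_vector_derivative ST_Dt f t x) (at t)"
    "(f t has_vector_derivative ST_Dx f t x) (at x)"
  using assms by (auto simp: ST_Dt_def ST_Dx_def simp flip: vector_derivative_works)

lemma ST_test_on_has_derivatives:
  assumes "f \<in> ST_test_on a b"
  shows "((\<lambda>r. f r x) has_vector_derivative ST_Dt f t x) (at t)"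
    "(f t has_vector_derivative ST_Dx f t x) (at x)"
  using ST_Ck_Suc_derivatives ST_test_on_Ck[OF assms] by blast+

lemma ST_test_on_Dx:
  assumes "f \<in> ST_test_on a b" shows "ST_Dx f \<in> ST_test_on a b"
proof -
  have "ST_Ck k (ST_Dx f)" for k using ST_test_on_Ck[OF assms, of "Suc k"] by simp
  moreover have "periodic (ST_Dx f t)" for t
    unfolding ST_Dx_def
    by (rule periodic_vector_derivative)
      (use assms ST_test_on_has_derivatives(2)[OF assms] in
        \<open>auto simp: ST_test_on_def intro: differentiableI_vector\<close>)
  moreover have "ST_Dx f t x = 0" if "t \<notin> {a..b}" for t x
  proof -
    have "f t = (\<lambda>_. 0)" using assms that by (auto simp: ST_test_on_def)
    then show ?thesis by (simp add: ST_Dx_def)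
  qed
  ultimately show ?thesis by (auto simp: ST_test_on_def)
qed

lemma ST_test_on_Dt:
  assumes "f \<in> ST_test_on a b" shows "ST_Dt f \<in> ST_test_on a b"
proof -
  have "ST_Ck k (ST_Dt f)" for k using ST_test_on_Ck[OF assms, of "Suc k"] by simp
  moreover have "periodic (ST_Dt f t)" for t
    using assms by (auto simp: ST_test_on_def periodic_def ST_Dt_def)
  moreover have "ST_Dt f t x = 0" if "t \<notin> {a..b}" for t x
  proof -
    have "((\<lambda>_. 0) has_vector_derivative 0) (at t)" by simp
    then have "((\<lambda>r. f r x) has_vector_derivative 0) (at t)"
      by (rule has_vector_derivative_transform_within_open[of _ _ _ "- {a..b}"])
        (use that assms in \<open>auto simp: ST_test_on_def\<close>)
    then show ?thesis by (simp add: ST_Dt_def vector_derivative_at)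
  qed
  ultimately show ?thesis by (auto simp: ST_test_on_def)
qed

lemma ST_test_on_Dx_funpow: "f \<in> ST_test_on a b \<Longrightarrow> (ST_Dx ^^ k) f \<in> ST_test_on a b"
  by (induction k) (auto simp: ST_test_on_Dx)

lemma ST_Dx_funpow: "(ST_Dx ^^ k) f t = (Dx ^^ k) (f t)"
  by (induction k) (auto simp: ST_Dx_def Dx_def)

lemma ST_test_on_slice:
  assumes "f \<in> ST_test_on a b" shows "f t \<in> torus_test"
proof -
  have "(Dx ^^ k) (f t) differentiable at x" for k x
    using ST_test_on_has_derivatives(2)[OF ST_test_on_Dx_funpow[OF assms, of k], of t x]
    by (auto simp: ST_Dx_funpow intro: differentiableI_vector)
  then show ?thesis using assms by (auto simp: torus_test_def ST_test_on_def)
qed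

lemma ST_Ck_lincomb:
  "ST_Ck k f \<Longrightarrow> ST_Ck k g \<Longrightarrow> ST_Ck k (\<lambda>t x. c * f t x + d * g t x)"
proof (induction k arbitrary: f g)
  case 0
  then show ?case by (auto simp: split_beta intro!: continuous_intros)
next
  case (Suc k)
  note f = ST_Ck_Suc_derivatives[OF Suc.prems(1)] and g = ST_Ck_Suc_derivatives[OF Suc.prems(2)]
  have t: "((\<lambda>r. c * f r x + d * g r x) has_vector_derivative
      c * ST_Dt f t x + d * ST_Dt g t x) (at t)" for t x
    by (intro has_vector_derivative_add has_vector_derivative_mult_right f g)
  have x: "((\<lambda>x. c * f t x + d * g t x) has_vector_derivative
      c * ST_Dx f t x + d * ST_Dx g t x) (at x)" for t x
    by (intro has_vector_derivative_add has_vector_derivative_mult_right f g)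
  have "ST_Dt (\<lambda>t x. c * f t x + d * g t x) = (\<lambda>t x. c * ST_Dt f t x + d * ST_Dt g t x)"
    by (intro ext) (use t in \<open>simp add: ST_Dt_def vector_derivative_at\<close>)
  moreover have "ST_Dx (\<lambda>t x. c * f t x + d * g t x) = (\<lambda>t x. c * ST_Dx f t x + d * ST_Dx g t x)"
    by (intro ext) (use x in \<open>simp add: ST_Dx_def vector_derivative_at\<close>)
  moreover have "continuous_on UNIV (\<lambda>(t, x). c * f t x + d * g t x)"
    using Suc.prems by (auto simp: split_beta intro!: continuous_intros)
  ultimately show ?case
    using Suc.prems Suc.IH t x by (auto intro: differentiableI_vector)
qed

lemma ST_derivative_lincomb:
  assumes "f \<in> ST_test_on a b" "g \<in> ST_test_on a' b'"
  shows "ST_Dt (\<lambda>t x. c * f t x + d * g t x) = (\<lambda>t x. c * ST_Dt f t x + d * ST_Dt g t x)"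
    "ST_Dx (\<lambda>t x. c * f t x + d * g t x) = (\<lambda>t x. c * ST_Dx f t x + d * ST_Dx g t x)"
  unfolding ST_Dt_def[of "\<lambda>t x. c * f t x + d * g t x"] ST_Dx_def[of "\<lambda>t x. c * f t x + d * g t x"]
  by (intro ext vector_derivative_at has_vector_derivative_add has_vector_derivative_mult_right
      ST_test_on_has_derivatives[OF assms(1)] ST_test_on_has_derivatives[OF assms(2)])+

lemma ST_testE:
  assumes "f \<in> ST_test" obtains a b where "0 < a" "b < 1" "f \<in> ST_test_on a b"
  using assms unfolding ST_test_def by blast

lemma ST_test_onI: "0 < a \<Longrightarrow> b < 1 \<Longrightarrow> f \<in> ST_test_on a b \<Longrightarrow> f \<in> ST_test"
  unfolding ST_test_def by blast

lemma ST_test_Dt: "f \<in> ST_test \<Longrightarrow> ST_Dt f \<in> ST_test"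
  by (meson ST_testE ST_test_onI ST_test_on_Dt)

lemma ST_test_Dx: "f \<in> ST_test \<Longrightarrow> ST_Dx f \<in> ST_test"
  by (meson ST_testE ST_test_onI ST_test_on_Dx)

lemma ST_test_slice: "f \<in> ST_test \<Longrightarrow> f t \<in> torus_test"
  by (meson ST_testE ST_test_on_slice)

lemma ST_test_lincomb:
  assumes "f \<in> ST_test" "g \<in> ST_test" shows "(\<lambda>t x. c * f t x + d * g t x) \<in> ST_test"
proof -
  obtain a b a' b' where ab: "0 < a" "b < 1" "f \<in> ST_test_on a b"
    "0 < a'" "b' < 1" "g \<in> ST_test_on a' b'" using assms by (metis ST_testE)
  have "f t x = 0 \<and> g t x = 0" if "t \<notin> {min a a'..max b b'}" for t x
  proof -
    have "t \<notin> {a..b}" "t \<notin> {a'..b'}" using that by auto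
    then show ?thesis using ab by (auto simp: ST_test_on_def)
  qed
  then have "(\<lambda>t x. c * f t x + d * g t x) \<in> ST_test_on (min a a') (max b b')"
    using ab ST_Ck_lincomb by (auto simp: ST_test_on_def periodic_def)
  then show ?thesis by (rule ST_test_onI[rotated 2]) (use ab in auto)
qed

section \<open>Fourier coefficients of space-time test functions\<close>

text \<open>This is \<open>2 * pi\<close> times the Fourier coefficient of index \<open>- n\<close> of \<open>f t\<close>.\<close>

definition ST_pairing :: "int \<Rightarrow> (real \<Rightarrow> real \<Rightarrow> complex) \<Rightarrow> real \<Rightarrow> complex" where
  "ST_pairing n f t = torus_dist (character n) (f t)"

lemma ST_pairing_lincomb:
  assumes "f \<in> ST_test" "g \<in> ST_test"
  shows "ST_pairing n (\<lambda>t x. c * f t x + d * g t x) t = c * ST_pairing n f t + d * ST_pairing n g t"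
proof -
  have "(\<lambda>x. c * h t x) \<in> torus_test" if "h \<in> ST_test" for h c
    using ST_test_slice[OF ST_test_lincomb[OF that that, of c 0], of t] by simp
  then show ?thesis
    unfolding ST_pairing_def using assms
    by (subst torus_dist_character_add) (simp_all only: torus_dist_character_cmult)
qed

lemma ST_pairing_Dx:
  assumes "f \<in> ST_test"
  shows "ST_pairing n (ST_Dx f) t = - (\<i> * of_int n) * ST_pairing n f t"
proof -
  have "ST_Dx f t = Dx (f t)" by (simp add: ST_Dx_def Dx_def)
  then show ?thesis unfolding ST_pairing_def
    using torus_dist_character_Dx[OF ST_test_slice[OF assms]] by simp
qed

lemma ST_pairing_Dxx:
  assumes "f \<in> ST_test"
  shows "ST_pairing n (ST_Dx (ST_Dx f)) t = - (of_int n)\<^sup>2 * ST_pairing n f t"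
proof -
  have "(\<i> * of_int n) * ((\<i> * of_int n) * z) = (\<i> * \<i>) * ((of_int n)\<^sup>2 * z)" for z :: complex
    by (simp only: power2_eq_square mult_ac)
  then show ?thesis using assms by (simp add: ST_pairing_Dx ST_test_Dx)
qed

lemma ST_pairing_has_derivative:
  assumes "f \<in> ST_test"
  shows "(ST_pairing n f has_vector_derivative ST_pairing n (ST_Dt f) t) (at t)"
proof -
  obtain a b where f: "f \<in> ST_test_on a b" using assms by (rule ST_testE)
  have c: "continuous_on UNIV (\<lambda>(t, x). ST_Dt f t x)"
    using ST_test_on_continuous[OF ST_test_on_Dt[OF f]] .
  have "((\<lambda>t. integral (cbox 0 (2 * pi)) (\<lambda>x. character n x * f t x)) has_vector_derivative
      integral (cbox 0 (2 * pi)) (\<lambda>x. character n x * ST_Dt f t x)) (at t within UNIV)"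
  proof (rule leibniz_rule_vector_derivative)
    show "((\<lambda>t. character n x * f t x) has_vector_derivative character n x * ST_Dt f t x)
        (at t within UNIV)" for t x
      by (intro has_vector_derivative_mult_right ST_test_on_has_derivatives[OF f])
    show "(\<lambda>x. character n x * f t x) integrable_on cbox 0 (2 * pi)" for t
      using torus_dist_character_integrable[OF ST_test_slice[OF assms]] by simp
    show "continuous_on (UNIV \<times> cbox 0 (2 * pi)) (\<lambda>(t, x). character n x * ST_Dt f t x)"
      unfolding split_beta
      by (intro continuous_intros continuous_on_compose2[OF continuous_on_character, of _ snd UNIV]
          continuous_on_subset[OF c[unfolded split_beta]]) auto
  qed auto
  moreover have "ST_pairing n f = (\<lambda>t. integral (cbox 0 (2 * pi)) (\<lambda>x. character n x * f t x))"
    by (simp add: ST_pairing_def torus_dist_def fun_eq_iff)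
  ultimately show ?thesis by (simp add: ST_pairing_def torus_dist_def)
qed

lemma ST_pairing_continuous: "f \<in> ST_test \<Longrightarrow> continuous_on A (ST_pairing n f)"
  by (meson continuous_at_imp_continuous_on has_vector_derivative_continuous
      ST_pairing_has_derivative)

lemma ST_pairing_vanishes_at_ends:
  assumes "f \<in> ST_test" shows "ST_pairing n f 0 = 0" "ST_pairing n f 1 = 0"
proof -
  obtain a b where "0 < a" "b < 1" "f \<in> ST_test_on a b" using assms by (rule ST_testE)
  then have "f 0 = (\<lambda>_. 0)" "f 1 = (\<lambda>_. 0)" by (auto simp: ST_test_on_def)
  then show "ST_pairing n f 0 = 0" "ST_pairing n f 1 = 0"
    by (simp_all add: ST_pairing_def torus_dist_def)
qed

lemma ST_pairing_Dt_Dx_funpow: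
  assumes "f \<in> ST_test"
  shows "ST_pairing n (ST_Dt ((ST_Dx ^^ k) f)) t = (- (\<i> * of_int n)) ^ k * ST_pairing n (ST_Dt f) t"
proof -
  have k: "(ST_Dx ^^ k) f \<in> ST_test" by (induction k) (auto simp: assms ST_test_Dx)
  have "ST_pairing n ((ST_Dx ^^ k) f) = (\<lambda>t. (- (\<i> * of_int n)) ^ k * ST_pairing n f t)"
    unfolding ST_pairing_def ST_Dx_funpow
    using torus_dist_character_Dx_funpow[OF ST_test_slice[OF assms]] by (intro ext) simp
  then have "(ST_pairing n ((ST_Dx ^^ k) f) has_vector_derivative
      (- (\<i> * of_int n)) ^ k * ST_pairing n (ST_Dt f) t) (at t)"
    by (simp only:) (intro has_vector_derivative_mult_right ST_pairing_has_derivative assms)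
  with ST_pairing_has_derivative[OF k] show ?thesis by (rule vector_derivative_unique_at)
qed

text \<open>The bound for \<open>ST_Dt f\<close> goes through the time derivative of the pairing with
  \<open>(ST_Dx ^^ k) f\<close>, so that only derivatives in the order \<open>ST_Dt\<close> after \<open>ST_Dx\<close> enter and the
  symmetry of mixed derivatives is avoided.\<close>

lemma ST_pairing_decay:
  assumes f: "f \<in> ST_test"
    and B: "\<And>j k x. j \<le> 1 \<Longrightarrow> k \<le> 2 * weight_order s + 2 \<Longrightarrow> x \<in> {0..2*pi} \<Longrightarrow>
      norm ((ST_Dt ^^ j) ((ST_Dx ^^ k) f) t x) \<le> B"
  defines "C \<equiv> 2 ^ weight_order s * (2 * pi * B)"
  shows "norm (ST_pairing n f t) \<le> C * weight s n"
    and "norm (ST_pairing n (ST_Dt f) t) \<le> C * weight s n"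
    and "norm (ST_pairing n (ST_Dx (ST_Dx f)) t) \<le> C * weight s n"
proof -
  have x: "norm ((Dx ^^ k) (f t) x) \<le> B" if "k \<le> 2 * weight_order s + 2" "x \<in> {0..2*pi}" for k x
    using B[of 0 k x] that by (simp add: ST_Dx_funpow)
  show "norm (ST_pairing n f t) \<le> C * weight s n"
    unfolding ST_pairing_def C_def
    by (rule torus_dist_character_decay[OF ST_test_slice[OF f]]) (use x[of 0] x in auto)
  have "ST_pairing n (ST_Dx (ST_Dx f)) t = torus_dist (character n) ((Dx ^^ 2) (f t))"
    by (simp add: ST_pairing_def ST_Dx_def Dx_def numeral_2_eq_2)
  moreover have "norm (torus_dist (character n) ((Dx ^^ 2) (f t))) \<le> C * weight s n"
    unfolding C_def
  proof (rule torus_dist_character_decay[OF torus_test_Dx_funpow[OF ST_test_slice[OF f]]])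
    have "(Dx ^^ (2 * weight_order s)) ((Dx ^^ 2) (f t)) = (Dx ^^ (2 * weight_order s + 2)) (f t)"
      by (simp only: funpow_add o_def)
    then show "norm ((Dx ^^ (2 * weight_order s)) ((Dx ^^ 2) (f t)) x) \<le> B"
      if "x \<in> {0..2 * pi}" for x
      using x[of "2 * weight_order s + 2" x] that by simp
  qed (use x[of 2] in auto)
  ultimately show "norm (ST_pairing n (ST_Dx (ST_Dx f)) t) \<le> C * weight s n" by simp
  have *: "norm (ST_pairing n (ST_Dt ((ST_Dx ^^ k) f)) t) \<le> 2 * pi * B"
    if "k \<le> 2 * weight_order s" for k
    unfolding ST_pairing_def
  proof (rule norm_torus_dist_character_le)
    have "(ST_Dx ^^ k) f \<in> ST_test" by (induction k) (auto simp: f ST_test_Dx)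
    then show "continuous_on {0..2 * pi} (ST_Dt ((ST_Dx ^^ k) f) t)"
      by (intro torus_test_continuous ST_test_slice ST_test_Dt)
  qed (use B[of 1 k] that in auto)
  show "norm (ST_pairing n (ST_Dt f) t) \<le> C * weight s n"
    unfolding C_def
  proof (rule weight_ge_decay)
    show "norm (ST_pairing n (ST_Dt f) t) \<le> 2 * pi * B" using *[of 0] by simp
    show "\<bar>of_int n\<bar> ^ (2 * weight_order s) * norm (ST_pairing n (ST_Dt f) t) \<le> 2 * pi * B"
      using *[of "2 * weight_order s"]
      by (simp add: ST_pairing_Dt_Dx_funpow[OF f] norm_mult norm_power)
  qed simp
qed

text \<open>The derivatives of a single test function are bounded uniformly in time by compactness.\<close>

lemma ST_pairing_uniform_decay:
  assumes "f \<in> ST_test"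
  shows "\<exists>C\<ge>0. \<forall>t\<in>{0..1}. \<forall>n. norm (ST_pairing n f t) \<le> C * weight s n"
proof -
  obtain a b where f: "f \<in> ST_test_on a b" using assms by (rule ST_testE)
  have bdd: "\<exists>B\<ge>0. \<forall>t\<in>{0..1}. \<forall>x\<in>{0..2 * pi}. norm (h t x) \<le> B" if "h \<in> ST_test_on a b" for h
  proof -
    have "bounded ((\<lambda>(t, x). h t x) ` ({0..1} \<times> {0..2 * pi}))"
      by (intro compact_imp_bounded compact_continuous_image compact_Times
          continuous_on_subset[OF ST_test_on_continuous[OF that]]) auto
    then obtain B where B: "B > 0" "\<And>y. y \<in> (\<lambda>(t, x). h t x) ` ({0..1} \<times> {0..2 * pi}) \<Longrightarrow> norm y \<le> B"
      unfolding bounded_pos by blast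
    have "norm (h t x) \<le> B" if "t \<in> {0..1}" "x \<in> {0..2 * pi}" for t x
      by (rule B(2), rule image_eqI[of _ _ "(t, x)"]) (use that in auto)
    with B(1) show ?thesis by (intro exI[of _ B] conjI ballI) simp_all
  qed
  obtain B1 where B1: "B1 \<ge> 0" "\<forall>t\<in>{0..1}. \<forall>x\<in>{0..2 * pi}. norm (f t x) \<le> B1"
    using bdd[OF f] by blast
  obtain B2 where B2: "\<forall>t\<in>{0..1}. \<forall>x\<in>{0..2 * pi}. norm ((ST_Dx ^^ (2 * weight_order s)) f t x) \<le> B2"
    using bdd[OF ST_test_on_Dx_funpow[OF f, of "2 * weight_order s"]] by blast
  have "norm (ST_pairing n f t) \<le> 2 ^ weight_order s * (2 * pi * max B1 B2) * weight s n"
    if t: "t \<in> {0..1}" for n t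
    unfolding ST_pairing_def
  proof (rule torus_dist_character_decay[OF ST_test_slice[OF assms]])
    fix x :: real assume x: "x \<in> {0..2 * pi}"
    show "norm (f t x) \<le> max B1 B2"
      using B1(2)[rule_format, OF t x] by (rule max.coboundedI1)
    show "norm ((Dx ^^ (2 * weight_order s)) (f t) x) \<le> max B1 B2"
      using B2[rule_format, OF t x] unfolding ST_Dx_funpow by (rule max.coboundedI2)
  qed
  moreover have "0 \<le> 2 ^ weight_order s * (2 * pi * max B1 B2)"
    by (intro mult_nonneg_nonneg) (simp_all add: B1 le_max_iff_disj)
  ultimately show ?thesis by blast
qed

section \<open>Distributions given by Fourier series\<close>

definition torus_series :: "(int \<Rightarrow> complex) \<Rightarrow> torus_functional" where
  "torus_series z = (\<lambda>g. \<Sum>\<^sub>\<infinity>n. z n * torus_dist (character n) g)"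

lemma torus_series_summable:
  assumes z: "(\<lambda>n. weight s n * norm (z n)) summable_on UNIV" and g: "g \<in> torus_test"
  shows "(\<lambda>n. z n * torus_dist (character n) g) summable_on UNIV"
proof -
  obtain C where C: "C \<ge> 0" "\<And>n. norm (torus_dist (character n) g) \<le> C * weight s n"
    using torus_test_decay[OF g] by blast
  have "(\<lambda>n. norm (z n * torus_dist (character n) g)) summable_on UNIV"
  proof (rule Infinite_Sum.abs_summable_on_comparison_test'[OF summable_on_cmult_right[OF z, of C]])
    show "norm (z n * torus_dist (character n) g) \<le> C * (weight s n * norm (z n))" for n
      using mult_left_mono[OF C(2)[of n], of "norm (z n)"] by (simp add: norm_mult mult_ac)
  qed
  then show ?thesis by (rule abs_summable_summable)
qed

lemma fourier_coeff_torus_series [simp]: "fourier_coeff (torus_series z) n = z n"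
proof -
  have "torus_series z (character (- n)) = (\<Sum>\<^sub>\<infinity>k\<in>{n}. z k * (2 * of_real pi))"
    unfolding torus_series_def
    by (rule infsum_cong_neutral) (auto simp: torus_dist_character)
  then show ?thesis by (simp add: fourier_coeff_def)
qed

text \<open>Weighted \<open>l\<^sup>1\<close> coefficients grow at most polynomially, and finitely many derivatives of the test
  function compensate for that.\<close>

lemma torus_series_distribution:
  assumes z: "(\<lambda>n. weight s n * norm (z n)) summable_on UNIV"
  shows "torus_distribution (torus_series z)"
  unfolding torus_distribution_def
proof (intro conjI ballI allI)
  fix f g :: "real \<Rightarrow> complex" assume fg: "f \<in> torus_test" "g \<in> torus_test"
  show "torus_series z (\<lambda>x. f x + g x) = torus_series z f + torus_series z g"
    unfolding torus_series_def
    by (simp add: torus_dist_character_add[OF fg] distrib_left infsum_add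
        torus_series_summable[OF z] fg)
next
  fix c :: complex and f :: "real \<Rightarrow> complex" assume f: "f \<in> torus_test"
  have "(\<Sum>\<^sub>\<infinity>n. z n * (c * torus_dist (character n) f)) =
      (\<Sum>\<^sub>\<infinity>n. c * (z n * torus_dist (character n) f))"
    by (simp add: mult_ac)
  then show "torus_series z (\<lambda>x. c * f x) = c * torus_series z f"
    unfolding torus_series_def torus_dist_character_cmult
    by (simp add: infsum_cmult_right torus_series_summable[OF z f])
next
  define S where "S = (\<Sum>\<^sub>\<infinity>n. weight s n * norm (z n))"
  show "\<exists>C m. \<forall>f\<in>torus_test. \<forall>B. (\<forall>k\<le>m. \<forall>x. norm ((Dx ^^ k) f x) \<le> B) \<longrightarrow>
      norm (torus_series z f) \<le> C * B"
  proof (intro exI ballI allI impI)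
    fix f B assume f: "f \<in> torus_test"
      and B: "\<forall>k\<le>2 * weight_order s. \<forall>x. norm ((Dx ^^ k) f x) \<le> B"
    define C where "C = 2 ^ weight_order s * (2 * pi * B)"
    have d: "norm (torus_dist (character n) f) \<le> C * weight s n" for n
      unfolding C_def
      by (rule torus_dist_character_decay[OF f]) (use B[rule_format, of 0] B in auto)
    have le: "norm (z n * torus_dist (character n) f) \<le> C * (weight s n * norm (z n))" for n
      using mult_left_mono[OF d[of n], of "norm (z n)"] by (simp add: norm_mult mult_ac)
    have "norm (torus_series z f) \<le> (\<Sum>\<^sub>\<infinity>n. C * (weight s n * norm (z n)))"
      unfolding torus_series_def
      by (rule norm_infsum_le[OF has_sum_infsum[OF torus_series_summable[OF z f]]
            has_sum_infsum[OF summable_on_cmult_right[OF z]] le])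
    also have "\<dots> = C * S" by (simp add: S_def infsum_cmult_right z)
    finally show "norm (torus_series z f) \<le> (2 ^ weight_order s * (2 * pi) * S) * B"
      by (simp add: C_def mult_ac)
  qed
qed

text \<open>The \<open>H\<^sup>s\<close> norm is a weighted \<open>l\<^sup>2\<close> norm, hence at most the weighted \<open>l\<^sup>1\<close> norm.\<close>

lemma Hs_norm_le_l1:
  assumes z: "(\<lambda>n. weight s n * norm (fourier_coeff T n)) summable_on UNIV"
  shows "(\<lambda>n. (norm (fourier_coeff T n))\<^sup>2 * (1 + (of_int n)\<^sup>2) powr s) summable_on UNIV"
    and "Hs_norm s T \<le> (\<Sum>\<^sub>\<infinity>n. weight s n * norm (fourier_coeff T n))"
proof -
  define a where "a n = weight s n * norm (fourier_coeff T n)" for n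
  define S where "S = (\<Sum>\<^sub>\<infinity>n. a n)"
  have a: "a summable_on UNIV" "\<And>n. 0 \<le> a n" using z by (simp_all add: a_def[abs_def])
  have aS: "a n \<le> S" for n
    using finite_sum_le_infsum[OF a(1), of "{n}"] a(2) by (simp add: S_def)
  have sq: "(norm (fourier_coeff T n))\<^sup>2 * (1 + (of_int n)\<^sup>2) powr s = a n * a n" for n
    unfolding a_def weight_square[symmetric] by (simp only: power2_eq_square mult_ac)
  have le: "a n * a n \<le> S * a n" for n by (intro mult_right_mono aS a)
  have summ: "(\<lambda>n. a n * a n) summable_on UNIV"
    by (rule summable_on_comparison_test[OF summable_on_cmult_right[OF a(1), of S] le])
      (simp add: a(2))
  then show "(\<lambda>n. (norm (fourier_coeff T n))\<^sup>2 * (1 + (of_int n)\<^sup>2) powr s) summable_on UNIV"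
    by (simp only: sq)
  have S0: "0 \<le> S" unfolding S_def by (rule infsum_nonneg) (simp add: a(2))
  have "(\<Sum>\<^sub>\<infinity>n. a n * a n) \<le> (\<Sum>\<^sub>\<infinity>n. S * a n)"
    by (rule infsum_mono[OF summ summable_on_cmult_right[OF a(1)] le])
  also have "\<dots> = S\<^sup>2"
    by (simp add: infsum_cmult_right a S_def[symmetric] power2_eq_square)
  finally have "Hs_norm s T \<le> sqrt (S\<^sup>2)"
    unfolding Hs_norm_def sq by (rule real_sqrt_le_mono)
  then show "Hs_norm s T \<le> (\<Sum>\<^sub>\<infinity>n. weight s n * norm (fourier_coeff T n))"
    using S0 by (simp add: S_def a_def)
qed

lemma Hs_norm_nonneg: "0 \<le> Hs_norm s T"
  unfolding Hs_norm_def by (intro real_sqrt_ge_zero infsum_nonneg) simp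

lemma torus_series_in_Hs:
  assumes "(\<lambda>n. weight s n * norm (z n)) summable_on UNIV"
  shows "torus_series z \<in> Hs s"
  unfolding Hs_def
  using torus_series_distribution[OF assms] Hs_norm_le_l1(1)[of s "torus_series z"] assms by simp

lemma fourier_coeff_diff:
  "fourier_coeff (\<lambda>g. S g - T g) n = fourier_coeff S n - fourier_coeff T n"
  by (simp add: fourier_coeff_def diff_divide_distrib)

section \<open>Curves of distributions\<close>

text \<open>The supremum in time is taken mode by mode, before the summation, so that a single summable majorant
  serves all times.\<close>

definition weighted_family :: "real \<Rightarrow> (int \<Rightarrow> real \<Rightarrow> complex) \<Rightarrow> bool" where
  "weighted_family s z \<longleftrightarrow> (\<forall>n. continuous_on {0..1} (z n)) \<and>
     (\<lambda>n. weight s n * snorm (z n)) summable_on UNIV"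

definition curve :: "(int \<Rightarrow> real \<Rightarrow> complex) \<Rightarrow> real \<Rightarrow> torus_functional" where
  "curve z t = torus_series (\<lambda>n. z n t)"

lemma weighted_familyD:
  assumes "weighted_family s z"
  shows "continuous_on {0..1} (z n)" "(\<lambda>n. weight s n * snorm (z n)) summable_on UNIV"
  using assms by (auto simp: weighted_family_def)

lemma weighted_family_summable:
  assumes "weighted_family s z" "t \<in> {0..1}"
  shows "(\<lambda>n. weight s n * norm (z n t)) summable_on UNIV"
  by (rule summable_on_comparison_test[OF weighted_familyD(2)[OF assms(1)]])
    (auto intro!: mult_left_mono snorm_upper weighted_familyD(1)[OF assms(1)] assms(2))

lemma weighted_family_diff:
  assumes "weighted_family s z" "weighted_family s y"
  shows "weighted_family s (\<lambda>n t. z n t - y n t)"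
  unfolding weighted_family_def
proof (intro conjI allI)
  note c = weighted_familyD(1)[OF assms(1)] weighted_familyD(1)[OF assms(2)]
  show cd: "continuous_on {0..1} (\<lambda>t. z n t - y n t)" for n
    by (intro continuous_intros c)
  have "snorm (\<lambda>t. z n t - y n t) \<le> snorm (z n) + snorm (y n)" for n
    using snorm_add_le[of "z n" "\<lambda>t. - y n t"] snorm_cong[of "\<lambda>t. - y n t" "y n"]
    by (simp add: c continuous_intros)
  then have "weight s n * snorm (\<lambda>t. z n t - y n t)
      \<le> weight s n * snorm (z n) + weight s n * snorm (y n)" for n
    by (simp add: mult_left_mono flip: distrib_left)
  then show "(\<lambda>n. weight s n * snorm (\<lambda>t. z n t - y n t)) summable_on UNIV"
    by (rule summable_on_comparison_test[OF summable_on_add[OF weighted_familyD(2)[OF assms(1)]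
            weighted_familyD(2)[OF assms(2)]]]) (simp add: snorm_nonneg cd)
qed

lemma weighted_family_mult:
  assumes z: "weighted_family s z"
    and e: "\<And>n. continuous_on {0..1} (e n)" "\<And>n t. norm (e n t) \<le> C"
  shows "weighted_family s (\<lambda>n t. e n t * z n t)"
  unfolding weighted_family_def
proof (intro conjI allI)
  have C: "C \<ge> 0" using e(2)[of 0 0] norm_ge_zero order_trans by blast
  show c: "continuous_on {0..1} (\<lambda>t. e n t * z n t)" for n
    by (intro continuous_intros e weighted_familyD(1)[OF z])
  have "snorm (\<lambda>t. e n t * z n t) \<le> C * snorm (z n)" for n
    by (rule snorm_least)
      (auto simp: norm_mult intro!: mult_mono e snorm_upper weighted_familyD(1)[OF z] C)
  then have "weight s n * snorm (\<lambda>t. e n t * z n t) \<le> C * (weight s n * snorm (z n))" for n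
    using mult_left_mono[OF _ weight_nonneg[of s n], of "snorm (\<lambda>t. e n t * z n t)" "C * snorm (z n)"]
    by (simp add: mult.left_commute)
  then show "(\<lambda>n. weight s n * snorm (\<lambda>t. e n t * z n t)) summable_on UNIV"
    by (rule summable_on_comparison_test[OF summable_on_cmult_right[OF weighted_familyD(2)[OF z]]])
      (simp add: snorm_nonneg c)
qed

lemma curve_in_C0_Hs:
  assumes z: "weighted_family s z" shows "curve z \<in> C0_Hs s"
  unfolding C0_Hs_def
proof (intro CollectI conjI ballI)
  show "curve z t \<in> Hs s" if "t \<in> {0..1}" for t
    unfolding curve_def by (intro torus_series_in_Hs weighted_family_summable that z)
  fix t :: real assume t: "t \<in> {0..1}"
  have "((\<lambda>r. \<Sum>\<^sub>\<infinity>n. weight s n * norm (z n r - z n t)) \<longlongrightarrow> (\<Sum>\<^sub>\<infinity>n::int. 0)) (at t within {0..1})"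
  proof (rule infsum_tendsto_dominated[where h="\<lambda>n. 2 * (weight s n * snorm (z n))"])
    show "((\<lambda>r. weight s n * norm (z n r - z n t)) \<longlongrightarrow> 0) (at t within {0..1})" for n
    proof -
      have "(z n \<longlongrightarrow> z n t) (at t within {0..1})"
        using weighted_familyD(1)[OF z] t by (simp add: continuous_on_def)
      then have "((\<lambda>r. weight s n * norm (z n r - z n t)) \<longlongrightarrow> weight s n * norm (z n t - z n t))
          (at t within {0..1})"
        by (intro tendsto_intros)
      then show ?thesis by simp
    qed
    have "norm (weight s n * norm (z n r - z n t)) \<le> 2 * (weight s n * snorm (z n))"
      if "r \<in> {0..1}" for r n
    proof -
      have "norm (z n r - z n t) \<le> snorm (z n) + snorm (z n)"
        by (rule order_trans[OF norm_triangle_ineq4])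
          (intro add_mono snorm_upper weighted_familyD(1)[OF z] t that)
      from mult_left_mono[OF this weight_nonneg[of s n]] show ?thesis
        by (simp add: abs_mult algebra_simps)
    qed
    then show "\<forall>\<^sub>F r in at t within {0..1}. \<forall>n\<in>UNIV. norm (weight s n * norm (z n r - z n t))
        \<le> 2 * (weight s n * snorm (z n))"
      by (auto simp: eventually_at_filter intro!: always_eventually)
  qed (intro summable_on_cmult_right weighted_familyD(2)[OF z])
  then have lim: "((\<lambda>r. \<Sum>\<^sub>\<infinity>n. weight s n * norm (z n r - z n t)) \<longlongrightarrow> 0) (at t within {0..1})"
    by simp
  have le: "Hs_norm s (\<lambda>g. curve z r g - curve z t g)
      \<le> (\<Sum>\<^sub>\<infinity>n. weight s n * norm (z n r - z n t))" if r: "r \<in> {0..1}" for r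
  proof -
    have "(\<lambda>n. weight s n * norm (z n r - z n t)) summable_on UNIV"
    proof (rule summable_on_comparison_test[OF summable_on_add[OF
          weighted_family_summable[OF z r] weighted_family_summable[OF z t]]])
      show "weight s n * norm (z n r - z n t) \<le> weight s n * norm (z n r) + weight s n * norm (z n t)" for n
        using norm_triangle_ineq4[of "z n r" "z n t"] by (simp add: mult_left_mono flip: distrib_left)
    qed simp
    then show ?thesis
      using Hs_norm_le_l1(2)[of s "\<lambda>g. curve z r g - curve z t g"]
      by (simp add: fourier_coeff_diff curve_def)
  qed
  show "((\<lambda>r. Hs_norm s (\<lambda>g. curve z r g - curve z t g)) \<longlongrightarrow> 0) (at t within {0..1})"
  proof (rule tendsto_sandwich[OF _ _ tendsto_const lim])
    show "\<forall>\<^sub>F r in at t within {0..1}. Hs_norm s (\<lambda>g. curve z r g - curve z t g)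
        \<le> (\<Sum>\<^sub>\<infinity>n. weight s n * norm (z n r - z n t))"
      using le by (auto simp: eventually_at_filter intro!: always_eventually)
  qed (simp add: Hs_norm_nonneg)
qed

lemma curve_ST_test: "curve z t (f t) = (\<Sum>\<^sub>\<infinity>n. z n t * ST_pairing n f t)"
  by (simp add: curve_def torus_series_def ST_pairing_def)

lemma curve_ST_test_summable:
  assumes "weighted_family s z" "f \<in> ST_test" "t \<in> {0..1}"
  shows "(\<lambda>n. z n t * ST_pairing n f t) summable_on UNIV"
  unfolding ST_pairing_def
  by (rule torus_series_summable[OF weighted_family_summable[OF assms(1,3)] ST_test_slice[OF assms(2)]])

lemma curve_ST_test_bound:
  assumes z: "weighted_family s z" and f: "f \<in> ST_test" and t: "t \<in> {0..1}"
    and C: "\<And>n. norm (ST_pairing n f t) \<le> C * weight s n"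
  shows "norm (z n t * ST_pairing n f t) \<le> C * (weight s n * snorm (z n))"
    "norm (curve z t (f t)) \<le> C * (\<Sum>\<^sub>\<infinity>n. weight s n * snorm (z n))"
proof -
  show le: "norm (z n t * ST_pairing n f t) \<le> C * (weight s n * snorm (z n))" for n
    using mult_mono[OF snorm_upper[OF weighted_familyD(1)[OF z] t, of n] C[of n]]
      snorm_nonneg[OF weighted_familyD(1)[OF z], of n]
    by (simp add: norm_mult mult_ac)
  have "norm (curve z t (f t)) \<le> (\<Sum>\<^sub>\<infinity>n. C * (weight s n * snorm (z n)))"
    unfolding curve_ST_test
    by (rule norm_infsum_le[OF has_sum_infsum[OF curve_ST_test_summable[OF z f t]]
          has_sum_infsum[OF summable_on_cmult_right[OF weighted_familyD(2)[OF z]]] le])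
  then show "norm (curve z t (f t)) \<le> C * (\<Sum>\<^sub>\<infinity>n. weight s n * snorm (z n))"
    by (simp add: infsum_cmult_right weighted_familyD(2)[OF z])
qed

lemma curve_ST_test_continuous:
  assumes z: "weighted_family s z" and f: "f \<in> ST_test"
  shows "continuous_on {0..1} (\<lambda>t. curve z t (f t))"
  unfolding curve_ST_test continuous_on_def
proof
  fix t :: real assume t: "t \<in> {0..1}"
  obtain C where C: "C \<ge> 0" "\<And>t n. t \<in> {0..1} \<Longrightarrow> norm (ST_pairing n f t) \<le> C * weight s n"
    using ST_pairing_uniform_decay[OF f] by blast
  show "((\<lambda>t. \<Sum>\<^sub>\<infinity>n. z n t * ST_pairing n f t) \<longlongrightarrow> (\<Sum>\<^sub>\<infinity>n. z n t * ST_pairing n f t))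
      (at t within {0..1})"
  proof (rule infsum_tendsto_dominated[where h="\<lambda>n. C * (weight s n * snorm (z n))"])
    show "((\<lambda>t. z n t * ST_pairing n f t) \<longlongrightarrow> z n t * ST_pairing n f t) (at t within {0..1})" for n
      using weighted_familyD(1)[OF z] ST_pairing_continuous[OF f, of "{0..1}"] t
      by (intro tendsto_mult) (auto simp: continuous_on_def)
    show "\<forall>\<^sub>F t in at t within {0..1}. \<forall>n\<in>UNIV. norm (z n t * ST_pairing n f t)
        \<le> C * (weight s n * snorm (z n))"
      using curve_ST_test_bound(1)[OF z f _ C(2)]
      by (auto simp: eventually_at_filter intro!: always_eventually)
  qed (intro summable_on_cmult_right weighted_familyD(2)[OF z])
qed

lemma ST_dist_curve_bound:
  assumes z: "weighted_family s z" and f: "f \<in> ST_test"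
    and C: "\<And>t n. t \<in> {0..1} \<Longrightarrow> norm (ST_pairing n f t) \<le> C * weight s n"
  shows "norm (ST_dist (curve z) f) \<le> C * (\<Sum>\<^sub>\<infinity>n. weight s n * snorm (z n))"
proof -
  have "norm (integral {0..1} (\<lambda>t. curve z t (f t)))
      \<le> (C * (\<Sum>\<^sub>\<infinity>n. weight s n * snorm (z n))) * (1 - 0)"
    by (rule integral_bound)
      (use curve_ST_test_bound(2)[OF z f _ C] curve_ST_test_continuous[OF z f] in simp_all)
  then show ?thesis by (simp add: ST_dist_def)
qed

lemma ST_dist_curve_lincomb:
  assumes z: "weighted_family s z" and f: "f \<in> ST_test" and g: "g \<in> ST_test"
  shows "ST_dist (curve z) (\<lambda>t x. c * f t x + d * g t x) =
    c * ST_dist (curve z) f + d * ST_dist (curve z) g"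
proof -
  have "curve z t (\<lambda>x. c * f t x + d * g t x) = c * curve z t (f t) + d * curve z t (g t)"
    if t: "t \<in> {0..1}" for t
  proof -
    note sf = curve_ST_test_summable[OF z f t] and sg = curve_ST_test_summable[OF z g t]
    have "curve z t (\<lambda>x. c * f t x + d * g t x) =
        (\<Sum>\<^sub>\<infinity>n. c * (z n t * ST_pairing n f t) + d * (z n t * ST_pairing n g t))"
      unfolding curve_ST_test[of z t "\<lambda>t x. c * f t x + d * g t x"] ST_pairing_lincomb[OF f g]
      by (simp only: distrib_left mult.left_commute)
    also have "\<dots> = (\<Sum>\<^sub>\<infinity>n. c * (z n t * ST_pairing n f t)) + (\<Sum>\<^sub>\<infinity>n. d * (z n t * ST_pairing n g t))"
      by (intro infsum_add summable_on_cmult_right sf sg)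
    also have "\<dots> = c * curve z t (f t) + d * curve z t (g t)"
      unfolding curve_ST_test by (simp only: infsum_cmult_right sf sg)
    finally show ?thesis .
  qed
  then have "ST_dist (curve z) (\<lambda>t x. c * f t x + d * g t x) =
      integral {0..1} (\<lambda>t. c * curve z t (f t) + d * curve z t (g t))"
    unfolding ST_dist_def by (intro integral_cong) auto
  also have "\<dots> = c * ST_dist (curve z) f + d * ST_dist (curve z) g"
    unfolding ST_dist_def
    by (subst integral_add)
      (auto intro!: integrable_on_mult_right integrable_continuous_interval
        continuous_on_mult_left curve_ST_test_continuous[OF z] f g)
  finally show ?thesis .
qed

lemma ST_dist_curve_diff:
  assumes z: "weighted_family s z" and y: "weighted_family s y" and f: "f \<in> ST_test"
  shows "ST_dist (curve (\<lambda>n t. z n t - y n t)) f = ST_dist (curve z) f - ST_dist (curve y) f"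
proof -
  have "curve (\<lambda>n t. z n t - y n t) t (f t) = curve z t (f t) - curve y t (f t)"
    if t: "t \<in> {0..1}" for t
  proof -
    note sz = curve_ST_test_summable[OF z f t] and sy = curve_ST_test_summable[OF y f t]
    have "curve (\<lambda>n t. z n t - y n t) t (f t) =
        (\<Sum>\<^sub>\<infinity>n. z n t * ST_pairing n f t + - (y n t * ST_pairing n f t))"
      unfolding curve_ST_test by (simp add: left_diff_distrib)
    also have "\<dots> = curve z t (f t) + (\<Sum>\<^sub>\<infinity>n. - (y n t * ST_pairing n f t))"
      unfolding curve_ST_test by (intro infsum_add sz summable_on_uminus[THEN iffD2] sy)
    finally show ?thesis by (simp add: infsum_uminus curve_ST_test)
  qed
  then have "ST_dist (curve (\<lambda>n t. z n t - y n t)) f =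
      integral {0..1} (\<lambda>t. curve z t (f t) - curve y t (f t))"
    unfolding ST_dist_def by (intro integral_cong) auto
  also have "\<dots> = ST_dist (curve z) f - ST_dist (curve y) f"
    unfolding ST_dist_def
    by (rule integral_diff) (auto intro!: integrable_continuous_interval
        curve_ST_test_continuous[OF z] curve_ST_test_continuous[OF y] f)
  finally show ?thesis .
qed

lemma ST_dist_curve_tendsto:
  assumes z: "\<And>N. weighted_family s (z N)" and y: "weighted_family s y" and f: "f \<in> ST_test"
    and lim: "(\<lambda>N. \<Sum>\<^sub>\<infinity>n. weight s n * snorm (\<lambda>t. z N n t - y n t)) \<longlonglongrightarrow> 0"
  shows "(\<lambda>N. ST_dist (curve (z N)) f) \<longlonglongrightarrow> ST_dist (curve y) f"
proof -
  obtain C where C: "C \<ge> 0" "\<And>t n. t \<in> {0..1} \<Longrightarrow> norm (ST_pairing n f t) \<le> C * weight s n"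
    using ST_pairing_uniform_decay[OF f] by blast
  have le: "norm (ST_dist (curve (z N)) f - ST_dist (curve y) f)
      \<le> C * (\<Sum>\<^sub>\<infinity>n. weight s n * snorm (\<lambda>t. z N n t - y n t))" for N
    using ST_dist_curve_bound[OF weighted_family_diff[OF z y] f C(2)]
    by (simp add: ST_dist_curve_diff[OF z y f])
  have "(\<lambda>N. C * (\<Sum>\<^sub>\<infinity>n. weight s n * snorm (\<lambda>t. z N n t - y n t))) \<longlonglongrightarrow> 0"
    using tendsto_mult_left[OF lim, of C] by simp
  from Lim_null_comparison[OF always_eventually[OF allI[OF le]] this]
  have "(\<lambda>N. ST_dist (curve (z N)) f - ST_dist (curve y) f) \<longlonglongrightarrow> 0" .
  then show ?thesis by (rule LIM_zero_cancel)
qed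

text \<open>Applied with \<open>\<alpha> = -1\<close>, \<open>\<beta> = 0\<close> to the time derivative of a curve, and with the coefficients of the
  linear part of the equation to the nonlinear term.\<close>

lemma ST_distribution_curve_derivatives:
  assumes z: "weighted_family s z"
  shows "ST_distribution (\<lambda>f. \<alpha> * ST_dist (curve z) (ST_Dt f) + \<beta> * ST_dist (curve z) (ST_Dx (ST_Dx f)))"
    (is "ST_distribution ?F")
proof -
  have lin: "?F (\<lambda>t x. c * f t x + d * g t x) = c * ?F f + d * ?F g"
    if fg: "f \<in> ST_test" "g \<in> ST_test" for c d f g
  proof -
    obtain a b a' b' where on: "f \<in> ST_test_on a b" "g \<in> ST_test_on a' b'"
      using fg by (metis ST_testE)
    have "ST_Dt (\<lambda>t x. c * f t x + d * g t x) = (\<lambda>t x. c * ST_Dt f t x + d * ST_Dt g t x)"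
      "ST_Dx (ST_Dx (\<lambda>t x. c * f t x + d * g t x)) =
        (\<lambda>t x. c * ST_Dx (ST_Dx f) t x + d * ST_Dx (ST_Dx g) t x)"
      by (simp_all only: ST_derivative_lincomb[OF on]
          ST_derivative_lincomb[OF on(1)[THEN ST_test_on_Dx] on(2)[THEN ST_test_on_Dx]])
    then show ?thesis
      by (simp add: ST_dist_curve_lincomb[OF z] ST_test_Dt ST_test_Dx fg algebra_simps)
  qed
  define S where "S = (\<Sum>\<^sub>\<infinity>n. weight s n * snorm (z n))"
  show ?thesis
    unfolding ST_distribution_def
  proof (intro conjI ballI allI impI)
    fix f g assume "f \<in> ST_test" "g \<in> ST_test"
    then show "?F (\<lambda>t x. f t x + g t x) = ?F f + ?F g" using lin[of f g 1 1] by simp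
  next
    fix c f assume "f \<in> ST_test"
    then show "?F (\<lambda>t x. c * f t x) = c * ?F f" using lin[of f f c 0] by simp
  next
    fix a b :: real assume ab: "0 < a" "b < 1"
    show "\<exists>C m. \<forall>f\<in>ST_test_on a b. \<forall>B.
        (\<forall>j\<le>m. \<forall>k\<le>m. \<forall>t x. norm ((ST_Dt ^^ j) ((ST_Dx ^^ k) f) t x) \<le> B) \<longrightarrow> norm (?F f) \<le> C * B"
    proof (intro exI ballI allI impI)
      fix f B assume fon: "f \<in> ST_test_on a b"
        and B: "\<forall>j\<le>2 * weight_order s + 2. \<forall>k\<le>2 * weight_order s + 2. \<forall>t x.
          norm ((ST_Dt ^^ j) ((ST_Dx ^^ k) f) t x) \<le> B"
      have f: "f \<in> ST_test" using ab fon by (rule ST_test_onI)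
      define C where "C = 2 ^ weight_order s * (2 * pi * B)"
      have B': "norm ((ST_Dt ^^ j) ((ST_Dx ^^ k) f) t x) \<le> B"
        if "j \<le> 1" "k \<le> 2 * weight_order s + 2" for j k t x
        using B that by simp
      have "norm (ST_dist (curve z) (ST_Dt f)) \<le> C * S"
        unfolding C_def S_def
        by (rule ST_dist_curve_bound[OF z ST_test_Dt[OF f]], rule ST_pairing_decay(2)[OF f B'])
      moreover have "norm (ST_dist (curve z) (ST_Dx (ST_Dx f))) \<le> C * S"
        unfolding C_def S_def
        by (rule ST_dist_curve_bound[OF z ST_test_Dx[OF ST_test_Dx[OF f]]],
            rule ST_pairing_decay(3)[OF f B'])
      ultimately have "norm (?F f) \<le> norm \<alpha> * (C * S) + norm \<beta> * (C * S)"
        by (intro order_trans[OF norm_triangle_ineq] add_mono)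
          (auto simp: norm_mult intro!: mult_left_mono)
      then show "norm (?F f) \<le> ((norm \<alpha> + norm \<beta>) * (2 ^ weight_order s * (2 * pi)) * S) * B"
        by (simp add: C_def algebra_simps)
    qed
  qed
qed

section \<open>Quadratic interactions of Fourier modes\<close>

definition conj_sign :: "int \<Rightarrow> complex \<Rightarrow> complex" where
  "conj_sign e z = (if e = 1 then z else cnj z)"

lemma conj_sign_mult: "conj_sign e (x * y) = conj_sign e x * conj_sign e y"
  by (simp add: conj_sign_def)

lemma conj_sign_sum: "conj_sign e (sum f A) = (\<Sum>x\<in>A. conj_sign e (f x))"
  by (simp add: conj_sign_def cnj_sum)

lemma norm_conj_sign [simp]: "norm (conj_sign e z) = norm z"
  by (simp add: conj_sign_def)

lemma conj_sign_eq_0_iff [simp]: "conj_sign e z = 0 \<longleftrightarrow> z = 0"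
  by (simp add: conj_sign_def)

lemma conj_sign_idem [simp]: "conj_sign e (conj_sign e z) = z"
  by (simp add: conj_sign_def)

lemma conj_sign_one [simp]: "conj_sign e 1 = 1"
  by (simp add: conj_sign_def)

lemma continuous_on_conj_sign [continuous_intros]:
  "continuous_on A f \<Longrightarrow> continuous_on A (\<lambda>x. conj_sign e (f x))"
  unfolding conj_sign_def by (cases "e = 1") (auto intro: continuous_intros)

lemma tendsto_conj_sign:
  "(f \<longlongrightarrow> l) F \<Longrightarrow> ((\<lambda>x. conj_sign e (f x)) \<longlongrightarrow> conj_sign e l) F"
  unfolding conj_sign_def by (auto intro: tendsto_cnj)

lemma conj_sign_exp:
  "e \<in> {1, -1} \<Longrightarrow> conj_sign e (exp (\<i> * of_int k * of_real t)) = exp (\<i> * of_int (e * k) * of_real t)"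
  by (auto simp: conj_sign_def exp_cnj)

lemma conj_sign_character:
  "e \<in> {1, -1} \<Longrightarrow> conj_sign e (character n x) = character (e * n) x"
  by (auto simp: conj_sign_def cnj_character)

text \<open>Signs \<open>(1, 1)\<close>, \<open>(-1, -1)\<close> and \<open>(1, -1)\<close> stand for \<open>u\<^sup>2\<close>, the square of the conjugate, and
  \<open>|u|\<^sup>2\<close> without its mean.  In all cases the modes \<open>k\<close> and \<open>l\<close> interact at the frequency
  \<open>e1 k + e2 l\<close>; subtracting the mean excludes the pairs \<open>(k, k)\<close> when the signs differ.\<close>

locale quadratic_interaction =
  fixes e1 e2 :: int
  assumes signs: "(e1, e2) \<in> {(1, 1), (-1, -1), (1, -1)}"
begin

lemma sign1: "e1 \<in> {1, -1}" and sign2: "e2 \<in> {1, -1}"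
  using signs by auto

definition out :: "int \<times> int \<Rightarrow> int" where
  "out p = e1 * fst p + e2 * snd p"

definition admissible :: "(int \<times> int) set" where
  "admissible = {p. e1 = e2 \<or> fst p \<noteq> snd p}"

text \<open>If \<open>a n t\<close> is \<open>exp (i n\<^sup>2 t)\<close> times the coefficient of \<open>u\<close> at frequency \<open>n\<close>, and likewise for the
  nonlinear term, then the product of the modes \<open>k\<close> and \<open>l\<close> acquires this phase.\<close>

definition phase :: "int \<times> int \<Rightarrow> int" where
  "phase p = (out p)\<^sup>2 - e1 * (fst p)\<^sup>2 - e2 * (snd p)\<^sup>2"

definition interaction :: "(int \<Rightarrow> real \<Rightarrow> complex) \<Rightarrow> int \<times> int \<Rightarrow> real \<Rightarrow> complex" where
  "interaction a p t =
     exp (\<i> * of_int (phase p) * of_real t) * (conj_sign e1 (a (fst p) t) * conj_sign e2 (a (snd p) t))"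

definition primitive :: "(int \<Rightarrow> real \<Rightarrow> complex) \<Rightarrow> int \<times> int \<Rightarrow> real \<Rightarrow> complex" where
  "primitive a p t = integral {0..t} (interaction a p)"

lemma interaction_continuous:
  assumes "\<And>n. continuous_on A (a n)" shows "continuous_on A (interaction a p)"
  unfolding interaction_def by (intro continuous_intros assms)

lemma norm_interaction: "norm (interaction a p t) = norm (a (fst p) t) * norm (a (snd p) t)"
proof -
  have "norm (exp (\<i> * of_int (phase p) * of_real t)) = 1"
    using norm_character[of "phase p" t] by (simp add: character_def)
  then show ?thesis by (simp add: interaction_def norm_mult)
qed

lemma primitive_continuous:
  assumes "\<And>n. continuous_on {0..1} (a n)" shows "continuous_on {0..1} (primitive a p)"
  unfolding primitive_def[abs_def]
  by (intro indefinite_integral_continuous_1 integrable_continuous_interval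
      interaction_continuous assms)

lemma primitive_has_derivative:
  assumes "\<And>n. continuous_on {0..1} (a n)" "t \<in> {0..1}"
  shows "(primitive a p has_vector_derivative interaction a p t) (at t within {0..1})"
  unfolding primitive_def[abs_def]
  by (rule integral_has_vector_derivative[OF interaction_continuous assms(2)]) (rule assms)

lemma primitive_0 [simp]: "primitive a p 0 = 0"
  by (simp add: primitive_def)

definition active_pairs :: "(int \<Rightarrow> complex) \<Rightarrow> (int \<times> int) set" where
  "active_pairs m = ({n. m n \<noteq> 0} \<times> {n. m n \<noteq> 0}) \<inter> admissible"

definition pair_symbol :: "(int \<Rightarrow> complex) \<Rightarrow> int \<times> int \<Rightarrow> complex" where
  "pair_symbol m p = conj_sign e1 (m (fst p)) * conj_sign e2 (m (snd p))"

text \<open>The coefficient of frequency \<open>n\<close> of the time primitive of the nonlinear term after the cutoff,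
  in the moving frame of the free evolution.\<close>

definition cutoff_primitive ::
  "(int \<Rightarrow> real \<Rightarrow> complex) \<Rightarrow> (int \<Rightarrow> complex) \<Rightarrow> int \<Rightarrow> real \<Rightarrow> complex" where
  "cutoff_primitive a m n t = (\<Sum>p\<in>{p\<in>active_pairs m. out p = n}. pair_symbol m p * primitive a p t)"

lemma finite_active_pairs: "finite {n. m n \<noteq> 0} \<Longrightarrow> finite (active_pairs m)"
  unfolding active_pairs_def by auto

end

text \<open>The nonlinear term is a sum over pairs of modes, a distribution is a sum over frequencies; this and
  \<open>infsum_group_by\<close> below pass from one to the other.\<close>

lemma infsum_finite_regroup:
  fixes c :: "'p \<Rightarrow> complex"
  assumes "finite P"
  shows "(\<Sum>\<^sub>\<infinity>n. (\<Sum>p\<in>{p\<in>P. h p = n}. c p) * d n) = (\<Sum>p\<in>P. c p * d (h p))"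
proof -
  have "(\<Sum>\<^sub>\<infinity>n. (\<Sum>p\<in>{p\<in>P. h p = n}. c p) * d n) =
      (\<Sum>\<^sub>\<infinity>n\<in>h ` P. (\<Sum>p\<in>{p\<in>P. h p = n}. c p) * d n)"
  proof (rule infsum_cong_neutral)
    fix n assume "n \<in> UNIV - h ` P"
    then have "{p\<in>P. h p = n} = {}" by auto
    then show "(\<Sum>p\<in>{p\<in>P. h p = n}. c p) * d n = 0" by (simp only: sum.empty mult_zero_left)
  qed auto
  also have "\<dots> = (\<Sum>n\<in>h ` P. \<Sum>p\<in>{p\<in>P. h p = n}. c p * d (h p))"
    using assms by (auto simp: sum_distrib_right intro!: sum.cong)
  also have "\<dots> = (\<Sum>p\<in>P. c p * d (h p))"
    using sum.image_gen[OF assms, of "\<lambda>p. c p * d (h p)" h] by simp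
  finally show ?thesis .
qed

lemma integral_by_parts_vanishing:
  fixes c d h h' :: "real \<Rightarrow> complex"
  assumes c: "\<And>t. t \<in> {0..1} \<Longrightarrow> (c has_vector_derivative d t) (at t within {0..1})"
    and h: "\<And>t. (h has_vector_derivative h' t) (at t)" "h 0 = 0" "h 1 = 0"
    and cont: "continuous_on {0..1} d" "continuous_on {0..1} h'"
  shows "integral {0..1} (\<lambda>t. d t * h t) = - integral {0..1} (\<lambda>t. c t * h' t)"
proof -
  have "((\<lambda>t. c t * h' t + d t * h t) has_integral c 1 * h 1 - c 0 * h 0) {0..1}"
    by (rule fundamental_theorem_of_calculus)
      (auto intro!: has_vector_derivative_mult c has_vector_derivative_at_within[OF h(1)])
  then have "integral {0..1} (\<lambda>t. c t * h' t + d t * h t) = 0"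
    using h by (simp add: integral_unique)
  moreover have "continuous_on {0..1} c" "continuous_on {0..1} h"
    unfolding continuous_on_eq_continuous_within
    using has_vector_derivative_continuous[OF c]
      has_vector_derivative_continuous[OF has_vector_derivative_at_within[OF h(1)]] by blast+
  then have "integral {0..1} (\<lambda>t. c t * h' t + d t * h t) =
      integral {0..1} (\<lambda>t. c t * h' t) + integral {0..1} (\<lambda>t. d t * h t)"
    by (intro integral_add integrable_continuous_interval continuous_intros cont)
  ultimately show ?thesis by (simp add: add_eq_0_iff)
qed

text \<open>The factor that takes a Fourier coefficient from the moving frame of the free evolution back to
  the rest frame.\<close>

definition free_phase :: "int \<Rightarrow> real \<Rightarrow> complex" where
  "free_phase n t = exp (- (\<i> * of_int (n\<^sup>2) * of_real t))"

lemma norm_free_phase [simp]: "norm (free_phase n t) = 1"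
  by (simp add: free_phase_def norm_exp_eq_Re)

lemma continuous_on_free_phase [continuous_intros]: "continuous_on A (free_phase n)"
  unfolding free_phase_def[abs_def] by (intro continuous_intros)

lemma free_phase_has_derivative:
  "(free_phase n has_vector_derivative - (\<i> * of_int (n\<^sup>2)) * free_phase n t) (at t within A)"
  unfolding free_phase_def[abs_def]
  by (rule has_vector_derivative_real_field) (auto intro!: derivative_eq_intros)

lemma free_phase_cancel: "exp (\<i> * of_int (n\<^sup>2) * of_real t) * free_phase n t = 1"
  unfolding free_phase_def by (simp flip: exp_add)

context quadratic_interaction
begin

text \<open>The phases of the modes \<open>k\<close> and \<open>l\<close> combine to the phase of the interaction times the free phase at the
  frequency where they interact.\<close>

lemma torus_dist_Q_cutoff:
  assumes Q: "\<And>S \<zeta>. finite S \<Longrightarrow> Q (\<lambda>x. \<Sum>k\<in>S. \<zeta> k * character k x) =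
      (\<lambda>x. \<Sum>p\<in>(S \<times> S) \<inter> admissible.
        conj_sign e1 (\<zeta> (fst p)) * conj_sign e2 (\<zeta> (snd p)) * character (out p) x)"
    and m: "finite {n. m n \<noteq> 0}" and g: "g \<in> torus_test"
  shows "Q_cutoff Q m (curve (\<lambda>n t. free_phase n t * a n t)) t g =
    (\<Sum>p\<in>active_pairs m. pair_symbol m p * (free_phase (out p) t * interaction a p t)
       * torus_dist (character (out p)) g)"
proof -
  define \<zeta> where "\<zeta> n = m n * (free_phase n t * a n t)" for n
  have phase: "conj_sign e1 (free_phase k t) * conj_sign e2 (free_phase l t) =
      free_phase (out (k, l)) t * exp (\<i> * of_int (phase (k, l)) * of_real t)" for k l
  proof -
    have "conj_sign e (free_phase n t) = exp (\<i> * of_int (- e * n\<^sup>2) * of_real t)"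
      if "e \<in> {1, -1}" for e n
      using conj_sign_exp[OF that, of "- n\<^sup>2" t] by (simp add: free_phase_def)
    note * = this[OF sign1, of k] this[OF sign2, of l]
    show ?thesis
      unfolding * unfolding free_phase_def phase_def
      by (simp add: algebra_simps flip: exp_add)
  qed
  have "cutoff m (curve (\<lambda>n t. free_phase n t * a n t) t) = (\<lambda>x. \<Sum>k | m k \<noteq> 0. \<zeta> k * character k x)"
    by (simp add: cutoff_def curve_def \<zeta>_def)
  then have "Q (cutoff m (curve (\<lambda>n t. free_phase n t * a n t) t)) = (\<lambda>x. \<Sum>p\<in>active_pairs m.
        conj_sign e1 (\<zeta> (fst p)) * conj_sign e2 (\<zeta> (snd p)) * character (out p) x)"
    by (simp add: Q[OF m] active_pairs_def)
  also have "\<dots> = (\<lambda>x. \<Sum>p\<in>active_pairs m.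
        pair_symbol m p * (free_phase (out p) t * interaction a p t) * character (out p) x)"
  proof (intro ext sum.cong refl)
    fix x p
    have "conj_sign e1 (\<zeta> (fst p)) * conj_sign e2 (\<zeta> (snd p)) = pair_symbol m p *
        ((conj_sign e1 (free_phase (fst p) t) * conj_sign e2 (free_phase (snd p) t)) *
         (conj_sign e1 (a (fst p) t) * conj_sign e2 (a (snd p) t)))"
      by (simp add: \<zeta>_def conj_sign_mult pair_symbol_def mult_ac)
    then show "conj_sign e1 (\<zeta> (fst p)) * conj_sign e2 (\<zeta> (snd p)) * character (out p) x =
        pair_symbol m p * (free_phase (out p) t * interaction a p t) * character (out p) x"
      by (simp add: phase interaction_def mult.assoc)
  qed
  finally have "Q_cutoff Q m (curve (\<lambda>n t. free_phase n t * a n t)) t g = integral {0..2 * pi}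
      (\<lambda>x. \<Sum>p\<in>active_pairs m. pair_symbol m p * (free_phase (out p) t * interaction a p t)
         * (character (out p) x * g x))"
    by (simp add: Q_cutoff_def torus_dist_def sum_distrib_right mult.assoc)
  also have "\<dots> = (\<Sum>p\<in>active_pairs m. integral {0..2 * pi}
      (\<lambda>x. pair_symbol m p * (free_phase (out p) t * interaction a p t) * (character (out p) x * g x)))"
    by (intro integral_sum finite_active_pairs m integrable_on_mult_right
        torus_dist_character_integrable g)
  also have "\<dots> = (\<Sum>p\<in>active_pairs m. pair_symbol m p * (free_phase (out p) t * interaction a p t)
       * torus_dist (character (out p)) g)"
    by (simp add: torus_dist_def)
  finally show ?thesis .
qed

text \<open>The free propagator removes the free phase, so what remains is the time derivative of
  the primitives.\<close>

lemma free_propagator_Q_cutoff: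
  assumes T: "\<And>g. g \<in> torus_test \<Longrightarrow> T g = (\<Sum>p\<in>active_pairs m.
      pair_symbol m p * (free_phase (out p) t * interaction a p t) * torus_dist (character (out p)) g)"
    and m: "finite {n. m n \<noteq> 0}"
  shows "free_propagator t T g =
    (\<Sum>p\<in>active_pairs m. pair_symbol m p * interaction a p t * torus_dist (character (out p)) g)"
proof -
  have fc: "fourier_coeff T n = (\<Sum>p\<in>{p\<in>active_pairs m. out p = n}.
      pair_symbol m p * (free_phase n t * interaction a p t))" for n
  proof -
    have "fourier_coeff T n = (\<Sum>p\<in>active_pairs m. if out p = n then
        pair_symbol m p * (free_phase n t * interaction a p t) else 0)"
      unfolding fourier_coeff_def T[OF character_in_torus_test] sum_divide_distrib
      by (intro sum.cong refl) (auto simp: torus_dist_character)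
    then show ?thesis
      by (simp add: finite_active_pairs m sum.If_cases Int_def conj_commute)
  qed
  have "exp (\<i> * of_int (n\<^sup>2) * of_real t) * fourier_coeff T n =
      (\<Sum>p\<in>{p\<in>active_pairs m. out p = n}. pair_symbol m p * interaction a p t)" for n
    unfolding fc sum_distrib_left
  proof (intro sum.cong refl)
    fix p
    show "exp (\<i> * of_int (n\<^sup>2) * of_real t) * (pair_symbol m p * (free_phase n t * interaction a p t))
        = pair_symbol m p * interaction a p t"
      using free_phase_cancel[of n t] by (metis mult.assoc mult.left_commute mult_1)
  qed
  then show ?thesis
    unfolding free_propagator_def fourier_multiplier_def
    using infsum_finite_regroup[OF finite_active_pairs[OF m], where h=out
        and c="\<lambda>p. pair_symbol m p * interaction a p t" and d="\<lambda>n. torus_dist (character n) g"]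
    by simp
qed

text \<open>Only the primitives of the interactions have a limit, so the time derivative is moved to the test
  function.  In the rest frame it also falls on the free phase, which produces the second derivative in \<open>x\<close>.\<close>

lemma integral_interaction_by_parts:
  assumes a: "\<And>n. continuous_on {0..1} (a n)" and f: "f \<in> ST_test"
  shows "integral {0..1} (\<lambda>t. interaction a p t * ST_pairing n f t) =
      - integral {0..1} (\<lambda>t. primitive a p t * ST_pairing n (ST_Dt f) t)"
    and "integral {0..1} (\<lambda>t. interaction a p t * (free_phase n t * ST_pairing n f t)) =
      - integral {0..1} (\<lambda>t. primitive a p t * (free_phase n t * (ST_pairing n (ST_Dt f) t
          + \<i> * ST_pairing n (ST_Dx (ST_Dx f)) t)))"
proof -
  show "integral {0..1} (\<lambda>t. interaction a p t * ST_pairing n f t) =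
      - integral {0..1} (\<lambda>t. primitive a p t * ST_pairing n (ST_Dt f) t)"
    by (intro integral_by_parts_vanishing primitive_has_derivative a ST_pairing_has_derivative f
        ST_pairing_vanishes_at_ends interaction_continuous ST_pairing_continuous ST_test_Dt)
  show "integral {0..1} (\<lambda>t. interaction a p t * (free_phase n t * ST_pairing n f t)) =
      - integral {0..1} (\<lambda>t. primitive a p t * (free_phase n t * (ST_pairing n (ST_Dt f) t
          + \<i> * ST_pairing n (ST_Dx (ST_Dx f)) t)))"
  proof (intro integral_by_parts_vanishing primitive_has_derivative a interaction_continuous)
    fix t
    have "((\<lambda>t. free_phase n t * ST_pairing n f t) has_vector_derivative
        free_phase n t * ST_pairing n (ST_Dt f) t + - (\<i> * of_int (n\<^sup>2)) * free_phase n t * ST_pairing n f t) (at t)"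
      by (intro has_vector_derivative_mult free_phase_has_derivative ST_pairing_has_derivative f)
    then show "((\<lambda>t. free_phase n t * ST_pairing n f t) has_vector_derivative
        free_phase n t * (ST_pairing n (ST_Dt f) t + \<i> * ST_pairing n (ST_Dx (ST_Dx f)) t)) (at t)"
      by (simp add: ST_pairing_Dxx[OF f] algebra_simps)
  next
    show "continuous_on {0..1} (\<lambda>t. free_phase n t * (ST_pairing n (ST_Dt f) t
          + \<i> * ST_pairing n (ST_Dx (ST_Dx f)) t))"
      by (intro continuous_intros ST_pairing_continuous ST_test_Dt ST_test_Dx f)
  qed (simp_all add: ST_pairing_vanishes_at_ends f)
qed

lemma curve_cutoff_primitive:
  assumes m: "finite {n. m n \<noteq> 0}"
  shows "curve (cutoff_primitive a m) t (f t) =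
      (\<Sum>p\<in>active_pairs m. pair_symbol m p * primitive a p t * ST_pairing (out p) f t)"
    and "curve (\<lambda>n t. free_phase n t * cutoff_primitive a m n t) t (f t) =
      (\<Sum>p\<in>active_pairs m. pair_symbol m p * primitive a p t * (free_phase (out p) t * ST_pairing (out p) f t))"
proof -
  note regroup = infsum_finite_regroup[OF finite_active_pairs[OF m], where h=out
      and c="\<lambda>p. pair_symbol m p * primitive a p t"]
  show "curve (cutoff_primitive a m) t (f t) =
      (\<Sum>p\<in>active_pairs m. pair_symbol m p * primitive a p t * ST_pairing (out p) f t)"
    using regroup[where d="\<lambda>n. ST_pairing n f t"] by (simp add: curve_ST_test cutoff_primitive_def)
  show "curve (\<lambda>n t. free_phase n t * cutoff_primitive a m n t) t (f t) =
      (\<Sum>p\<in>active_pairs m. pair_symbol m p * primitive a p t * (free_phase (out p) t * ST_pairing (out p) f t))"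
    using regroup[where d="\<lambda>n. free_phase n t * ST_pairing n f t"]
    by (simp add: curve_ST_test cutoff_primitive_def mult_ac)
qed

end

lemma infsum_group_by:
  fixes W :: "'p \<Rightarrow> real"
  assumes W: "W summable_on A"
  shows "(\<lambda>n. \<Sum>\<^sub>\<infinity>p\<in>{p\<in>A. h p = n}. W p) summable_on UNIV"
    and "(\<Sum>\<^sub>\<infinity>n. \<Sum>\<^sub>\<infinity>p\<in>{p\<in>A. h p = n}. W p) = (\<Sum>\<^sub>\<infinity>p\<in>A. W p)"
proof -
  define B where "B = Sigma UNIV (\<lambda>n. {p\<in>A. h p = n})"
  have bij: "bij_betw snd B A"
    by (rule bij_betwI[of _ _ _ "\<lambda>p. (h p, p)"]) (auto simp: B_def)
  have s: "(\<lambda>(n, p). W p) summable_on B"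
    using summable_on_reindex_bij_betw[OF bij, of W] W by (simp add: case_prod_unfold)
  have i: "infsum (\<lambda>(n, p). W p) B = infsum W A"
    using infsum_reindex_bij_betw[OF bij, of W] by (simp add: case_prod_unfold)
  show "(\<lambda>n. \<Sum>\<^sub>\<infinity>p\<in>{p\<in>A. h p = n}. W p) summable_on UNIV"
    using summable_on_Sigma_banach[OF s[unfolded B_def]] .
  show "(\<Sum>\<^sub>\<infinity>n. \<Sum>\<^sub>\<infinity>p\<in>{p\<in>A. h p = n}. W p) = (\<Sum>\<^sub>\<infinity>p\<in>A. W p)"
    using infsum_Sigma'_banach[OF s[unfolded B_def]] i by (simp add: B_def)
qed

lemma ST_distribution_cong:
  assumes eq: "\<And>f. f \<in> ST_test \<Longrightarrow> F f = G f" and G: "ST_distribution G"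
  shows "ST_distribution F"
proof -
  have add: "(\<lambda>t x. f t x + g t x) \<in> ST_test" if "f \<in> ST_test" "g \<in> ST_test" for f g
    using ST_test_lincomb[OF that, of 1 1] by simp
  have mult: "(\<lambda>t x. c * f t x) \<in> ST_test" if "f \<in> ST_test" for c f
    using ST_test_lincomb[OF that that, of c 0] by simp
  show ?thesis
    unfolding ST_distribution_def
  proof (intro conjI allI ballI impI)
    fix f g assume "f \<in> ST_test" "g \<in> ST_test"
    then show "F (\<lambda>t x. f t x + g t x) = F f + F g"
      using G by (simp add: eq add ST_distribution_def)
  next
    fix c f assume "f \<in> ST_test"
    then show "F (\<lambda>t x. c * f t x) = c * F f"
      using G by (simp add: eq mult ST_distribution_def)
  next
    fix a b :: real assume ab: "0 < a" "b < 1"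
    then obtain C m where "\<forall>f\<in>ST_test_on a b. \<forall>B. (\<forall>j\<le>m. \<forall>k\<le>m. \<forall>t x.
        norm ((ST_Dt ^^ j) ((ST_Dx ^^ k) f) t x) \<le> B) \<longrightarrow> norm (G f) \<le> C * B"
      using G unfolding ST_distribution_def by meson
    then show "\<exists>C m. \<forall>f\<in>ST_test_on a b. \<forall>B. (\<forall>j\<le>m. \<forall>k\<le>m. \<forall>t x.
        norm ((ST_Dt ^^ j) ((ST_Dx ^^ k) f) t x) \<le> B) \<longrightarrow> norm (F f) \<le> C * B"
      using eq ST_test_onI[OF ab] by (intro exI[of _ C] exI[of _ m]) simp
  qed
qed

lemma ST_dist_curve_cmult:
  "ST_dist (curve (\<lambda>n t. c * z n t)) f = c * ST_dist (curve z) f"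
  unfolding ST_dist_def curve_ST_test
  by (simp add: mult.assoc infsum_cmult_right')

context quadratic_interaction
begin

lemma cutoff_primitive_family:
  assumes a: "\<And>n. continuous_on {0..1} (a n)" and m: "finite {n. m n \<noteq> 0}"
  shows "weighted_family s (cutoff_primitive a m)"
  unfolding weighted_family_def
proof (intro conjI allI)
  show "continuous_on {0..1} (cutoff_primitive a m n)" for n
    unfolding cutoff_primitive_def[abs_def]
    by (intro continuous_intros primitive_continuous a)
  have "cutoff_primitive a m n t = 0" if "n \<notin> out ` active_pairs m" for n t
  proof -
    have "{p\<in>active_pairs m. out p = n} = {}" using that by auto
    then show ?thesis by (simp only: cutoff_primitive_def sum.empty)
  qed
  then have "snorm (cutoff_primitive a m n) = 0" if "n \<notin> out ` active_pairs m" for n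
    using that by (intro snorm_zero) blast
  then have "{n\<in>UNIV. weight s n * snorm (cutoff_primitive a m n) \<noteq> 0} \<subseteq> out ` active_pairs m"
    by auto
  then show "(\<lambda>n. weight s n * snorm (cutoff_primitive a m n)) summable_on UNIV"
    using finite_active_pairs[OF m] finite_subset
    by (intro finite_nonzero_values_imp_summable_on) blast
qed

lemma pair_symbol_tendsto:
  assumes "cutoff_sequence m"
  shows "(\<lambda>N. pair_symbol (m N) p) \<longlonglongrightarrow> 1"
proof -
  have "(\<lambda>N. pair_symbol (m N) p) \<longlonglongrightarrow> conj_sign e1 1 * conj_sign e2 1"
    unfolding pair_symbol_def
    by (intro tendsto_mult tendsto_conj_sign) (use assms in \<open>auto simp: cutoff_sequence_def\<close>)
  then show ?thesis by simp
qed

text \<open>The symbol of a pair is bounded and tends to \<open>1\<close>, so dominated convergence over pairs applies to every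
  cutoff sequence, with a limit that does not depend on it.\<close>

lemma cutoff_primitive_tendsto:
  assumes a: "\<And>n. continuous_on {0..1} (a n)"
    and W: "(\<lambda>p. weight s (out p) * snorm (primitive a p)) summable_on admissible"
    and V: "\<And>n t. t \<in> {0..1} \<Longrightarrow> V n t = (\<Sum>\<^sub>\<infinity>p\<in>{p\<in>admissible. out p = n}. primitive a p t)"
    and V_family: "weighted_family s V"
    and m: "cutoff_sequence m"
  shows "(\<lambda>N. \<Sum>\<^sub>\<infinity>n. weight s n * snorm (\<lambda>t. cutoff_primitive a (m N) n t - V n t)) \<longlonglongrightarrow> 0"
proof -
  have fin: "finite {n. m N n \<noteq> 0}" for N using m by (simp add: cutoff_sequence_def)
  obtain C where C: "\<And>N n. norm (m N n) \<le> C" using m unfolding cutoff_sequence_def by blast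
  have C0: "C \<ge> 0" using C[of 0 0] norm_ge_zero[of "m 0 0"] by linarith
  define W where "W p = weight s (out p) * snorm (primitive a p)" for p
  define D where "D N p = norm (pair_symbol (m N) p - 1)" for N p
  note pc = primitive_continuous[OF a]
  have W0: "0 \<le> W p" for p by (simp add: W_def snorm_nonneg pc)
  have D0: "0 \<le> D N p" for N p by (simp add: D_def)
  have DC: "D N p \<le> C * C + 1" for N p
  proof -
    have "norm (pair_symbol (m N) p) \<le> C * C"
      unfolding pair_symbol_def norm_mult norm_conj_sign by (intro mult_mono C C0) simp
    then show ?thesis
      unfolding D_def using norm_triangle_ineq4[of "pair_symbol (m N) p" 1] by simp
  qed
  have Ws: "W summable_on admissible" using W by (simp add: W_def[abs_def])
  have DW_le: "D N p * W p \<le> (C * C + 1) * W p" for N p by (intro mult_right_mono DC W0)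
  have DWs: "(\<lambda>p. D N p * W p) summable_on admissible" for N
    by (rule summable_on_comparison_test[OF summable_on_cmult_right[OF Ws] DW_le])
      (simp add: D0 W0)
  have lim: "(\<lambda>N. \<Sum>\<^sub>\<infinity>p\<in>admissible. D N p * W p) \<longlonglongrightarrow> (\<Sum>\<^sub>\<infinity>p\<in>admissible. 0)"
  proof (rule infsum_tendsto_dominated[where h="\<lambda>p. (C * C + 1) * W p"])
    show "(\<lambda>N. D N p * W p) \<longlonglongrightarrow> 0" for p
    proof -
      have "(\<lambda>N. D N p * W p) \<longlonglongrightarrow> norm (1 - 1 :: complex) * W p"
        unfolding D_def by (intro tendsto_intros pair_symbol_tendsto m)
      then show ?thesis by simp
    qed
    show "\<forall>\<^sub>F N in sequentially. \<forall>p\<in>admissible. norm (D N p * W p) \<le> (C * C + 1) * W p"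
      using DW_le by (intro always_eventually) (simp add: D0 W0)
  qed (intro summable_on_cmult_right Ws)
  define Adm where "Adm n = {p\<in>admissible. out p = n}" for n
  have le: "weight s n * snorm (\<lambda>t. cutoff_primitive a (m N) n t - V n t)
      \<le> (\<Sum>\<^sub>\<infinity>p\<in>Adm n. D N p * W p)" for N n
  proof -
    have sn: "(\<lambda>p. snorm (primitive a p)) summable_on Adm n"
    proof -
      have "W summable_on Adm n"
        by (rule summable_on_subset_banach[OF Ws]) (auto simp: Adm_def)
      then have "(\<lambda>p. weight s n * snorm (primitive a p)) summable_on Adm n"
        by (rule summable_on_cong[THEN iffD1, rotated]) (simp add: W_def Adm_def)
      from summable_on_cmult_right[OF this, of "inverse (weight s n)"] show ?thesis
        using weight_pos[of s n] by (simp flip: mult.assoc)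
    qed
    have Dsn: "(\<lambda>p. D N p * snorm (primitive a p)) summable_on Adm n"
      by (rule summable_on_comparison_test[OF summable_on_cmult_right[OF sn, of "C * C + 1"]])
        (auto intro!: mult_right_mono mult_nonneg_nonneg DC D0 snorm_nonneg pc)
    have "snorm (\<lambda>t. cutoff_primitive a (m N) n t - V n t)
        \<le> (\<Sum>\<^sub>\<infinity>p\<in>Adm n. D N p * snorm (primitive a p))"
    proof (rule snorm_least)
      fix t :: real assume t: "t \<in> {0..1}"
      have ps: "(\<lambda>p. primitive a p t) summable_on Adm n"
        by (rule abs_summable_summable, rule Infinite_Sum.abs_summable_on_comparison_test'[OF sn])
          (intro snorm_upper pc t)
      have "cutoff_primitive a (m N) n t = (\<Sum>\<^sub>\<infinity>p\<in>{p\<in>active_pairs (m N). out p = n}. pair_symbol (m N) p * primitive a p t)"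
        by (simp add: cutoff_primitive_def finite_active_pairs fin)
      also have "\<dots> = (\<Sum>\<^sub>\<infinity>p\<in>Adm n. pair_symbol (m N) p * primitive a p t)"
        by (rule infsum_cong_neutral) (auto simp: Adm_def active_pairs_def pair_symbol_def)
      finally have c: "cutoff_primitive a (m N) n t = (\<Sum>\<^sub>\<infinity>p\<in>Adm n. pair_symbol (m N) p * primitive a p t)" .
      have nle: "norm ((pair_symbol (m N) p - 1) * primitive a p t) \<le> D N p * snorm (primitive a p)" for p
        by (auto simp: norm_mult D_def intro!: mult_left_mono snorm_upper pc t[simplified])
      have ds: "(\<lambda>p. (pair_symbol (m N) p - 1) * primitive a p t) summable_on Adm n"
        by (rule abs_summable_summable, rule Infinite_Sum.abs_summable_on_comparison_test'[OF Dsn nle])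
      have "cutoff_primitive a (m N) n t =
          (\<Sum>\<^sub>\<infinity>p\<in>Adm n. (pair_symbol (m N) p - 1) * primitive a p t + primitive a p t)"
        unfolding c by (simp add: algebra_simps)
      also have "\<dots> = (\<Sum>\<^sub>\<infinity>p\<in>Adm n. (pair_symbol (m N) p - 1) * primitive a p t) + V n t"
        unfolding V[OF t] Adm_def[symmetric] by (intro infsum_add ds ps)
      finally have "cutoff_primitive a (m N) n t - V n t =
          (\<Sum>\<^sub>\<infinity>p\<in>Adm n. (pair_symbol (m N) p - 1) * primitive a p t)" by simp
      also have "norm \<dots> \<le> (\<Sum>\<^sub>\<infinity>p\<in>Adm n. D N p * snorm (primitive a p))"
        by (rule norm_infsum_le[OF has_sum_infsum[OF ds] has_sum_infsum[OF Dsn] nle])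
      finally show "norm (cutoff_primitive a (m N) n t - V n t)
          \<le> (\<Sum>\<^sub>\<infinity>p\<in>Adm n. D N p * snorm (primitive a p))" .
    qed
    then have "weight s n * snorm (\<lambda>t. cutoff_primitive a (m N) n t - V n t)
        \<le> weight s n * (\<Sum>\<^sub>\<infinity>p\<in>Adm n. D N p * snorm (primitive a p))"
      by (intro mult_left_mono) auto
    also have "\<dots> = (\<Sum>\<^sub>\<infinity>p\<in>Adm n. weight s n * (D N p * snorm (primitive a p)))"
      by (simp only: infsum_cmult_right Dsn)
    also have "\<dots> = (\<Sum>\<^sub>\<infinity>p\<in>Adm n. D N p * W p)"
      by (rule infsum_cong) (auto simp: Adm_def W_def)
    finally show ?thesis .
  qed
  note group = infsum_group_by[OF DWs, where h=out, folded Adm_def]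
  show ?thesis
  proof (rule tendsto_sandwich[OF _ _ tendsto_const])
    show "(\<lambda>N. \<Sum>\<^sub>\<infinity>p\<in>admissible. D N p * W p) \<longlonglongrightarrow> 0" using lim by simp
    have "(\<Sum>\<^sub>\<infinity>n. weight s n * snorm (\<lambda>t. cutoff_primitive a (m N) n t - V n t))
        \<le> (\<Sum>\<^sub>\<infinity>n. \<Sum>\<^sub>\<infinity>p\<in>Adm n. D N p * W p)" for N
      by (rule infsum_mono[OF weighted_familyD(2)[OF weighted_family_diff[OF
              cutoff_primitive_family[OF a fin] V_family]] group(1) le])
    then show "\<forall>\<^sub>F N in sequentially. (\<Sum>\<^sub>\<infinity>n. weight s n * snorm (\<lambda>t. cutoff_primitive a (m N) n t - V n t))
        \<le> (\<Sum>\<^sub>\<infinity>p\<in>admissible. D N p * W p)"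
      by (simp add: group(2))
    have "0 \<le> snorm (\<lambda>t. cutoff_primitive a (m N) n t - V n t)" for N n
      by (rule snorm_nonneg, rule weighted_familyD(1)[OF weighted_family_diff[OF
              cutoff_primitive_family[OF a fin] V_family]])
    then show "\<forall>\<^sub>F N in sequentially. 0 \<le> (\<Sum>\<^sub>\<infinity>n. weight s n * snorm (\<lambda>t. cutoff_primitive a (m N) n t - V n t))"
      by (intro always_eventually allI infsum_nonneg) simp
  qed
qed

lemma ST_dist_Q_cutoff:
  assumes Q: "\<And>S \<zeta>. finite S \<Longrightarrow> Q (\<lambda>x. \<Sum>k\<in>S. \<zeta> k * character k x) =
      (\<lambda>x. \<Sum>p\<in>(S \<times> S) \<inter> admissible.
        conj_sign e1 (\<zeta> (fst p)) * conj_sign e2 (\<zeta> (snd p)) * character (out p) x)"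
    and a: "\<And>n. continuous_on {0..1} (a n)"
    and m: "finite {n. m n \<noteq> 0}" and f: "f \<in> ST_test"
  defines "U \<equiv> curve (\<lambda>n t. free_phase n t * a n t)"
    and "V \<equiv> cutoff_primitive a m"
  shows "ST_dist (Q_cutoff Q m U) f = - ST_dist (curve (\<lambda>n t. free_phase n t * V n t)) (ST_Dt f)
      - \<i> * ST_dist (curve (\<lambda>n t. free_phase n t * V n t)) (ST_Dx (ST_Dx f))"
    and "ST_dist (\<lambda>t. free_propagator t (Q_cutoff Q m U t)) f = - ST_dist (curve V) (ST_Dt f)"
proof -
  note fin = finite_active_pairs[OF m]
  have QU: "Q_cutoff Q m U t g = (\<Sum>p\<in>active_pairs m.
      pair_symbol m p * (free_phase (out p) t * interaction a p t) * torus_dist (character (out p)) g)"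
    if "g \<in> torus_test" for t g
    unfolding U_def by (rule torus_dist_Q_cutoff[OF Q m that])
  have fp: "free_propagator t (Q_cutoff Q m U t) g =
      (\<Sum>p\<in>active_pairs m. pair_symbol m p * interaction a p t * torus_dist (character (out p)) g)" for t g
    by (rule free_propagator_Q_cutoff[OF QU m])
  note cI = interaction_continuous[of "{0..1}" a, OF a] and cP = primitive_continuous[OF a]
  note cF = ST_pairing_continuous ST_test_Dt ST_test_Dx f
  have int: "(\<lambda>t. c * h t) integrable_on {0..1}" if "continuous_on {0..1} h" for c and h :: "real \<Rightarrow> complex"
    using that by (intro integrable_continuous_interval continuous_intros)
  have "ST_dist (\<lambda>t. free_propagator t (Q_cutoff Q m U t)) f =
      integral {0..1} (\<lambda>t. \<Sum>p\<in>active_pairs m. pair_symbol m p * (interaction a p t * ST_pairing (out p) f t))"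
    unfolding ST_dist_def fp ST_pairing_def by (simp add: mult.assoc)
  also have "\<dots> = (\<Sum>p\<in>active_pairs m. pair_symbol m p *
      integral {0..1} (\<lambda>t. interaction a p t * ST_pairing (out p) f t))"
    by (subst integral_sum) (auto intro!: int fin continuous_intros cI cF)
  also have "\<dots> = - (\<Sum>p\<in>active_pairs m. pair_symbol m p *
      integral {0..1} (\<lambda>t. primitive a p t * ST_pairing (out p) (ST_Dt f) t))"
    by (simp add: integral_interaction_by_parts(1)[OF a f] sum_negf)
  also have "\<dots> = - integral {0..1} (\<lambda>t. \<Sum>p\<in>active_pairs m. pair_symbol m p *
      (primitive a p t * ST_pairing (out p) (ST_Dt f) t))"
    by (subst integral_sum) (auto intro!: int fin continuous_intros cP cF)
  also have "\<dots> = - ST_dist (curve V) (ST_Dt f)"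
    unfolding ST_dist_def V_def curve_cutoff_primitive(1)[OF m] by (simp add: mult.assoc)
  finally show "ST_dist (\<lambda>t. free_propagator t (Q_cutoff Q m U t)) f = - ST_dist (curve V) (ST_Dt f)" .
  define P where "P h p = integral {0..1} (\<lambda>t. primitive a p t * (free_phase (out p) t * ST_pairing (out p) h t))"
    for h p
  have P: "ST_dist (curve (\<lambda>n t. free_phase n t * V n t)) h = (\<Sum>p\<in>active_pairs m. pair_symbol m p * P h p)"
    if h: "h \<in> ST_test" for h
  proof -
    have "ST_dist (curve (\<lambda>n t. free_phase n t * V n t)) h =
        integral {0..1} (\<lambda>t. \<Sum>p\<in>active_pairs m. pair_symbol m p *
          (primitive a p t * (free_phase (out p) t * ST_pairing (out p) h t)))"
      unfolding ST_dist_def V_def curve_cutoff_primitive(2)[OF m] by (simp add: mult.assoc)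
    also have "\<dots> = (\<Sum>p\<in>active_pairs m. pair_symbol m p * P h p)"
      unfolding P_def by (subst integral_sum)
        (auto intro!: int fin continuous_intros cP ST_pairing_continuous h)
    finally show ?thesis .
  qed
  have "ST_dist (Q_cutoff Q m U) f = integral {0..1} (\<lambda>t. \<Sum>p\<in>active_pairs m. pair_symbol m p *
      (interaction a p t * (free_phase (out p) t * ST_pairing (out p) f t)))"
    unfolding ST_dist_def QU[OF ST_test_slice[OF f]] ST_pairing_def by (simp add: mult_ac)
  also have "\<dots> = (\<Sum>p\<in>active_pairs m. pair_symbol m p *
      integral {0..1} (\<lambda>t. interaction a p t * (free_phase (out p) t * ST_pairing (out p) f t)))"
    by (subst integral_sum) (auto intro!: int fin continuous_intros cI cF)
  also have "\<dots> = (\<Sum>p\<in>active_pairs m. pair_symbol m p *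
      (- P (ST_Dt f) p - \<i> * P (ST_Dx (ST_Dx f)) p))"
  proof (intro sum.cong refl arg_cong2[where f="(*)"])
    fix p
    have "integral {0..1} (\<lambda>t. primitive a p t * (free_phase (out p) t * (ST_pairing (out p) (ST_Dt f) t
          + \<i> * ST_pairing (out p) (ST_Dx (ST_Dx f)) t))) =
        integral {0..1} (\<lambda>t. primitive a p t * (free_phase (out p) t * ST_pairing (out p) (ST_Dt f) t)
          + \<i> * (primitive a p t * (free_phase (out p) t * ST_pairing (out p) (ST_Dx (ST_Dx f)) t)))"
      by (simp add: algebra_simps)
    also have "\<dots> = P (ST_Dt f) p + \<i> * P (ST_Dx (ST_Dx f)) p"
      unfolding P_def
      by (subst integral_add) (auto intro!: integrable_continuous_interval continuous_intros cP cF)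
    finally show "integral {0..1} (\<lambda>t. interaction a p t * (free_phase (out p) t * ST_pairing (out p) f t)) =
        - P (ST_Dt f) p - \<i> * P (ST_Dx (ST_Dx f)) p"
      unfolding integral_interaction_by_parts(2)[OF a f] by simp
  qed
  also have "\<dots> = - (\<Sum>p\<in>active_pairs m. pair_symbol m p * P (ST_Dt f) p)
      - \<i> * (\<Sum>p\<in>active_pairs m. pair_symbol m p * P (ST_Dx (ST_Dx f)) p)"
    by (simp add: algebra_simps sum_negf sum_subtractf sum_distrib_left)
  finally show "ST_dist (Q_cutoff Q m U) f = - ST_dist (curve (\<lambda>n t. free_phase n t * V n t)) (ST_Dt f)
      - \<i> * ST_dist (curve (\<lambda>n t. free_phase n t * V n t)) (ST_Dx (ST_Dx f))"
    by (simp only: P ST_test_Dt ST_test_Dx f)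
qed

text \<open>The nonlinear term is \<open>v\<close>, defined by the equation itself.  The sum of the primitives of the
  interactions at frequency \<open>n\<close> equals \<open>- (i / \<omega>) a n\<close> by \<open>eq\<close>, and the nonlinear terms after the cutoff
  converge to the time derivative of these sums, which in the rest frame is \<open>v\<close>.\<close>

lemma solution_from_coefficients:
  assumes Q: "\<And>S \<zeta>. finite S \<Longrightarrow> Q (\<lambda>x. \<Sum>k\<in>S. \<zeta> k * character k x) =
      (\<lambda>x. \<Sum>p\<in>(S \<times> S) \<inter> admissible.
        conj_sign e1 (\<zeta> (fst p)) * conj_sign e2 (\<zeta> (snd p)) * character (out p) x)"
    and \<omega>: "\<omega> \<noteq> 0"
    and family: "weighted_family s a" and a0: "\<And>n. a n 0 = 0"
    and W: "(\<lambda>p. weight s (out p) * snorm (primitive a p)) summable_on admissible"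
    and eq: "\<And>n t. t \<in> {0..1} \<Longrightarrow>
      \<i> * a n t + of_real \<omega> * (\<Sum>\<^sub>\<infinity>p\<in>{p\<in>admissible. out p = n}. primitive a p t) = 0"
  defines "U \<equiv> curve (\<lambda>n t. free_phase n t * a n t)"
  shows "extended_weak_solution s \<omega> Q (\<lambda>g. 0) U"
    and "cutoff_sequence m \<Longrightarrow>
      \<exists>F. Cm1_tendsto s (\<lambda>N. ST_dist (\<lambda>t. free_propagator t (Q_cutoff Q (m N) U t))) F"
proof -
  note a = weighted_familyD(1)[OF family]
  have twist: "weighted_family s (\<lambda>n t. free_phase n t * z n t)" if "weighted_family s z" for z
    by (rule weighted_family_mult[OF that continuous_on_free_phase, where C=1]) simp
  note U_family = twist[OF family]
  define V where "V n t = - (\<i> / of_real \<omega>) * a n t" for n t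
  have V: "V n t = (\<Sum>\<^sub>\<infinity>p\<in>{p\<in>admissible. out p = n}. primitive a p t)" if "t \<in> {0..1}" for n t
    using eq[OF that, of n] \<omega> by (simp add: V_def field_simps add_eq_0_iff)
  have V_family: "weighted_family s V"
    unfolding V_def[abs_def]
    by (rule weighted_family_mult[OF family, where e="\<lambda>_ _. - (\<i> / of_real \<omega>)"
        and C="norm (\<i> / of_real \<omega>)"]) (auto intro: continuous_intros)
  have fin: "finite {n. m N n \<noteq> 0}" if "cutoff_sequence m" for m N
    using that by (simp add: cutoff_sequence_def)
  have C_family: "weighted_family s (cutoff_primitive a (m N))" if "cutoff_sequence m" for m N
    by (rule cutoff_primitive_family[OF a fin[OF that]])
  note lim = cutoff_primitive_tendsto[OF a W V V_family]

  have UV: "ST_dist (curve (\<lambda>n t. free_phase n t * V n t)) f = - (\<i> / of_real \<omega>) * ST_dist U f" for f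
  proof -
    have "(\<lambda>n t. free_phase n t * V n t) = (\<lambda>n t. - (\<i> / of_real \<omega>) * (free_phase n t * a n t))"
      by (simp add: V_def fun_eq_iff)
    then show ?thesis by (simp only: ST_dist_curve_cmult U_def)
  qed
  define v where "v f = \<i> / of_real \<omega> * ST_dist U (ST_Dt f)
      + (- 1 / of_real \<omega>) * ST_dist U (ST_Dx (ST_Dx f))" for f
  have v: "ST_distribution v"
    unfolding v_def[abs_def] U_def by (rule ST_distribution_curve_derivatives[OF U_family])
  have Q_lim: "ST_tendsto (\<lambda>N. ST_dist (Q_cutoff Q (m N) U)) v" if m: "cutoff_sequence m" for m
    unfolding ST_tendsto_def
  proof
    fix f assume f: "f \<in> ST_test"
    have "snorm (\<lambda>t. free_phase n t * cutoff_primitive a (m N) n t - free_phase n t * V n t) =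
        snorm (\<lambda>t. cutoff_primitive a (m N) n t - V n t)" for N n
      by (rule snorm_cong) (simp add: norm_mult flip: right_diff_distrib)
    then have *: "(\<lambda>N. ST_dist (curve (\<lambda>n t. free_phase n t * cutoff_primitive a (m N) n t)) h)
        \<longlonglongrightarrow> ST_dist (curve (\<lambda>n t. free_phase n t * V n t)) h" if "h \<in> ST_test" for h
      using lim[OF _ m] that
      by (intro ST_dist_curve_tendsto[OF twist[OF C_family[OF m]] twist[OF V_family]]) simp_all
    have QN: "ST_dist (Q_cutoff Q (m N) U) f =
        - ST_dist (curve (\<lambda>n t. free_phase n t * cutoff_primitive a (m N) n t)) (ST_Dt f)
        - \<i> * ST_dist (curve (\<lambda>n t. free_phase n t * cutoff_primitive a (m N) n t)) (ST_Dx (ST_Dx f))" for N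
      unfolding U_def by (rule ST_dist_Q_cutoff(1)[OF Q a fin[OF m] f])
    note * = * [OF ST_test_Dt[OF f]] * [OF ST_test_Dx[OF ST_test_Dx[OF f]]]
    have "(\<lambda>N. ST_dist (Q_cutoff Q (m N) U) f) \<longlonglongrightarrow>
        - ST_dist (curve (\<lambda>n t. free_phase n t * V n t)) (ST_Dt f)
        - \<i> * ST_dist (curve (\<lambda>n t. free_phase n t * V n t)) (ST_Dx (ST_Dx f))"
      unfolding QN by (intro tendsto_intros *)
    also have "- ST_dist (curve (\<lambda>n t. free_phase n t * V n t)) (ST_Dt f)
        - \<i> * ST_dist (curve (\<lambda>n t. free_phase n t * V n t)) (ST_Dx (ST_Dx f)) = v f"
      using \<omega> by (simp add: UV v_def field_simps)
    finally show "(\<lambda>N. ST_dist (Q_cutoff Q (m N) U) f) \<longlonglongrightarrow> v f" .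
  qed
  have zero: "torus_series (\<lambda>n. 0) g = 0" for g by (simp add: torus_series_def)
  show "extended_weak_solution s \<omega> Q (\<lambda>g. 0) U"
    unfolding extended_weak_solution_def
  proof (intro conjI ballI exI[of _ v])
    show "U \<in> C0_Hs s" unfolding U_def by (rule curve_in_C0_Hs[OF U_family])
    show "U 0 g = 0" for g unfolding U_def curve_def by (simp add: a0 zero)
    show "Q_exists_as Q U v" unfolding Q_exists_as_def using v Q_lim by blast
    show "\<i> * dist_dt (ST_dist U) f + dist_dx (dist_dx (ST_dist U)) f + of_real \<omega> * v f = 0" for f
      using \<omega> by (simp add: v_def dist_dt_def dist_dx_def field_simps)
  qed
  assume m: "cutoff_sequence m"
  define Vm where "Vm N = cutoff_primitive a (m N)" for N
  have Vm: "weighted_family s (Vm N)" for N unfolding Vm_def by (rule C_family[OF m])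
  have dt: "ST_distribution (dist_dt (ST_dist (curve z)))" if "weighted_family s z" for z
    using ST_distribution_curve_derivatives[OF that, of "-1" 0]
    by (simp add: dist_dt_def[abs_def])
  have FN: "ST_dist (\<lambda>t. free_propagator t (Q_cutoff Q (m N) U t)) f = dist_dt (ST_dist (curve (Vm N))) f"
    if "f \<in> ST_test" for N f
    unfolding U_def Vm_def dist_dt_def by (rule ST_dist_Q_cutoff(2)[OF Q a fin[OF m] that])
  have prim_N: "Cm1_primitive s (ST_dist (\<lambda>t. free_propagator t (Q_cutoff Q (m N) U t))) (curve (Vm N))" for N
    unfolding Cm1_primitive_def
  proof (intro conjI ballI)
    show "ST_distribution (ST_dist (\<lambda>t. free_propagator t (Q_cutoff Q (m N) U t)))"
      by (rule ST_distribution_cong[OF FN dt[OF Vm]])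
    show "curve (Vm N) 0 g = 0" for g
      by (simp add: curve_def Vm_def cutoff_primitive_def zero)
  qed (simp_all add: curve_in_C0_Hs[OF Vm] FN)
  have prim: "Cm1_primitive s (dist_dt (ST_dist (curve V))) (curve V)"
    unfolding Cm1_primitive_def
    using dt[OF V_family] curve_in_C0_Hs[OF V_family] by (simp add: curve_def V_def a0 zero)
  define S where "S N = (\<Sum>\<^sub>\<infinity>n. weight s n * snorm (\<lambda>t. Vm N n t - V n t))" for N
  have S: "S \<longlonglongrightarrow> 0" unfolding S_def[abs_def] Vm_def using lim[OF _ m] by simp
  have le: "Hs_norm s (\<lambda>g. curve (Vm N) t g - curve V t g) \<le> S N" if t: "t \<in> {0..1}" for N t
  proof -
    note d = weighted_family_diff[OF Vm[of N] V_family]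
    have fc: "fourier_coeff (\<lambda>g. curve (Vm N) t g - curve V t g) n = Vm N n t - V n t" for n
      by (simp add: fourier_coeff_diff curve_def)
    have "Hs_norm s (\<lambda>g. curve (Vm N) t g - curve V t g) \<le> (\<Sum>\<^sub>\<infinity>n. weight s n * norm (Vm N n t - V n t))"
      using Hs_norm_le_l1(2)[of s "\<lambda>g. curve (Vm N) t g - curve V t g"] weighted_family_summable[OF d t]
      by (simp add: fc)
    also have "\<dots> \<le> S N"
      unfolding S_def
      by (rule infsum_mono[OF weighted_family_summable[OF d t] weighted_familyD(2)[OF d]])
        (intro mult_left_mono snorm_upper weighted_familyD(1)[OF d] t weight_nonneg)
    finally show ?thesis .
  qed
  have "(\<lambda>N. SUP t\<in>{0..1}. Hs_norm s (\<lambda>g. curve (Vm N) t g - curve V t g)) \<longlonglongrightarrow> 0"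
  proof (rule tendsto_sandwich[OF _ _ tendsto_const S]; intro always_eventually allI)
    fix N
    have "Hs_norm s (\<lambda>g. curve (Vm N) 0 g - curve V 0 g)
        \<le> (SUP t\<in>{0..1}. Hs_norm s (\<lambda>g. curve (Vm N) t g - curve V t g))"
      by (rule cSUP_upper) (auto intro!: bdd_aboveI2[of _ _ "S N"] le)
    then show "0 \<le> (SUP t\<in>{0..1}. Hs_norm s (\<lambda>g. curve (Vm N) t g - curve V t g))"
      using Hs_norm_nonneg order_trans by blast
    show "(SUP t\<in>{0..1}. Hs_norm s (\<lambda>g. curve (Vm N) t g - curve V t g)) \<le> S N"
      by (rule cSUP_least) (auto intro: le)
  qed
  then show "\<exists>F. Cm1_tendsto s (\<lambda>N. ST_dist (\<lambda>t. free_propagator t (Q_cutoff Q (m N) U t))) F"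
    unfolding Cm1_tendsto_def using prim_N prim
    by (intro exI[of _ "dist_dt (ST_dist (curve V))"] exI[of _ "\<lambda>N. curve (Vm N)"]
        exI[of _ "curve V"] conjI allI)
qed

end

section \<open>Oscillatory integrals and approximation by products\<close>

definition wave :: "real \<Rightarrow> real \<Rightarrow> complex" where
  "wave \<mu> t = exp (\<i> * of_real \<mu> * of_real t)"

lemma norm_wave [simp]: "norm (wave \<mu> t) = 1"
  by (simp add: wave_def norm_exp_eq_Re)

lemma wave_0 [simp]: "wave \<mu> 0 = 1"
  by (simp add: wave_def)

lemma wave_mult: "wave \<mu> t * wave \<nu> t = wave (\<mu> + \<nu>) t"
  by (simp add: wave_def algebra_simps flip: exp_add)

lemma cnj_wave: "cnj (wave \<mu> t) = wave (- \<mu>) t"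
  by (simp add: wave_def exp_cnj)

lemma continuous_on_wave [continuous_intros]: "continuous_on A (wave \<mu>)"
  unfolding wave_def[abs_def] by (intro continuous_intros)

lemma wave_has_derivative:
  "(wave \<mu> has_vector_derivative \<i> * of_real \<mu> * wave \<mu> t) (at t within A)"
  unfolding wave_def[abs_def]
  by (rule has_vector_derivative_real_field) (auto intro!: derivative_eq_intros)

lemma norm_integral_unit_le:
  fixes f :: "real \<Rightarrow> complex"
  assumes "continuous_on {0..1} f" "t \<in> {0..1}" "\<And>r. r \<in> {0..1} \<Longrightarrow> norm (f r) \<le> B"
  shows "norm (integral {0..t} f) \<le> B"
proof -
  have B: "0 \<le> B" by (rule order_trans[OF norm_ge_zero assms(3)[of 0]]) simp
  have "norm (integral {0..t} f) \<le> B * (t - 0)"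
    by (rule integral_bound) (use assms in \<open>auto intro: continuous_on_subset\<close>)
  also have "\<dots> \<le> B" using assms(2) B by (simp add: mult_left_le)
  finally show ?thesis .
qed

lemma integral_wave_by_parts:
  assumes t: "t \<in> {0..1}"
    and f: "\<And>r. r \<in> {0..1} \<Longrightarrow> (f has_vector_derivative f' r) (at r within {0..1})"
    and f': "continuous_on {0..1} f'"
  shows "integral {0..t} (\<lambda>r. wave \<mu> r * f' r) =
    wave \<mu> t * f t - f 0 - \<i> * of_real \<mu> * integral {0..t} (\<lambda>r. wave \<mu> r * f r)"
proof -
  have f_cont: "continuous_on {0..1} f"
    unfolding continuous_on_eq_continuous_within using has_vector_derivative_continuous[OF f] by blast
  have sub: "{0..t} \<subseteq> {0..1}" using t by auto
  note c = continuous_on_subset[OF f' sub] continuous_on_subset[OF f_cont sub]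
  have "((\<lambda>r. wave \<mu> r * f' r + (\<i> * of_real \<mu> * wave \<mu> r) * f r) has_integral
      wave \<mu> t * f t - wave \<mu> 0 * f 0) {0..t}"
  proof (rule fundamental_theorem_of_calculus)
    fix r assume "r \<in> {0..t}"
    then have "r \<in> {0..1}" using sub by auto
    then show "((\<lambda>r. wave \<mu> r * f r) has_vector_derivative
        wave \<mu> r * f' r + (\<i> * of_real \<mu> * wave \<mu> r) * f r) (at r within {0..t})"
      by (intro has_vector_derivative_mult wave_has_derivative
          has_vector_derivative_within_subset[OF f sub])
  qed (use t in auto)
  then have "wave \<mu> t * f t - f 0 =
      integral {0..t} (\<lambda>r. wave \<mu> r * f' r + \<i> * of_real \<mu> * (wave \<mu> r * f r))"
    by (simp add: integral_unique mult.assoc)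
  also have "\<dots> = integral {0..t} (\<lambda>r. wave \<mu> r * f' r) + \<i> * of_real \<mu> * integral {0..t} (\<lambda>r. wave \<mu> r * f r)"
    by (subst integral_add) (auto intro!: integrable_continuous_interval continuous_intros c)
  finally show ?thesis by simp
qed

text \<open>Integration by parts gains the factor \<open>1 / \<bar>\<mu>\<bar>\<close>; both boundary terms and the remaining integral are
  bounded by \<open>B\<close>.\<close>

lemma oscillatory_integral_le:
  assumes t: "t \<in> {0..1}" and \<mu>: "\<mu> \<noteq> 0"
    and f: "\<And>r. r \<in> {0..1} \<Longrightarrow> (f has_vector_derivative f' r) (at r within {0..1})"
    and f': "continuous_on {0..1} f'"
    and B: "\<And>r. r \<in> {0..1} \<Longrightarrow> norm (f r) \<le> B" "\<And>r. r \<in> {0..1} \<Longrightarrow> norm (f' r) \<le> B"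
  shows "norm (integral {0..t} (\<lambda>r. wave \<mu> r * f r)) \<le> 3 * B / \<bar>\<mu>\<bar>"
proof -
  have "\<i> * of_real \<mu> * integral {0..t} (\<lambda>r. wave \<mu> r * f r) =
      wave \<mu> t * f t - f 0 - integral {0..t} (\<lambda>r. wave \<mu> r * f' r)"
    using integral_wave_by_parts[OF t f f', of \<mu>] by simp
  then have "\<bar>\<mu>\<bar> * norm (integral {0..t} (\<lambda>r. wave \<mu> r * f r)) =
      norm (wave \<mu> t * f t - f 0 - integral {0..t} (\<lambda>r. wave \<mu> r * f' r))"
    by (metis norm_mult norm_ii norm_of_real mult_1)
  also have "\<dots> \<le> norm (wave \<mu> t * f t) + norm (f 0) + norm (integral {0..t} (\<lambda>r. wave \<mu> r * f' r))"
    by (intro order_trans[OF norm_triangle_ineq4] add_mono norm_triangle_ineq4 order_refl)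
  also have "norm (integral {0..t} (\<lambda>r. wave \<mu> r * f' r)) \<le> B"
    by (rule norm_integral_unit_le[OF _ t])
      (auto simp: norm_mult intro!: continuous_intros f' B)
  also have "norm (wave \<mu> t * f t) + norm (f 0) + B \<le> 3 * B"
    using B(1)[OF t] B(1)[of 0] by (simp add: norm_mult)
  finally show ?thesis using \<mu> by (simp add: field_simps)
qed

definition twice_smooth ::
  "(real \<Rightarrow> complex) \<Rightarrow> (real \<Rightarrow> complex) \<Rightarrow> (real \<Rightarrow> complex) \<Rightarrow> bool" where
  "twice_smooth f f' f'' \<longleftrightarrow> (\<forall>t. (f has_vector_derivative f' t) (at t)) \<and>
     (\<forall>t. (f' has_vector_derivative f'' t) (at t)) \<and> continuous_on UNIV f''"

lemma twice_smoothD: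
  assumes "twice_smooth f f' f''"
  shows "(f has_vector_derivative f' t) (at t within A)" "(f' has_vector_derivative f'' t) (at t within A)"
    "continuous_on A f" "continuous_on A f'" "continuous_on A f''"
proof -
  show d: "(f has_vector_derivative f' t) (at t within A)" "(f' has_vector_derivative f'' t) (at t within A)"
    for t A
    using assms unfolding twice_smooth_def by (auto intro: has_vector_derivative_at_within)
  show "continuous_on A f" "continuous_on A f'"
    unfolding continuous_on_eq_continuous_within
    using d has_vector_derivative_continuous by blast+
  show "continuous_on A f''"
    using assms unfolding twice_smooth_def by (auto intro: continuous_on_subset)
qed

lemma twice_smooth_bounded:
  assumes "twice_smooth f f' f''"
  shows "\<exists>B\<ge>1. \<forall>t\<in>{0..1}. norm (f t) \<le> B \<and> norm (f' t) \<le> B \<and> norm (f'' t) \<le> B"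
proof -
  note c = twice_smoothD(3-5)[OF assms, of "{0..1}"]
  let ?B = "1 + snorm f + snorm f' + snorm f''"
  have "norm (f t) \<le> ?B \<and> norm (f' t) \<le> ?B \<and> norm (f'' t) \<le> ?B" if "t \<in> {0..1}" for t
    using snorm_upper[OF c(1) that] snorm_upper[OF c(2) that] snorm_upper[OF c(3) that]
      snorm_nonneg[OF c(1)] snorm_nonneg[OF c(2)] snorm_nonneg[OF c(3)] by linarith
  moreover have "1 \<le> ?B"
    using snorm_nonneg[OF c(1)] snorm_nonneg[OF c(2)] snorm_nonneg[OF c(3)] by linarith
  ultimately show ?thesis by blast
qed

lemma twice_smooth_mult:
  assumes "twice_smooth f f' f''" "twice_smooth g g' g''"
  shows "twice_smooth (\<lambda>t. f t * g t) (\<lambda>t. f t * g' t + f' t * g t)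
    (\<lambda>t. (f t * g'' t + f' t * g' t) + (f' t * g' t + f'' t * g t))"
  unfolding twice_smooth_def
  by (intro conjI allI continuous_intros has_vector_derivative_mult has_vector_derivative_add
      twice_smoothD[OF assms(1)] twice_smoothD[OF assms(2)])

lemma twice_smooth_polynomial_derivative:
  fixes g :: "real \<Rightarrow> complex"
  assumes "polynomial_function g"
  obtains g1 g2 g3 where "twice_smooth g1 g2 g3" "\<And>t. (g has_vector_derivative g1 t) (at t)"
proof -
  obtain g1 where 1: "polynomial_function g1" "\<And>t. (g has_vector_derivative g1 t) (at t)"
    using has_vector_derivative_polynomial_function[OF assms] by blast
  obtain g2 where 2: "polynomial_function g2" "\<And>t. (g1 has_vector_derivative g2 t) (at t)"
    using has_vector_derivative_polynomial_function[OF 1(1)] by blast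
  obtain g3 where 3: "polynomial_function g3" "\<And>t. (g2 has_vector_derivative g3 t) (at t)"
    using has_vector_derivative_polynomial_function[OF 2(1)] by blast
  show ?thesis
    by (rule that[of g1 g2 g3])
      (use 1 2 3 continuous_on_polymonial_function in \<open>auto simp: twice_smooth_def\<close>)
qed

definition ramp :: "real \<Rightarrow> real \<Rightarrow> complex" where
  "ramp \<Lambda> t = of_real (1 - exp (- \<Lambda> * t))"

lemma twice_smooth_ramp:
  "twice_smooth (ramp \<Lambda>) (\<lambda>t. of_real (\<Lambda> * exp (- \<Lambda> * t))) (\<lambda>t. of_real (- \<Lambda> * (\<Lambda> * exp (- \<Lambda> * t))))"
  unfolding twice_smooth_def ramp_def[abs_def]
  by (intro conjI allI continuous_intros has_vector_derivative_of_real)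
    (auto simp: has_real_derivative_iff_has_vector_derivative[symmetric] intro!: derivative_eq_intros)

text \<open>Differentiate a polynomial approximation of \<open>Y\<close> and multiply the derivative by the square of a ramp, one
  factor for \<open>\<beta>\<close> and one for \<open>\<gamma>\<close>.  The ramp makes both vanish at \<open>0\<close>; it is nearly \<open>1\<close> outside a short
  initial layer, so the primitive hardly changes.\<close>

lemma approximate_by_primitive_of_product:
  assumes Y: "continuous_on {0..1} Y" "Y 0 = 0" and \<eta>: "\<eta> > 0"
  obtains \<beta> \<beta>' \<beta>'' \<gamma> \<gamma>' \<gamma>'' where "twice_smooth \<beta> \<beta>' \<beta>''" "twice_smooth \<gamma> \<gamma>' \<gamma>''"
    "\<beta> 0 = 0" "\<gamma> 0 = 0" "\<And>t. cnj (\<beta> t) = \<beta> t"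
    "\<And>t. t \<in> {0..1} \<Longrightarrow> norm (integral {0..t} (\<lambda>r. \<beta> r * \<gamma> r) - Y t) \<le> \<eta>"
proof -
  obtain g where g: "polynomial_function g" "\<And>t. t \<in> {0..1} \<Longrightarrow> norm (Y t - g t) < \<eta> / 4"
    using Stone_Weierstrass_polynomial_function[of "{0..1}" Y "\<eta> / 4"] Y \<eta> by auto
  obtain g1 g2 g3 where g1: "twice_smooth g1 g2 g3" "\<And>t. (g has_vector_derivative g1 t) (at t)"
    using twice_smooth_polynomial_derivative[OF g(1)] by blast
  obtain G where G: "G \<ge> 1" "\<And>t. t \<in> {0..1} \<Longrightarrow> norm (g1 t) \<le> G"
    using twice_smooth_bounded[OF g1(1)] by blast
  define \<Lambda> where "\<Lambda> = 4 * G / \<eta>"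
  have \<Lambda>: "\<Lambda> > 0" using G \<eta> by (simp add: \<Lambda>_def)
  note ramp = twice_smooth_ramp[of \<Lambda>]
  have small: "norm (integral {0..t} (\<lambda>r. ramp \<Lambda> r * (g1 r * ramp \<Lambda> r)) - Y t) \<le> \<eta>"
    if t: "t \<in> {0..1}" for t
  proof -
    have "(g1 has_integral g t - g 0) {0..t}"
      by (rule fundamental_theorem_of_calculus)
        (use t in \<open>auto intro: has_vector_derivative_at_within g1(2)\<close>)
    then have "integral {0..t} (\<lambda>r. ramp \<Lambda> r * (g1 r * ramp \<Lambda> r)) - (g t - g 0) =
        integral {0..t} (\<lambda>r. ramp \<Lambda> r * (g1 r * ramp \<Lambda> r) - g1 r)"
      by (subst integral_diff)
        (auto simp: integral_unique intro!: integrable_continuous_interval continuous_intros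
          twice_smoothD[OF ramp] twice_smoothD[OF g1(1)])
    also have "norm \<dots> \<le> integral {0..t} (\<lambda>r. 2 * G * exp (- \<Lambda> * r))"
    proof (rule integral_norm_bound_integral)
      fix r assume r: "r \<in> {0..t}"
      then have r1: "r \<in> {0..1}" using t by auto
      define x where "x = exp (- \<Lambda> * r)"
      have x: "0 < x" "x \<le> 1" using r \<Lambda> by (auto simp: x_def)
      have "ramp \<Lambda> r * (g1 r * ramp \<Lambda> r) - g1 r = of_real ((1 - x)\<^sup>2 - 1) * g1 r"
        by (simp add: ramp_def x_def power2_eq_square algebra_simps)
      then have "norm (ramp \<Lambda> r * (g1 r * ramp \<Lambda> r) - g1 r) = \<bar>(1 - x)\<^sup>2 - 1\<bar> * norm (g1 r)"
        by (simp only: norm_mult norm_of_real)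
      also have "\<bar>(1 - x)\<^sup>2 - 1\<bar> = x * (2 - x)"
        using x by (simp add: power2_eq_square algebra_simps abs_if)
      also have "x * (2 - x) * norm (g1 r) \<le> (x * 2) * G"
        by (intro mult_mono mult_left_mono G r1) (use x in auto)
      finally show "norm (ramp \<Lambda> r * (g1 r * ramp \<Lambda> r) - g1 r) \<le> 2 * G * exp (- \<Lambda> * r)"
        by (simp add: x_def mult_ac)
    qed (auto intro!: integrable_continuous_interval continuous_intros
          twice_smoothD[OF ramp] twice_smoothD[OF g1(1)])
    also have "\<dots> = 2 * G / \<Lambda> - 2 * G / \<Lambda> * exp (- \<Lambda> * t)"
    proof (rule integral_unique)
      have "((\<lambda>r. 2 * G * exp (- \<Lambda> * r)) has_integral
          (- (2 * G / \<Lambda>) * exp (- \<Lambda> * t)) - (- (2 * G / \<Lambda>) * exp (- \<Lambda> * 0))) {0..t}"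
        by (rule fundamental_theorem_of_calculus)
          (use t \<Lambda> in \<open>auto simp: has_real_derivative_iff_has_vector_derivative[symmetric]
            intro!: derivative_eq_intros\<close>)
      then show "((\<lambda>r. 2 * G * exp (- \<Lambda> * r)) has_integral
          2 * G / \<Lambda> - 2 * G / \<Lambda> * exp (- \<Lambda> * t)) {0..t}" by simp
    qed
    also have "\<dots> \<le> 2 * G / \<Lambda>" using G \<Lambda> by simp
    also have "\<dots> = \<eta> / 2" using G \<eta> by (simp add: \<Lambda>_def)
    finally have 1: "norm (integral {0..t} (\<lambda>r. ramp \<Lambda> r * (g1 r * ramp \<Lambda> r)) - (g t - g 0)) \<le> \<eta> / 2" .
    have 2: "norm (Y t - g t) \<le> \<eta> / 4" using g(2)[OF t] by simp
    have 3: "norm (g 0) \<le> \<eta> / 4" using g(2)[of 0] Y(2) by simp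
    define E where "E = integral {0..t} (\<lambda>r. ramp \<Lambda> r * (g1 r * ramp \<Lambda> r)) - (g t - g 0)"
    have E: "integral {0..t} (\<lambda>r. ramp \<Lambda> r * (g1 r * ramp \<Lambda> r)) - Y t = (E - (Y t - g t)) - g 0"
      by (simp add: E_def)
    show ?thesis
      unfolding E using 1[folded E_def] 2 3 norm_triangle_ineq4[of "E - (Y t - g t)" "g 0"]
        norm_triangle_ineq4[of E "Y t - g t"] by simp
  qed
  show ?thesis
    by (rule that[OF ramp twice_smooth_mult[OF g1(1) ramp] _ _ _ small]) (simp_all add: ramp_def)
qed

section \<open>Approximate solutions\<close>

text \<open>For the signs \<open>(1, -1)\<close> the nonlinearity is real, so the equation forces the modes \<open>n\<close> and
  \<open>- n\<close> of a solution to be related: \<open>a (- n)\<close> has the derivative of \<open>- mirror n (a n)\<close>, where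
  the derivative of \<open>mirror n f\<close> is that of \<open>f\<close>, conjugated and multiplied by \<open>exp (2 i n\<^sup>2 t)\<close>.
  Integration by parts gives the following form, which makes sense for continuous \<open>f\<close>.\<close>

definition mirror :: "int \<Rightarrow> (real \<Rightarrow> complex) \<Rightarrow> real \<Rightarrow> complex" where
  "mirror n f t = wave (2 * of_int (n\<^sup>2)) t * cnj (f t)
     - \<i> * of_real (2 * of_int (n\<^sup>2)) * integral {0..t} (\<lambda>r. wave (2 * of_int (n\<^sup>2)) r * cnj (f r))"

lemma mirror_eq_integral:
  assumes t: "t \<in> {0..1}" and f0: "f 0 = 0"
    and f: "\<And>r. r \<in> {0..1} \<Longrightarrow> (f has_vector_derivative f' r) (at r within {0..1})"
    and f': "continuous_on {0..1} f'"
  shows "mirror n f t = integral {0..t} (\<lambda>r. wave (2 * of_int (n\<^sup>2)) r * cnj (f' r))"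
proof -
  have "((\<lambda>r. cnj (f r)) has_vector_derivative cnj (f' r)) (at r within {0..1})"
    if "r \<in> {0..1}" for r
    using f[OF that] by (rule has_vector_derivative_cnj)
  from integral_wave_by_parts[OF t this, of "2 * of_int (n\<^sup>2)"] show ?thesis
    by (simp add: mirror_def f0 f' continuous_intros)
qed

lemma continuous_on_mirror:
  assumes "continuous_on {0..1} f" shows "continuous_on {0..1} (mirror n f)"
  unfolding mirror_def[abs_def]
  by (intro continuous_intros assms indefinite_integral_continuous_1 integrable_continuous_interval)

lemma mirror_at_0: "f 0 = 0 \<Longrightarrow> mirror n f 0 = 0"
  by (simp add: mirror_def)

lemma mirror_zero: "mirror n (\<lambda>_. 0) t = 0"
  by (simp add: mirror_def)

lemma snorm_mirror_le:
  assumes f: "continuous_on {0..1} f"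
  shows "snorm (mirror n f) \<le> (1 + 2 * (of_int n)\<^sup>2) * snorm f"
proof (rule snorm_least)
  fix t :: real assume t: "t \<in> {0..1}"
  have "norm (integral {0..t} (\<lambda>r. wave (2 * of_int (n\<^sup>2)) r * cnj (f r))) \<le> snorm f"
    by (rule norm_integral_unit_le[OF _ t])
      (auto simp: norm_mult intro!: continuous_intros f snorm_upper)
  then have "norm (\<i> * of_real (2 * of_int (n\<^sup>2)) * integral {0..t} (\<lambda>r. wave (2 * of_int (n\<^sup>2)) r * cnj (f r)))
      \<le> 2 * (of_int n)\<^sup>2 * snorm f"
    by (simp add: norm_mult norm_power mult_left_mono)
  moreover have "norm (wave (2 * of_int (n\<^sup>2)) t * cnj (f t)) \<le> snorm f"
    using snorm_upper[OF f t] by (simp add: norm_mult)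
  ultimately show "norm (mirror n f t) \<le> (1 + 2 * (of_int n)\<^sup>2) * snorm f"
    unfolding mirror_def distrib_right mult_1
    by (intro order_trans[OF norm_triangle_ineq4] add_mono)
qed

lemma mirror_add_cmult:
  assumes f: "continuous_on {0..1} f" and g: "continuous_on {0..1} g" and t: "t \<in> {0..1}"
  shows "mirror n (\<lambda>t. c * f t + d * g t) t = cnj c * mirror n f t + cnj d * mirror n g t"
proof -
  define \<mu> :: real where "\<mu> = 2 * of_int (n\<^sup>2)"
  have sub: "{0..t} \<subseteq> {0..1}" using t by auto
  have int: "(\<lambda>r. e * (wave \<mu> r * cnj (h r))) integrable_on {0..t}" if "continuous_on {0..1} h" for e h
    by (intro integrable_continuous_interval continuous_intros continuous_on_subset[OF that sub])
  have "integral {0..t} (\<lambda>r. wave \<mu> r * cnj (c * f r + d * g r)) =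
      integral {0..t} (\<lambda>r. cnj c * (wave \<mu> r * cnj (f r)) + cnj d * (wave \<mu> r * cnj (g r)))"
    by (simp add: algebra_simps)
  also have "\<dots> = cnj c * integral {0..t} (\<lambda>r. wave \<mu> r * cnj (f r)) + cnj d * integral {0..t} (\<lambda>r. wave \<mu> r * cnj (g r))"
    by (subst integral_add) (auto intro!: int f g)
  finally show ?thesis
    unfolding mirror_def \<mu>_def[symmetric] by (simp add: algebra_simps)
qed

lemma mirror_sum:
  assumes "\<And>p. p \<in> P \<Longrightarrow> continuous_on {0..1} (f p)" "t \<in> {0..1}"
  shows "mirror n (\<lambda>t. \<Sum>p\<in>P. f p t) t = (\<Sum>p\<in>P. mirror n (f p) t)"
  using assms(1)
proof (induction P rule: infinite_finite_induct)
  case (insert p P)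
  have "mirror n (\<lambda>t. \<Sum>p\<in>insert p P. f p t) t = mirror n (\<lambda>t. 1 * f p t + 1 * (\<Sum>p\<in>P. f p t)) t"
    using insert.hyps by simp
  also have "\<dots> = cnj 1 * mirror n (f p) t + cnj 1 * mirror n (\<lambda>t. \<Sum>p\<in>P. f p t) t"
    by (rule mirror_add_cmult[OF _ _ assms(2)]) (use insert.prems in \<open>auto intro!: continuous_intros\<close>)
  finally show ?case using insert by simp
qed (simp_all add: mirror_zero)

locale quadratic_equation = quadratic_interaction e1 e2 for e1 e2 :: int +
  fixes s \<omega> :: real
  assumes s_neg: "s < 0" and \<omega>_nz: "\<omega> \<noteq> 0"
begin

definition modes :: "int \<Rightarrow> int set" where "modes M = {- M..M}"

definition pairs :: "int \<Rightarrow> (int \<times> int) set" where "pairs M = (modes M \<times> modes M) \<inter> admissible"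

text \<open>The time-integrated error in the mode \<open>n\<close> of the equation.\<close>

definition defect :: "int \<Rightarrow> (int \<Rightarrow> real \<Rightarrow> complex) \<Rightarrow> int \<Rightarrow> real \<Rightarrow> complex" where
  "defect M a n t = \<i> * a n t + of_real \<omega> * (\<Sum>p\<in>{p\<in>pairs M. out p = n}. primitive a p t)"

text \<open>The decrease of this quantity in a correction step bounds the resonant interactions that the step
  introduces, up to a constant factor and a small error.\<close>

definition total_defect :: "int \<Rightarrow> (int \<Rightarrow> real \<Rightarrow> complex) \<Rightarrow> real" where
  "total_defect M a = (\<Sum>n\<in>modes (2 * M). weight s n * snorm (defect M a n))"

abbreviation pair_size :: "(int \<Rightarrow> real \<Rightarrow> complex) \<Rightarrow> int \<times> int \<Rightarrow> real" where
  "pair_size a p \<equiv> weight s (out p) * snorm (primitive a p)"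

text \<open>When the signs differ, the mirror relation is recorded for positive \<open>n\<close> only, the frequencies at which
  corrections are made in that case, and the mode \<open>0\<close> vanishes because nothing interacts there.\<close>

definition approximate_state :: "int \<Rightarrow> (int \<Rightarrow> real \<Rightarrow> complex) \<Rightarrow> bool" where
  "approximate_state M a \<longleftrightarrow> M \<ge> 0 \<and> (\<forall>n. continuous_on {0..1} (a n)) \<and> (\<forall>n. a n 0 = 0) \<and>
     (\<forall>n. n \<notin> modes M \<longrightarrow> a n = (\<lambda>_. 0)) \<and>
     (e1 \<noteq> e2 \<longrightarrow> a 0 = (\<lambda>_. 0) \<and> (\<forall>n>0. \<forall>t\<in>{0..1}. a (- n) t = - mirror n (a n) t))"

lemma finite_modes [simp]: "finite (modes M)"
  by (simp add: modes_def)

lemma finite_pairs [simp]: "finite (pairs M)"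
  by (simp add: pairs_def)

lemma pairs_mono: "M \<le> M' \<Longrightarrow> pairs M \<subseteq> pairs M'"
  by (auto simp: pairs_def modes_def)

lemma out_bound:
  assumes "p \<in> pairs M" shows "out p \<in> modes (2 * M)"
  using assms signs by (auto simp: pairs_def modes_def out_def)

lemma approximate_stateD:
  assumes "approximate_state M a"
  shows "M \<ge> 0" "continuous_on {0..1} (a n)" "a n 0 = 0" "n \<notin> modes M \<Longrightarrow> a n = (\<lambda>_. 0)"
    "e1 \<noteq> e2 \<Longrightarrow> a 0 = (\<lambda>_. 0)"
    "e1 \<noteq> e2 \<Longrightarrow> n > 0 \<Longrightarrow> t \<in> {0..1} \<Longrightarrow> a (- n) t = - mirror n (a n) t"
  using assms by (auto simp: approximate_state_def)

lemma defect_continuous: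
  assumes "\<And>n. continuous_on {0..1} (a n)" shows "continuous_on {0..1} (defect M a n)"
  unfolding defect_def[abs_def] by (intro continuous_intros primitive_continuous assms)

lemma defect_at_0: "a n 0 = 0 \<Longrightarrow> defect M a n 0 = 0"
  by (simp add: defect_def)

lemma primitive_cong:
  assumes "a (fst p) = b (fst p)" "a (snd p) = b (snd p)" shows "primitive a p = primitive b p"
  unfolding primitive_def[abs_def] interaction_def[abs_def] assms ..

lemma primitive_eq_0:
  assumes "a (fst p) = (\<lambda>_. 0) \<or> a (snd p) = (\<lambda>_. 0)" shows "primitive a p = (\<lambda>_. 0)"
proof -
  have "interaction a p t = 0" for t
    using assms unfolding interaction_def by (metis conj_sign_eq_0_iff mult_zero_left mult_zero_right)
  then have "interaction a p = (\<lambda>_. 0)" by (rule ext)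
  then show ?thesis by (simp add: primitive_def[abs_def])
qed

lemma snorm_primitive_le:
  assumes "\<And>n. continuous_on {0..1} (a n)"
    and "\<And>t. t \<in> {0..1} \<Longrightarrow> norm (a (fst p) t) * norm (a (snd p) t) \<le> B"
  shows "snorm (primitive a p) \<le> B"
  unfolding primitive_def[abs_def]
  by (intro snorm_least norm_integral_unit_le interaction_continuous assms)
    (use assms(2) in \<open>auto simp: norm_interaction\<close>)

text \<open>Exchanging the two modes conjugates their product and reverses the frequency at which they interact.\<close>

lemma mirror_primitive:
  assumes a: "\<And>n. continuous_on {0..1} (a n)" and e: "e1 \<noteq> e2" and t: "t \<in> {0..1}" and n: "out (k, l) = n"
  shows "mirror n (primitive a (k, l)) t = primitive a (l, k) t"
proof -
  have "mirror n (primitive a (k, l)) t =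
      integral {0..t} (\<lambda>r. wave (2 * of_int (n\<^sup>2)) r * cnj (interaction a (k, l) r))"
    by (rule mirror_eq_integral[OF t])
      (simp_all add: primitive_has_derivative interaction_continuous a)
  also have "\<dots> = integral {0..t} (interaction a (l, k))"
  proof (rule integral_cong)
    fix r
    have sg: "e1 = 1" "e2 = -1" using signs e by auto
    have "interaction a p r = wave (of_int (phase p)) r * (a (fst p) r * cnj (a (snd p) r))" for p
      unfolding interaction_def wave_def conj_sign_def by (simp add: sg)
    moreover have "wave (2 * of_int (n\<^sup>2)) r * cnj (wave (of_int (phase (k, l))) r) = wave (of_int (phase (l, k))) r"
      unfolding cnj_wave wave_mult phase_def n[symmetric] out_def
      by (rule arg_cong[of _ _ "\<lambda>\<mu>. wave \<mu> r"]) (simp add: sg power2_eq_square algebra_simps)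
    ultimately show "wave (2 * of_int (n\<^sup>2)) r * cnj (interaction a (k, l) r) = interaction a (l, k) r"
      by (simp add: mult_ac)
  qed
  finally show ?thesis by (simp add: primitive_def)
qed

text \<open>Because the mirror relation passes to the defect, cancelling the defect at \<open>n\<close> also cancels it
  at \<open>- n\<close>.\<close>

lemma mirror_defect:
  assumes st: "approximate_state M a" and e: "e1 \<noteq> e2" and t: "t \<in> {0..1}" and n: "n > 0"
  shows "mirror n (defect M a n) t = defect M a (- n) t"
proof -
  note a = approximate_stateD(2)[OF st]
  have "mirror n (defect M a n) t = cnj \<i> * mirror n (a n) t +
      cnj (of_real \<omega>) * mirror n (\<lambda>t. \<Sum>p\<in>{p\<in>pairs M. out p = n}. primitive a p t) t"
    unfolding defect_def[abs_def]
    by (rule mirror_add_cmult[OF a _ t]) (intro continuous_intros primitive_continuous a)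
  also have "mirror n (\<lambda>t. \<Sum>p\<in>{p\<in>pairs M. out p = n}. primitive a p t) t =
      (\<Sum>p\<in>{p\<in>pairs M. out p = n}. mirror n (primitive a p) t)"
    by (rule mirror_sum[OF _ t]) (intro primitive_continuous a)
  also have "\<dots> = (\<Sum>p\<in>{p\<in>pairs M. out p = - n}. primitive a p t)"
  proof (rule sum.reindex_bij_witness[of _ prod.swap prod.swap])
    have sg: "e1 = 1" "e2 = -1" using signs e by auto
    show "prod.swap p \<in> {p\<in>pairs M. out p = - n}" if "p \<in> {p\<in>pairs M. out p = n}" for p
      using that unfolding pairs_def admissible_def out_def by (auto simp: sg)
    show "prod.swap p \<in> {p\<in>pairs M. out p = n}" if "p \<in> {p\<in>pairs M. out p = - n}" for p
      using that unfolding pairs_def admissible_def out_def by (auto simp: sg)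
    show "primitive a (prod.swap p) t = mirror n (primitive a p) t" if "p \<in> {p\<in>pairs M. out p = n}" for p
      using that mirror_primitive[OF a e t, of "fst p" "snd p" n] by (simp add: prod.swap_def)
  qed auto
  also have "mirror n (a n) t = - a (- n) t"
    using approximate_stateD(6)[OF st e n t] by simp
  finally show ?thesis by (simp add: defect_def[abs_def])
qed

text \<open>The bookkeeping of one correction step, in which modes \<open>b\<close> with frequencies in \<open>R\<close> are added.  The
  interactions in \<open>main\<close> cancel the defect at the frequencies in \<open>Tg\<close>, and all other new interactions
  are small.  By \<open>main_size\<close> the interactions in \<open>main\<close> are no larger than the defect removed, up to the factor
  \<open>\<bar>\<omega>\<bar>\<close> and a small error, hence the difference of the total defects in the second conclusion.\<close>

lemma add_block:
  assumes st: "approximate_state M a"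
    and R: "finite R" "R \<inter> modes M = {}" "R \<subseteq> modes M'" and M': "M < M'"
    and b: "\<And>n. continuous_on {0..1} (b n)" "\<And>n. b n 0 = 0" "\<And>n. n \<notin> R \<Longrightarrow> b n = (\<lambda>_. 0)"
    and sym: "\<And>n t. e1 \<noteq> e2 \<Longrightarrow> n > 0 \<Longrightarrow> t \<in> {0..1} \<Longrightarrow> b (- n) t = - mirror n (b n) t"
    and main: "main \<subseteq> (R \<times> R) \<inter> admissible" "out ` main \<subseteq> Tg" and Tg: "finite Tg" "card Tg \<le> 2" "Tg \<subseteq> modes (2 * M')"
    and \<eta>: "\<eta> \<ge> 0"
  defines "a' \<equiv> (\<lambda>n t. a n t + b n t)"
    and "new \<equiv> ((modes M \<union> R) \<times> (modes M \<union> R)) \<inter> admissible - pairs M - main"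
  assumes small_new: "(\<Sum>p\<in>new. pair_size a' p) \<le> \<eta>"
    and small_modes: "(\<Sum>n\<in>R. weight s n * snorm (b n)) \<le> \<eta>"
    and cancel: "\<And>n. n \<in> Tg \<Longrightarrow>
      snorm (\<lambda>t. defect M a n t + of_real \<omega> * (\<Sum>p\<in>{p\<in>main. out p = n}. primitive b p t)) \<le> \<eta>"
    and main_size: "(\<Sum>p\<in>main. pair_size b p)
      \<le> (\<Sum>n\<in>Tg. weight s n * (snorm (defect M a n) + \<eta>)) / \<bar>\<omega>\<bar>"
  shows "approximate_state M' a'"
    and "(\<Sum>p\<in>pairs M' - pairs M. pair_size a' p)
      \<le> (total_defect M a - total_defect M' a') / \<bar>\<omega>\<bar> + (2 + 5 / \<bar>\<omega>\<bar>) * \<eta>"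
    and "(\<Sum>n\<in>modes M' - modes M. weight s n * snorm (a' n)) \<le> \<eta>"
    and "\<And>n. n \<in> Tg \<Longrightarrow> snorm (defect M' a' n) \<le> \<eta> + (1 + \<bar>\<omega>\<bar>) * \<eta> / weight s n"
proof -
  note a = approximate_stateD[OF st]
  have M'0: "M' \<ge> 0" using a(1) M' by simp
  have modes_sub: "modes M \<subseteq> modes M'" using M' by (auto simp: modes_def)
  have a'_old: "a' n = a n" if "n \<notin> R" for n using b(3)[OF that] by (simp add: a'_def)
  have a'_new: "a' n = b n" if "n \<notin> modes M" for n using a(4)[OF that] by (simp add: a'_def)
  have R_new: "n \<notin> modes M" if "n \<in> R" for n using R that by auto
  have a'_cont: "continuous_on {0..1} (a' n)" for n
    unfolding a'_def by (intro continuous_intros a b)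
  note pc' = primitive_continuous[of a', OF a'_cont] and pcb = primitive_continuous[of b, OF b(1)]
  show st': "approximate_state M' a'"
    unfolding approximate_state_def
  proof (intro conjI allI impI ballI)
    show "a' n = (\<lambda>_. 0)" if "n \<notin> modes M'" for n
    proof -
      have "n \<notin> modes M" "n \<notin> R" using that modes_sub R by auto
      then show ?thesis using a(4) b(3) by (simp add: a'_def)
    qed
    show "a' 0 = (\<lambda>_. 0)" if "e1 \<noteq> e2"
    proof -
      have "0 \<in> modes M" using a(1) by (simp add: modes_def)
      then have "0 \<notin> R" using R by auto
      then show ?thesis using a(5)[OF that] a'_old by simp
    qed
    show "a' (- n) t = - mirror n (a' n) t" if e: "e1 \<noteq> e2" and n: "n > 0" and t: "t \<in> {0..1}" for n t
    proof (cases "n \<in> modes M")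
      case True
      then have "- n \<in> modes M" by (auto simp: modes_def)
      then show ?thesis using True R a'_old a(6)[OF e n t] by (metis disjoint_iff)
    next
      case False
      then have "- n \<notin> modes M" by (auto simp: modes_def)
      then show ?thesis using False a'_new sym[OF e n t] by simp
    qed
  qed (simp_all add: M'0 a'_cont, simp add: a'_def a b)
  have prim_old: "primitive a' p = primitive a p" if "p \<in> pairs M" for p
  proof -
    have "fst p \<notin> R" "snd p \<notin> R" using that R by (auto simp: pairs_def)
    then show ?thesis by (intro primitive_cong a'_old)
  qed
  have prim_main: "primitive a' p = primitive b p" if "p \<in> main" for p
  proof -
    have "fst p \<in> R" "snd p \<in> R" using that main by auto
    then show ?thesis by (intro primitive_cong a'_new R_new)
  qed
  have main_new: "main \<inter> pairs M = {}" using main R by (auto simp: pairs_def)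
  \<comment> \<open>Pairs with a mode that is zero, present because \<open>M'\<close> may exceed the frequencies in \<open>R\<close>.\<close>
  define rest where "rest = pairs M' - pairs M - main - new"
  have prim_rest: "primitive a' p = (\<lambda>_. 0)" if "p \<in> rest" for p
  proof -
    have "fst p \<notin> modes M \<union> R \<or> snd p \<notin> modes M \<union> R"
      using that by (auto simp: rest_def new_def pairs_def)
    then show ?thesis
      by (intro primitive_eq_0) (metis UnCI a'_new b(3))
  qed
  have sub: "main \<subseteq> pairs M'" "new \<subseteq> pairs M'"
    using main R modes_sub by (auto simp: pairs_def new_def)
  have fin: "finite main" "finite new" "finite rest"
    using finite_subset[OF sub(1)] finite_subset[OF sub(2)] by (auto simp: rest_def)
  have disj: "main \<inter> new = {}" "pairs M \<inter> new = {}" by (auto simp: new_def)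
  have split: "sum f (pairs M') = sum f (pairs M) + sum f main + sum f new"
    if "\<And>p. p \<in> rest \<Longrightarrow> f p = 0" for f :: "int \<times> int \<Rightarrow> 'c::comm_monoid_add"
  proof -
    have "pairs M' = pairs M \<union> main \<union> new \<union> rest"
      using sub pairs_mono[of M M'] M' by (auto simp: rest_def)
    moreover have "sum f (pairs M \<union> main \<union> new \<union> rest) = sum f (pairs M \<union> main \<union> new) + sum f rest"
      by (rule sum.union_disjoint) (use fin in \<open>auto simp: rest_def\<close>)
    moreover have "sum f (pairs M \<union> main \<union> new) = sum f (pairs M \<union> main) + sum f new"
      by (rule sum.union_disjoint) (use fin disj in auto)
    moreover have "sum f (pairs M \<union> main) = sum f (pairs M) + sum f main"
      by (rule sum.union_disjoint) (use fin main_new in auto)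
    moreover have "sum f rest = 0" using that by (simp add: sum.neutral)
    ultimately show ?thesis by simp
  qed
  \<comment> \<open>The contribution of the new modes and of the nonresonant interactions to the defect.\<close>
  define rem where "rem n t = \<i> * b n t + of_real \<omega> * (\<Sum>p\<in>{p\<in>new. out p = n}. primitive a' p t)" for n t
  define mainsum where "mainsum n t = (\<Sum>p\<in>{p\<in>main. out p = n}. primitive b p t)" for n t
  have defect': "defect M' a' n t = defect M a n t + of_real \<omega> * mainsum n t + rem n t" for n t
  proof -
    define f where "f p = (if out p = n then primitive a' p t else 0)" for p
    have sel: "(\<Sum>p\<in>{p\<in>P. out p = n}. primitive a' p t) = sum f P" if "finite P" for P
      using that unfolding f_def by (rule sum.inter_filter)
    have "sum f (pairs M') = sum f (pairs M) + sum f main + sum f new"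
      by (rule split) (simp add: f_def prim_rest)
    then have "(\<Sum>p\<in>{p\<in>pairs M'. out p = n}. primitive a' p t) =
        (\<Sum>p\<in>{p\<in>pairs M. out p = n}. primitive a' p t) +
        (\<Sum>p\<in>{p\<in>main. out p = n}. primitive a' p t) + (\<Sum>p\<in>{p\<in>new. out p = n}. primitive a' p t)"
      using fin by (simp only: sel finite_pairs)
    also have "(\<Sum>p\<in>{p\<in>pairs M. out p = n}. primitive a' p t) = (\<Sum>p\<in>{p\<in>pairs M. out p = n}. primitive a p t)"
      by (intro sum.cong refl) (simp add: prim_old)
    also have "(\<Sum>p\<in>{p\<in>main. out p = n}. primitive a' p t) = mainsum n t"
      unfolding mainsum_def by (intro sum.cong refl) (simp add: prim_main)
    finally have "(\<Sum>p\<in>{p\<in>pairs M'. out p = n}. primitive a' p t) =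
        (\<Sum>p\<in>{p\<in>pairs M. out p = n}. primitive a p t) + mainsum n t
          + (\<Sum>p\<in>{p\<in>new. out p = n}. primitive a' p t)" .
    then show ?thesis unfolding defect_def rem_def a'_def by (simp add: algebra_simps)
  qed
  have rem_cont: "continuous_on {0..1} (rem n)" for n
    unfolding rem_def[abs_def] by (intro continuous_intros b pc')
  have mainsum_cont: "continuous_on {0..1} (mainsum n)" for n
    unfolding mainsum_def[abs_def] by (intro continuous_intros pcb)
  have rem_le: "snorm (rem n) \<le> snorm (b n) + \<bar>\<omega>\<bar> * (\<Sum>p\<in>{p\<in>new. out p = n}. snorm (primitive a' p))" for n
  proof -
    have "snorm (rem n) \<le> snorm (\<lambda>t. \<i> * b n t) + snorm (\<lambda>t. of_real \<omega> * (\<Sum>p\<in>{p\<in>new. out p = n}. primitive a' p t))"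
      unfolding rem_def[abs_def] by (intro snorm_add_le continuous_intros b pc')
    also have "snorm (\<lambda>t. \<i> * b n t) = snorm (b n)"
      by (rule snorm_cong) (simp add: norm_mult)
    also have "snorm (\<lambda>t. of_real \<omega> * (\<Sum>p\<in>{p\<in>new. out p = n}. primitive a' p t))
        \<le> norm (of_real \<omega> :: complex) * snorm (\<lambda>t. \<Sum>p\<in>{p\<in>new. out p = n}. primitive a' p t)"
      by (intro snorm_cmult_le continuous_intros pc')
    also have "\<dots> \<le> \<bar>\<omega>\<bar> * (\<Sum>p\<in>{p\<in>new. out p = n}. snorm (primitive a' p))"
      unfolding norm_of_real by (intro mult_left_mono snorm_sum_le pc') simp
    finally show ?thesis by simp
  qed
  have rem0: "0 \<le> weight s n * snorm (rem n)" for n by (simp add: snorm_nonneg rem_cont)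
  have rem_total: "(\<Sum>n\<in>modes (2 * M'). weight s n * snorm (rem n)) \<le> (1 + \<bar>\<omega>\<bar>) * \<eta>"
  proof -
    have "(\<Sum>n\<in>modes (2 * M'). weight s n * snorm (rem n)) \<le>
        (\<Sum>n\<in>modes (2 * M'). weight s n * snorm (b n) +
          \<bar>\<omega>\<bar> * (\<Sum>p\<in>{p\<in>new. out p = n}. pair_size a' p))"
    proof (rule sum_mono)
      fix n
      have "weight s n * snorm (rem n) \<le>
          weight s n * (snorm (b n) + \<bar>\<omega>\<bar> * (\<Sum>p\<in>{p\<in>new. out p = n}. snorm (primitive a' p)))"
        by (intro mult_left_mono rem_le weight_nonneg)
      also have "\<dots> = weight s n * snorm (b n) +
          \<bar>\<omega>\<bar> * (\<Sum>p\<in>{p\<in>new. out p = n}. weight s n * snorm (primitive a' p))"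
        by (simp add: distrib_left mult.left_commute flip: sum_distrib_left)
      finally show "weight s n * snorm (rem n) \<le> weight s n * snorm (b n) +
          \<bar>\<omega>\<bar> * (\<Sum>p\<in>{p\<in>new. out p = n}. pair_size a' p)"
        by simp
    qed
    also have "\<dots> = (\<Sum>n\<in>modes (2 * M'). weight s n * snorm (b n)) +
        \<bar>\<omega>\<bar> * (\<Sum>n\<in>modes (2 * M'). \<Sum>p\<in>{p\<in>new. out p = n}. pair_size a' p)"
      by (simp add: sum.distrib sum_distrib_left)
    also have "(\<Sum>n\<in>modes (2 * M'). \<Sum>p\<in>{p\<in>new. out p = n}. pair_size a' p) =
        (\<Sum>p\<in>new. pair_size a' p)"
      by (rule sum.group) (use fin sub out_bound in auto)
    also have "(\<Sum>n\<in>modes (2 * M'). weight s n * snorm (b n)) = (\<Sum>n\<in>R. weight s n * snorm (b n))"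
    proof (rule sum.mono_neutral_right)
      show "R \<subseteq> modes (2 * M')" using R M'0 by (auto simp: modes_def)
      show "\<forall>n\<in>modes (2 * M') - R. weight s n * snorm (b n) = 0"
        using b(3) by (auto intro: snorm_zero)
    qed simp
    finally have "(\<Sum>n\<in>modes (2 * M'). weight s n * snorm (rem n)) \<le>
        (\<Sum>n\<in>R. weight s n * snorm (b n)) + \<bar>\<omega>\<bar> * (\<Sum>p\<in>new. pair_size a' p)" .
    also have "\<dots> \<le> \<eta> + \<bar>\<omega>\<bar> * \<eta>"
      by (intro add_mono small_modes mult_left_mono small_new) simp
    finally show ?thesis by (simp add: algebra_simps)
  qed
  define d where "d n = snorm (defect M a n)" for n
  have target: "snorm (defect M' a' n) \<le> \<eta> + snorm (rem n)" if "n \<in> Tg" for n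
  proof -
    have "snorm (defect M' a' n) \<le> snorm (\<lambda>t. defect M a n t + of_real \<omega> * mainsum n t) + snorm (rem n)"
      unfolding defect'[abs_def]
      by (intro snorm_add_le continuous_intros defect_continuous a mainsum_cont rem_cont)
    then show ?thesis using cancel[OF that] by (simp add: mainsum_def)
  qed
  have other: "snorm (defect M' a' n) \<le> d n + snorm (rem n)" if "n \<notin> Tg" for n
  proof -
    have "{p\<in>main. out p = n} = {}" using that main by auto
    then have "mainsum n t = 0" for t unfolding mainsum_def by (simp only: sum.empty)
    then show ?thesis
      unfolding defect'[abs_def] d_def by (simp add: snorm_add_le defect_continuous a rem_cont)
  qed
  have old_total: "(\<Sum>n\<in>modes (2 * M'). weight s n * d n) = total_defect M a"
    unfolding total_defect_def d_def
  proof (rule sum.mono_neutral_right)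
    show "\<forall>n\<in>modes (2 * M') - modes (2 * M). weight s n * snorm (defect M a n) = 0"
    proof
      fix n assume n: "n \<in> modes (2 * M') - modes (2 * M)"
      then have "n \<notin> modes M" using a(1) by (auto simp: modes_def)
      from a(4)[OF this] have "a n t = 0" for t by simp
      moreover have "{p\<in>pairs M. out p = n} = {}" using n out_bound by auto
      ultimately have "defect M a n t = 0" for t
        unfolding defect_def by (simp only: sum.empty) simp
      then show "weight s n * snorm (defect M a n) = 0" by (simp add: snorm_zero)
    qed
  qed (use M' a(1) in \<open>auto simp: modes_def\<close>)
  have Tg_w: "(\<Sum>n\<in>Tg. weight s n * \<eta>) \<le> 2 * \<eta>"
  proof -
    have "(\<Sum>n\<in>Tg. weight s n * \<eta>) \<le> of_nat (card Tg) * \<eta>"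
      by (rule sum_bounded_above) (use weight_le_one[OF s_neg] \<eta> in \<open>simp add: mult_left_le_one_le\<close>)
    also have "\<dots> \<le> 2 * \<eta>" by (rule mult_right_mono[OF _ \<eta>]) (use Tg(2) in simp)
    finally show ?thesis .
  qed
  have total': "total_defect M' a' \<le> total_defect M a - (\<Sum>n\<in>Tg. weight s n * d n) + (3 + \<bar>\<omega>\<bar>) * \<eta>"
  proof -
    have "total_defect M' a' \<le> (\<Sum>n\<in>modes (2 * M'). (weight s n * d n - (if n \<in> Tg then weight s n * d n else 0))
        + (if n \<in> Tg then weight s n * \<eta> else 0) + weight s n * snorm (rem n))"
      unfolding total_defect_def
    proof (rule sum_mono)
      fix n
      show "weight s n * snorm (defect M' a' n) \<le> (weight s n * d n - (if n \<in> Tg then weight s n * d n else 0))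
        + (if n \<in> Tg then weight s n * \<eta> else 0) + weight s n * snorm (rem n)"
        using mult_left_mono[OF target weight_nonneg[of s n]] mult_left_mono[OF other weight_nonneg[of s n]]
        by (cases "n \<in> Tg") (simp_all add: distrib_left)
    qed
    also have "\<dots> = (total_defect M a - (\<Sum>n\<in>Tg. weight s n * d n)) + (\<Sum>n\<in>Tg. weight s n * \<eta>)
        + (\<Sum>n\<in>modes (2 * M'). weight s n * snorm (rem n))"
    proof -
      have "(\<Sum>n\<in>modes (2 * M'). if n \<in> Tg then h n else 0) = sum h Tg" for h :: "int \<Rightarrow> real"
        using Tg by (simp add: sum.inter_restrict[symmetric] Int_absorb1)
      then show ?thesis by (simp add: sum.distrib sum_subtractf old_total)
    qed
    also have "\<dots> \<le> (total_defect M a - (\<Sum>n\<in>Tg. weight s n * d n)) + 2 * \<eta> + (1 + \<bar>\<omega>\<bar>) * \<eta>"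
      by (intro add_mono order_refl Tg_w rem_total)
    finally show ?thesis by (simp add: algebra_simps)
  qed
  have "(\<Sum>p\<in>pairs M' - pairs M. pair_size a' p) =
      (\<Sum>p\<in>main. pair_size b p) +
      (\<Sum>p\<in>new. pair_size a' p)"
  proof -
    have "(\<Sum>p\<in>pairs M' - pairs M. pair_size a' p) =
        (\<Sum>p\<in>pairs M'. pair_size a' p) -
        (\<Sum>p\<in>pairs M. pair_size a' p)"
      by (rule sum_diff) (use pairs_mono[of M M'] M' in auto)
    also have "\<dots> = (\<Sum>p\<in>main. pair_size a' p) +
        (\<Sum>p\<in>new. pair_size a' p)"
      by (subst split) (auto simp: prim_rest snorm_zero)
    also have "(\<Sum>p\<in>main. pair_size a' p) =
        (\<Sum>p\<in>main. pair_size b p)"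
      by (intro sum.cong refl) (simp add: prim_main)
    finally show ?thesis .
  qed
  also have "\<dots> \<le> (\<Sum>n\<in>Tg. weight s n * (d n + \<eta>)) / \<bar>\<omega>\<bar> + \<eta>"
    unfolding d_def by (intro add_mono main_size small_new)
  also have "\<dots> \<le> (total_defect M a - total_defect M' a' + (5 + \<bar>\<omega>\<bar>) * \<eta>) / \<bar>\<omega>\<bar> + \<eta>"
  proof (intro add_right_mono divide_right_mono)
    have "(\<Sum>n\<in>Tg. weight s n * (d n + \<eta>)) = (\<Sum>n\<in>Tg. weight s n * d n) + (\<Sum>n\<in>Tg. weight s n * \<eta>)"
      by (simp add: distrib_left sum.distrib)
    then show "(\<Sum>n\<in>Tg. weight s n * (d n + \<eta>)) \<le> total_defect M a - total_defect M' a' + (5 + \<bar>\<omega>\<bar>) * \<eta>"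
      using total' Tg_w by (simp add: algebra_simps)
  qed simp
  also have "\<dots> = (total_defect M a - total_defect M' a') / \<bar>\<omega>\<bar> + (2 + 5 / \<bar>\<omega>\<bar>) * \<eta>"
  proof -
    have "(x + (5 + w) * \<eta>) / w + \<eta> = x / w + (2 + 5 / w) * \<eta>" if "w \<noteq> 0" for x w
      using that by (simp add: field_simps)
    then show ?thesis using \<omega>_nz by simp
  qed
  finally show "(\<Sum>p\<in>pairs M' - pairs M. pair_size a' p)
      \<le> (total_defect M a - total_defect M' a') / \<bar>\<omega>\<bar> + (2 + 5 / \<bar>\<omega>\<bar>) * \<eta>" .
  show "(\<Sum>n\<in>modes M' - modes M. weight s n * snorm (a' n)) \<le> \<eta>"
  proof -
    have "(\<Sum>n\<in>modes M' - modes M. weight s n * snorm (a' n)) = (\<Sum>n\<in>R. weight s n * snorm (a' n))"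
    proof (rule sum.mono_neutral_right)
      show "\<forall>n\<in>modes M' - modes M - R. weight s n * snorm (a' n) = 0"
        using b(3) a'_new by (auto intro: snorm_zero)
    qed (use R in auto)
    also have "\<dots> = (\<Sum>n\<in>R. weight s n * snorm (b n))"
      by (intro sum.cong refl) (simp add: a'_new R_new)
    finally show ?thesis using small_modes by simp
  qed
  show "snorm (defect M' a' n) \<le> \<eta> + (1 + \<bar>\<omega>\<bar>) * \<eta> / weight s n" if n: "n \<in> Tg" for n
  proof -
    have "weight s n * snorm (rem n) \<le> (\<Sum>n\<in>modes (2 * M'). weight s n * snorm (rem n))"
      by (rule member_le_sum) (use n Tg rem0 in auto)
    also note rem_total
    finally have "snorm (rem n) \<le> (1 + \<bar>\<omega>\<bar>) * \<eta> / weight s n"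
      using weight_pos[of s n] by (simp add: field_simps)
    then show ?thesis using target[OF n] by simp
  qed
qed

end

section \<open>Cancelling the defect in one mode\<close>

text \<open>The mirror image of a slow or moderately oscillating mode of high frequency is small, because
  the phase \<open>2 l\<^sup>2\<close> of the mirror map is not compensated.\<close>

lemma mirror_oscillating_le:
  assumes \<gamma>: "twice_smooth \<gamma> \<gamma>' \<gamma>''" "\<gamma> 0 = 0"
    and B: "\<And>t. t \<in> {0..1} \<Longrightarrow> norm (\<gamma> t) \<le> B" "\<And>t. t \<in> {0..1} \<Longrightarrow> norm (\<gamma>' t) \<le> B"
      "\<And>t. t \<in> {0..1} \<Longrightarrow> norm (\<gamma>'' t) \<le> B"
    and \<mu>: "2 * of_int (l\<^sup>2) + \<nu> \<noteq> 0" and t: "t \<in> {0..1}"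
  shows "norm (mirror l (\<lambda>t. cnj (\<gamma> t * wave \<nu> t)) t)
    \<le> 3 * (B + \<bar>\<nu>\<bar> * B) / \<bar>2 * of_int (l\<^sup>2) + \<nu>\<bar>"
proof -
  define f where "f t = \<gamma>' t + \<i> * of_real \<nu> * \<gamma> t" for t
  note d\<gamma> = twice_smoothD[OF \<gamma>(1)]
  have deriv: "((\<lambda>t. cnj (\<gamma> t * wave \<nu> t)) has_vector_derivative cnj (f r * wave \<nu> r)) (at r within {0..1})" for r
  proof -
    have "((\<lambda>t. \<gamma> t * wave \<nu> t) has_vector_derivative
        \<gamma> r * (\<i> * of_real \<nu> * wave \<nu> r) + \<gamma>' r * wave \<nu> r) (at r within {0..1})"
      by (intro has_vector_derivative_mult d\<gamma> wave_has_derivative)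
    then have "((\<lambda>t. \<gamma> t * wave \<nu> t) has_vector_derivative f r * wave \<nu> r) (at r within {0..1})"
      by (simp add: f_def algebra_simps)
    then show ?thesis by (rule has_vector_derivative_cnj)
  qed
  have "mirror l (\<lambda>t. cnj (\<gamma> t * wave \<nu> t)) t =
      integral {0..t} (\<lambda>r. wave (2 * of_int (l\<^sup>2)) r * cnj (cnj (f r * wave \<nu> r)))"
    by (rule mirror_eq_integral[OF t _ deriv])
      (auto simp: \<gamma> f_def intro!: continuous_intros d\<gamma>)
  also have "\<dots> = integral {0..t} (\<lambda>r. wave (2 * of_int (l\<^sup>2) + \<nu>) r * f r)"
    by (simp add: mult_ac flip: wave_mult)
  also have "norm \<dots> \<le> 3 * (B + \<bar>\<nu>\<bar> * B) / \<bar>2 * of_int (l\<^sup>2) + \<nu>\<bar>"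
  proof (rule oscillatory_integral_le[OF t \<mu>])
    show "(f has_vector_derivative \<gamma>'' r + \<i> * of_real \<nu> * \<gamma>' r) (at r within {0..1})" for r
      unfolding f_def[abs_def]
      by (intro has_vector_derivative_add has_vector_derivative_mult_right d\<gamma>)
    have tri: "norm (z + \<i> * of_real \<nu> * w) \<le> B + \<bar>\<nu>\<bar> * B" if "norm z \<le> B" "norm w \<le> B" for z w
      by (rule order_trans[OF norm_triangle_ineq])
        (use that in \<open>auto simp: norm_mult intro!: add_mono mult_left_mono\<close>)
    show "norm (f r) \<le> B + \<bar>\<nu>\<bar> * B" "norm (\<gamma>'' r + \<i> * of_real \<nu> * \<gamma>' r) \<le> B + \<bar>\<nu>\<bar> * B"
      if "r \<in> {0..1}" for r
      using B[OF that] unfolding f_def by (auto intro!: tri)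
  qed (intro continuous_intros d\<gamma>)
  finally show ?thesis .
qed

text \<open>The mirror map of the mode \<open>l\<close> has phase \<open>2 l\<^sup>2\<close> and the mode itself has phase \<open>2 n l\<close>.  They add up to
  \<open>2 l (l + n)\<close>, which is larger by the factor \<open>(l + n) / n\<close> than the rate \<open>2 n l\<close> at which the mode varies.\<close>

lemma mirror_mode_le:
  assumes \<gamma>: "twice_smooth \<gamma> \<gamma>' \<gamma>''" "\<gamma> 0 = 0"
    and B: "\<And>t. t \<in> {0..1} \<Longrightarrow> norm (\<gamma> t) \<le> B" "\<And>t. t \<in> {0..1} \<Longrightarrow> norm (\<gamma>' t) \<le> B"
      "\<And>t. t \<in> {0..1} \<Longrightarrow> norm (\<gamma>'' t) \<le> B"
    and l: "l \<ge> 1" and n: "n \<ge> 0" and t: "t \<in> {0..1}"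
  shows "norm (mirror l (\<lambda>t. cnj (\<gamma> t * wave (of_int (2 * n * l)) t)) t)
    \<le> 3 * B * (1 + 2 * of_int n) / of_int (l + n)"
proof -
  define x y where "x = real_of_int l" and "y = real_of_int n"
  have xy: "x \<ge> 1" "y \<ge> 0" using l n by (simp_all add: x_def y_def)
  have B0: "0 \<le> B" by (rule order_trans[OF norm_ge_zero B(1)[OF t]])
  have \<mu>: "2 * of_int (l\<^sup>2) + of_int (2 * n * l) = 2 * x * (x + y)"
    by (simp add: x_def y_def power2_eq_square algebra_simps)
  have pos: "2 * x * (x + y) > 0" using xy by simp
  have num: "1 + 2 * y * x \<le> (1 + 2 * y) * (2 * x)"
  proof -
    have "(1 + 2 * y) * (2 * x) - (1 + 2 * y * x) = (2 * x - 1) + 2 * (x * y)"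
      by (simp add: algebra_simps)
    moreover have "0 \<le> x * y" using xy by simp
    ultimately show ?thesis using xy by linarith
  qed
  have \<mu>0: "2 * of_int (l\<^sup>2) + of_int (2 * n * l) \<noteq> (0 :: real)"
    unfolding \<mu> using pos by (rule less_imp_neq[symmetric])
  have "norm (mirror l (\<lambda>t. cnj (\<gamma> t * wave (of_int (2 * n * l)) t)) t)
      \<le> 3 * (B + \<bar>of_int (2 * n * l)\<bar> * B) / \<bar>2 * of_int (l\<^sup>2) + of_int (2 * n * l)\<bar>"
    by (rule mirror_oscillating_le[OF \<gamma> B \<mu>0 t])
  also have "\<dots> = 3 * B * ((1 + 2 * y * x) / (2 * x * (x + y)))"
    unfolding \<mu> using pos xy by (simp add: x_def y_def abs_mult algebra_simps)
  also have "(1 + 2 * y * x) / (2 * x * (x + y)) \<le> (1 + 2 * y) * (2 * x) / (2 * x * (x + y))"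
    by (rule divide_right_mono[OF num less_imp_le[OF pos]])
  also have "\<dots> = (1 + 2 * y) / (x + y)" using xy by simp
  finally show ?thesis using B0 by (simp add: mult_left_mono x_def y_def)
qed

text \<open>By the triangle inequality, a resonant interaction is at most about as large as the defect that it cancels.\<close>

lemma snorm_of_cancelling_le:
  assumes small: "snorm (\<lambda>t. g t + c * f t) \<le> \<eta>"
    and f: "continuous_on {0..1} f" and g: "continuous_on {0..1} g"
  shows "norm c * snorm f \<le> snorm g + \<eta>"
proof (cases "c = 0")
  case True
  then show ?thesis using small snorm_nonneg[OF g] by simp
next
  case False
  have "snorm f \<le> (snorm g + \<eta>) / norm c"
  proof (rule snorm_least)
    fix t :: real assume t: "t \<in> {0..1}"
    have "continuous_on {0..1} (\<lambda>t. g t + c * f t)" by (intro continuous_intros f g)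
    from snorm_upper[OF this t] have "norm (g t + c * f t) \<le> \<eta>" using small by simp
    moreover have "norm (c * f t) \<le> norm (g t + c * f t) + norm (g t)"
      using norm_triangle_ineq4[of "g t + c * f t" "g t"] by simp
    ultimately have "norm c * norm (f t) \<le> snorm g + \<eta>"
      using snorm_upper[OF g t] by (simp add: norm_mult)
    then show "norm (f t) \<le> (snorm g + \<eta>) / norm c"
      using False by (simp add: field_simps)
  qed
  then show ?thesis using False by (simp add: field_simps)
qed

context quadratic_equation
begin

text \<open>An interaction is negligible if it takes place at a high frequency, where the weight is small, or if
  one of the two modes is small.\<close>

lemma high_pairs_sum_le:
  assumes a: "\<And>n. continuous_on {0..1} (a n)" and P: "card P \<le> N" and L: "L > 0"
    and D: "\<And>n t. t \<in> {0..1} \<Longrightarrow> norm (a n t) \<le> D"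
    and high: "\<And>p. p \<in> P \<Longrightarrow> L \<le> \<bar>of_int (out p)\<bar> \<or>
      (\<forall>t\<in>{0..1}. norm (a (fst p) t) * norm (a (snd p) t) \<le> D * D / L)"
  shows "(\<Sum>p\<in>P. pair_size a p) \<le> of_nat N * (D * D * (L powr s + 1 / L))"
proof -
  have D0: "D \<ge> 0" by (rule order_trans[OF norm_ge_zero D[of 0 0]]) simp
  have sn0: "0 \<le> snorm (primitive a p)" for p by (intro snorm_nonneg primitive_continuous a)
  have one: "pair_size a p \<le> D * D * (L powr s + 1 / L)" if p: "p \<in> P" for p
    using high[OF p]
  proof
    assume "L \<le> \<bar>of_int (out p)\<bar>"
    then have "weight s (out p) \<le> L powr s" by (intro weight_le_powr s_neg L)
    moreover have "snorm (primitive a p) \<le> D * D"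
      by (intro snorm_primitive_le a mult_mono D D0 norm_ge_zero)
    ultimately have "pair_size a p \<le> L powr s * (D * D)"
      by (intro mult_mono sn0) auto
    also have "\<dots> \<le> D * D * (L powr s + 1 / L)" using D0 L by (simp add: distrib_left)
    finally show ?thesis .
  next
    assume "\<forall>t\<in>{0..1}. norm (a (fst p) t) * norm (a (snd p) t) \<le> D * D / L"
    then have "snorm (primitive a p) \<le> D * D / L" by (intro snorm_primitive_le a) auto
    then have "pair_size a p \<le> 1 * (D * D / L)"
      by (intro mult_mono weight_le_one s_neg sn0) auto
    also have "\<dots> \<le> D * D * (L powr s + 1 / L)" using D0 by (simp add: distrib_left)
    finally show ?thesis .
  qed
  have "(\<Sum>p\<in>P. pair_size a p) \<le> of_nat (card P) * (D * D * (L powr s + 1 / L))"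
    by (rule sum_bounded_above) (rule one)
  also have "\<dots> \<le> of_nat N * (D * D * (L powr s + 1 / L))"
    by (rule mult_right_mono) (use P D0 L in auto)
  finally show ?thesis .
qed

lemma exists_large_scale:
  assumes "\<eta> > 0"
  obtains L :: real where "L \<ge> 1" "C * (L powr s + 1 / L) \<le> \<eta>" "C' * L powr s \<le> \<eta>"
proof -
  have p: "((\<lambda>L::real. L powr s) \<longlongrightarrow> 0) at_top"
    by (rule tendsto_neg_powr[OF s_neg filterlim_ident])
  have i: "((\<lambda>L::real. 1 / L) \<longlongrightarrow> 0) at_top"
    using tendsto_inverse_0_at_top[OF filterlim_ident] by (simp add: inverse_eq_divide)
  have "((\<lambda>L. C * (L powr s + 1 / L)) \<longlongrightarrow> C * (0 + 0)) at_top"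
    by (intro tendsto_intros p i)
  then have 1: "\<forall>\<^sub>F L in at_top. C * (L powr s + 1 / L) < \<eta>"
    using assms by (intro order_tendstoD) auto
  have "((\<lambda>L. C' * L powr s) \<longlongrightarrow> C' * 0) at_top"
    by (intro tendsto_intros p)
  then have 2: "\<forall>\<^sub>F L in at_top. C' * L powr s < \<eta>"
    using assms by (intro order_tendstoD) auto
  have "\<forall>\<^sub>F L in at_top. L \<ge> 1 \<and> C * (L powr s + 1 / L) \<le> \<eta> \<and> C' * L powr s \<le> \<eta>"
    using 1 2 eventually_ge_at_top[of 1] by eventually_elim auto
  then show ?thesis using that eventually_happens'[OF trivial_limit_at_top_linorder] by blast
qed

text \<open>The modes \<open>k\<close> and \<open>l\<close> carry \<open>\<beta>\<close> and \<open>\<gamma>\<close>, the latter with the phase opposite to that of their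
  interaction, so that the interactions at frequency \<open>n\<close> add up to \<open>\<beta> \<gamma>\<close>, whatever \<open>k\<close> is.  The primitive of \<open>\<beta> \<gamma>\<close>
  is close to the defect divided by \<open>- \<omega>\<close>.  All bounds on the amplitudes are fixed before \<open>k\<close>, and
  everything else tends to \<open>0\<close> as \<open>k\<close> grows.\<close>

lemma cancel_defect:
  assumes st: "approximate_state M a" and n: "e1 \<noteq> e2 \<Longrightarrow> n > 0" and \<eta>: "\<eta> > 0"
  shows "\<exists>M' a'. M < M' \<and> approximate_state M' a' \<and> (\<forall>x\<in>modes M. a' x = a x) \<and>
    (\<Sum>p\<in>pairs M' - pairs M. pair_size a' p)
      \<le> (total_defect M a - total_defect M' a') / \<bar>\<omega>\<bar> + (2 + 5 / \<bar>\<omega>\<bar>) * \<eta> \<and>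
    (\<Sum>x\<in>modes M' - modes M. weight s x * snorm (a' x)) \<le> \<eta> \<and>
    snorm (defect M' a' n) \<le> \<eta> + (1 + \<bar>\<omega>\<bar>) * \<eta> / weight s n \<and>
    (e1 \<noteq> e2 \<longrightarrow> snorm (defect M' a' (- n)) \<le> \<eta> + (1 + \<bar>\<omega>\<bar>) * \<eta> / weight s n)"
proof -
  note a = approximate_stateD[OF st]
  have a_cont: "continuous_on {0..1} (a x)" for x by (rule a(2))
  define d where "d = defect M a n"
  have d_cont: "continuous_on {0..1} d" unfolding d_def by (rule defect_continuous[OF a_cont])
  define Y where "Y t = - d t / of_real \<omega>" for t
  have Y: "continuous_on {0..1} Y" "Y 0 = 0"
    unfolding Y_def[abs_def] using \<omega>_nz
    by (auto intro!: continuous_intros d_cont) (simp add: d_def defect_at_0 a(3))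
  \<comment> \<open>The factor \<open>1 + 2 n\<^sup>2\<close> bounds the norm of the mirror map, which transfers the error from \<open>n\<close> to \<open>- n\<close>.\<close>
  define \<delta> where "\<delta> = \<eta> / (\<bar>\<omega>\<bar> * (1 + 2 * (of_int n)\<^sup>2))"
  have n2: "1 + 2 * (real_of_int n)\<^sup>2 \<ge> 1" by simp
  have n2': "1 + 2 * (real_of_int n)\<^sup>2 > 0" using n2 by linarith
  have \<delta>: "\<delta> > 0" unfolding \<delta>_def
    by (intro divide_pos_pos mult_pos_pos \<eta> n2') (use \<omega>_nz in simp)
  obtain \<beta> \<beta>' \<beta>'' \<gamma> \<gamma>' \<gamma>'' where \<beta>: "twice_smooth \<beta> \<beta>' \<beta>''" and \<gamma>: "twice_smooth \<gamma> \<gamma>' \<gamma>''"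
    and zero: "\<beta> 0 = 0" "\<gamma> 0 = 0" and \<beta>_real: "\<And>t. cnj (\<beta> t) = \<beta> t"
    and approx: "\<And>t. t \<in> {0..1} \<Longrightarrow> norm (integral {0..t} (\<lambda>r. \<beta> r * \<gamma> r) - Y t) \<le> \<delta>"
    using approximate_by_primitive_of_product[OF Y \<delta>] by blast
  obtain B1 where B1: "B1 \<ge> 1" "\<forall>t\<in>{0..1}. norm (\<beta> t) \<le> B1 \<and> norm (\<beta>' t) \<le> B1 \<and> norm (\<beta>'' t) \<le> B1"
    using twice_smooth_bounded[OF \<beta>] by blast
  obtain B2 where B2: "B2 \<ge> 1" "\<forall>t\<in>{0..1}. norm (\<gamma> t) \<le> B2 \<and> norm (\<gamma>' t) \<le> B2 \<and> norm (\<gamma>'' t) \<le> B2"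
    using twice_smooth_bounded[OF \<gamma>] by blast
  define B where "B = B1 + B2"
  have B: "B \<ge> 1" and B\<beta>: "\<And>t. t \<in> {0..1} \<Longrightarrow> norm (\<beta> t) \<le> B" "\<And>t. t \<in> {0..1} \<Longrightarrow> norm (\<beta>' t) \<le> B"
      "\<And>t. t \<in> {0..1} \<Longrightarrow> norm (\<beta>'' t) \<le> B"
    and B\<gamma>: "\<And>t. t \<in> {0..1} \<Longrightarrow> norm (\<gamma> t) \<le> B" "\<And>t. t \<in> {0..1} \<Longrightarrow> norm (\<gamma>' t) \<le> B"
      "\<And>t. t \<in> {0..1} \<Longrightarrow> norm (\<gamma>'' t) \<le> B"
    unfolding B_def using B1 B2 by (fastforce simp: add_increasing add_increasing2)+
  define A where "A = (\<Sum>x\<in>modes M. snorm (a x))"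
  have sna: "0 \<le> snorm (a x)" for x by (rule snorm_nonneg[OF a_cont])
  have A0: "A \<ge> 0" unfolding A_def by (rule sum_nonneg) (rule sna)
  have A: "norm (a x t) \<le> A" if "t \<in> {0..1}" for x t
  proof (cases "x \<in> modes M")
    case True
    have "norm (a x t) \<le> snorm (a x)" by (rule snorm_upper[OF a_cont that])
    also have "\<dots> \<le> A" unfolding A_def by (rule member_le_sum) (use True sna in auto)
    finally show ?thesis .
  qed (simp add: a(4) A0)
  define q where "q = 1 + 2 * \<bar>real_of_int n\<bar>"
  have q: "q \<ge> 1" by (simp add: q_def)
  \<comment> \<open>A bound on all amplitudes, and on \<open>L\<close> times those of the modes \<open>- k\<close> and \<open>- l\<close>.\<close>
  define D where "D = A + 3 * B * q"
  have Bq: "B \<le> 3 * B * q" using mult_mono[of 1 3 B "B * q"] mult_left_mono[OF q, of B] B by simp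
  have D: "A \<le> D" "3 * B * q \<le> D" "B \<le> D" "D \<ge> 0" using Bq A0 B unfolding D_def by linarith+
  define N where "N = (card (modes M) + 4) * (card (modes M) + 4)"
  obtain L where L: "L \<ge> 1" "(of_nat N * (D * D)) * (L powr s + 1 / L) \<le> \<eta>" "(4 * D) * L powr s \<le> \<eta>"
    using exists_large_scale[OF \<eta>] by blast
  \<comment> \<open>The new frequencies: \<open>k\<close> is huge and \<open>l\<close> is chosen so that both interact at frequency \<open>n\<close>.\<close>
  define k where "k = \<lceil>L\<rceil> + \<bar>n\<bar> + M + 1"
  define l where "l = e2 * (n - e1 * k)"
  have M0: "M \<ge> 0" by (rule a(1))
  have kL: "L \<le> of_int (k - \<bar>n\<bar> - M)" unfolding k_def using le_of_int_ceiling[of L] by linarith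
  have k0: "k - \<bar>n\<bar> - M \<ge> 1" using L(1) kL by linarith
  have out_kl: "out (k, l) = n" using sign2 by (auto simp: out_def l_def)
  have k_l: "k \<noteq> l" using k0 n signs M0 by (auto simp: l_def)
  have l_abs: "\<bar>l\<bar> \<ge> k - \<bar>n\<bar>" using signs k0 by (auto simp: l_def)
  have mirror_case: "l = k - n" "l > 0" "k > 0" "n > 0" "e1 = 1" "e2 = -1" if "e1 \<noteq> e2"
    using that n[OF that] signs k0 M0 by (auto simp: l_def)
  define \<theta> where "\<theta> = phase (k, l)"
  \<comment> \<open>If the signs agree, then \<open>(k, l)\<close> and \<open>(l, k)\<close> both interact at frequency \<open>n\<close>, with equal
    contributions; otherwise \<open>(l, k)\<close> interacts at \<open>- n\<close>.\<close>
  define \<kappa> :: complex where "\<kappa> = (if e1 = e2 then 1 / 2 else 1)"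
  have \<kappa>_same: "\<kappa> = 1 / 2" if "e1 = e2"
    using that by (simp add: \<kappa>_def)
  have \<kappa>_mirror: "\<kappa> = 1" if "e1 \<noteq> e2"
    using that by (simp add: \<kappa>_def)
  define bk where "bk t = conj_sign e1 (\<beta> t)" for t
  define bl where "bl t = conj_sign e2 (\<kappa> * (\<gamma> t * wave (- of_int \<theta>) t))" for t
  define b where "b x = (if x = k then bk else if x = l then bl
      else if e1 \<noteq> e2 \<and> x = - k then (\<lambda>t. - mirror k bk t)
      else if e1 \<noteq> e2 \<and> x = - l then (\<lambda>t. - mirror l bl t) else (\<lambda>_. 0))" for x
  define R where "R = (if e1 = e2 then {k, l} else {k, l, - k, - l})"
  have bk_cont: "continuous_on {0..1} bk" and bl_cont: "continuous_on {0..1} bl"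
    unfolding bk_def[abs_def] bl_def[abs_def]
    by (intro continuous_intros twice_smoothD(3)[OF \<beta>] twice_smoothD(3)[OF \<gamma>])+
  have b_k: "b k = bk" and b_l: "b l = bl" using k_l by (simp_all add: b_def)
  have b_cont: "continuous_on {0..1} (b x)" for x
    unfolding b_def by (auto intro!: continuous_intros bk_cont bl_cont continuous_on_mirror)
  have "bk 0 = 0" "bl 0 = 0" by (simp_all add: bk_def bl_def zero)
  then have b_0: "b x 0 = 0" for x
    unfolding b_def by (auto simp: mirror_at_0)
  have b_out: "b x = (\<lambda>_. 0)" if "x \<notin> R" for x
    using that by (auto simp: b_def R_def split: if_splits)
  have b_sym: "b (- x) t = - mirror x (b x) t" if e: "e1 \<noteq> e2" and x: "x > 0" for x t
  proof -
    have "- x \<noteq> k" "- x \<noteq> l" "x \<noteq> - k" "x \<noteq> - l" using mirror_case(2,3)[OF e] x by auto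
    then show ?thesis using e k_l by (cases "x = k \<or> x = l") (auto simp: b_def mirror_zero)
  qed
  have R_abs: "\<bar>x\<bar> \<ge> k - \<bar>n\<bar>" if "x \<in> R" for x
    using that l_abs k0 M0 by (auto simp: R_def split: if_splits)
  define M' where "M' = 2 * k + 2 * \<bar>n\<bar> + M"
  have M': "M < M'" using k0 M0 by (simp add: M'_def)
  have R_fin: "finite R" by (simp add: R_def)
  have R_card: "card R \<le> 4"
    unfolding R_def by (auto intro: order_trans[OF card_insert_le_m1] simp: card_insert_if)
  have R_M: "R \<inter> modes M = {}"
    using R_abs k0 by (force simp: modes_def)
  have R_M': "R \<subseteq> modes M'"
    using k0 M0 signs by (auto simp: modes_def R_def M'_def l_def split: if_splits)
  \<comment> \<open>Up to the factor \<open>\<kappa>\<close>, the primitive of the interaction of \<open>k\<close> and \<open>l\<close> is that of \<open>\<beta> \<gamma>\<close>.\<close>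
  define P where "P t = integral {0..t} (\<lambda>r. \<beta> r * \<gamma> r)" for t
  have P_cont: "continuous_on {0..1} P"
    unfolding P_def[abs_def]
    by (intro indefinite_integral_continuous_1 integrable_continuous_interval continuous_intros
        twice_smoothD(3)[OF \<beta>] twice_smoothD(3)[OF \<gamma>])
  have int_kl: "interaction b (k, l) r = \<kappa> * (\<beta> r * \<gamma> r)" for r
  proof -
    have "wave (of_int \<theta>) r * wave (- of_int \<theta>) r = 1"
      by (simp add: wave_mult) (simp add: wave_def)
    moreover have "interaction b (k, l) r = wave (of_int \<theta>) r * (\<beta> r * (\<kappa> * (\<gamma> r * wave (- of_int \<theta>) r)))"
      by (simp add: interaction_def b_k b_l bk_def bl_def wave_def \<theta>_def)
    ultimately show ?thesis by (metis mult.assoc mult.commute mult_1)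
  qed
  have prim_kl: "primitive b (k, l) t = \<kappa> * P t" for t
  proof -
    have "interaction b (k, l) = (\<lambda>r. \<kappa> * (\<beta> r * \<gamma> r))" by (rule ext) (rule int_kl)
    then show ?thesis by (simp add: primitive_def P_def)
  qed
  have prim_lk_same: "primitive b (l, k) t = primitive b (k, l) t" if e: "e1 = e2" for t
  proof -
    have "phase (l, k) = phase (k, l)" unfolding phase_def out_def by (simp add: e algebra_simps)
    then have "interaction b (l, k) = interaction b (k, l)"
      unfolding fun_eq_iff interaction_def by (simp add: e mult_ac)
    then show ?thesis by (simp add: primitive_def)
  qed
  have prim_lk_mirror: "primitive b (l, k) t = mirror n (primitive b (k, l)) t"
    if "e1 \<noteq> e2" "t \<in> {0..1}" for t
    using mirror_primitive[OF b_cont that out_kl] by simp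
  have main_err: "norm (d t + of_real \<omega> * P t) \<le> \<bar>\<omega>\<bar> * \<delta>" if t: "t \<in> {0..1}" for t
  proof -
    have "d t + of_real \<omega> * P t = of_real \<omega> * (P t - Y t)"
      using \<omega>_nz by (simp add: Y_def field_simps)
    then have "norm (d t + of_real \<omega> * P t) = \<bar>\<omega>\<bar> * norm (P t - Y t)"
      by (simp add: norm_mult)
    also have "\<dots> \<le> \<bar>\<omega>\<bar> * \<delta>"
      using approx[OF t] unfolding P_def by (intro mult_left_mono) auto
    finally show ?thesis .
  qed
  have \<omega>\<delta>: "(1 + 2 * (of_int n)\<^sup>2) * (\<bar>\<omega>\<bar> * \<delta>) = \<eta>"
    using \<omega>_nz less_imp_neq[OF n2', symmetric] unfolding \<delta>_def by simp
  have "\<bar>\<omega>\<bar> * \<delta> \<le> (1 + 2 * (of_int n)\<^sup>2) * (\<bar>\<omega>\<bar> * \<delta>)"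
    using mult_right_mono[OF n2, of "\<bar>\<omega>\<bar> * \<delta>"] \<delta> by simp
  then have \<omega>\<delta>_le: "\<bar>\<omega>\<bar> * \<delta> \<le> \<eta>" using \<omega>\<delta> by simp
  have dP: "snorm (\<lambda>t. d t + of_real \<omega> * P t) \<le> \<bar>\<omega>\<bar> * \<delta>" by (rule snorm_least) (rule main_err)
  have dP_cont: "continuous_on {0..1} (\<lambda>t. d t + of_real \<omega> * P t)" by (intro continuous_intros d_cont P_cont)
  define main where "main = {(k, l), (l, k)}"
  define Tg where "Tg = (if e1 = e2 then {n} else {n, - n})"
  have out_lk: "out (l, k) = (if e1 = e2 then n else - n)"
    using out_kl signs by (auto simp: out_def)
  have fib_same: "{p\<in>main. out p = n} = {(k, l), (l, k)}" if "e1 = e2"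
    using that out_kl out_lk by (auto simp: main_def)
  have fib_mirror: "{p\<in>main. out p = n} = {(k, l)}" "{p\<in>main. out p = - n} = {(l, k)}" if "e1 \<noteq> e2"
    using that out_kl out_lk n[OF that] by (auto simp: main_def)
  have cancel_n: "snorm (\<lambda>t. defect M a n t + of_real \<omega> * (\<Sum>p\<in>{p\<in>main. out p = n}. primitive b p t)) \<le> \<bar>\<omega>\<bar> * \<delta>"
  proof -
    have "(\<Sum>p\<in>{p\<in>main. out p = n}. primitive b p t) = P t" for t
    proof (cases "e1 = e2")
      case True
      show ?thesis unfolding fib_same[OF True] using k_l
        by (simp add: prim_lk_same[OF True] prim_kl \<kappa>_same[OF True])
    next
      case False
      show ?thesis unfolding fib_mirror[OF False] by (simp add: prim_kl \<kappa>_mirror[OF False])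
    qed
    then show ?thesis using dP by (simp add: d_def)
  qed
  have mirror_dP: "defect M a (- n) t + of_real \<omega> * primitive b (l, k) t =
      mirror n (\<lambda>t. d t + of_real \<omega> * P t) t" if e: "e1 \<noteq> e2" and t: "t \<in> {0..1}" for t
  proof -
    have "primitive b (k, l) = P" using e by (simp add: fun_eq_iff prim_kl \<kappa>_def)
    then have "defect M a (- n) t + of_real \<omega> * primitive b (l, k) t = cnj 1 * mirror n d t + cnj (of_real \<omega>) * mirror n P t"
      using mirror_defect[OF st e t n[OF e]] prim_lk_mirror[OF e t] by (simp add: d_def)
    also have "\<dots> = mirror n (\<lambda>t. 1 * d t + of_real \<omega> * P t) t"
      by (rule mirror_add_cmult[OF d_cont P_cont t, symmetric])
    finally show ?thesis by simp
  qed
  have cancel_neg: "snorm (\<lambda>t. defect M a (- n) t + of_real \<omega> * primitive b (l, k) t) \<le> \<eta>" if e: "e1 \<noteq> e2"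
  proof -
    have "snorm (\<lambda>t. defect M a (- n) t + of_real \<omega> * primitive b (l, k) t) =
        snorm (mirror n (\<lambda>t. d t + of_real \<omega> * P t))"
      by (rule snorm_cong) (simp add: mirror_dP[OF e])
    also have "\<dots> \<le> (1 + 2 * (of_int n)\<^sup>2) * snorm (\<lambda>t. d t + of_real \<omega> * P t)"
      by (rule snorm_mirror_le[OF dP_cont])
    also have "\<dots> \<le> (1 + 2 * (of_int n)\<^sup>2) * (\<bar>\<omega>\<bar> * \<delta>)"
      by (rule mult_left_mono[OF dP]) simp
    finally show ?thesis by (simp add: \<omega>\<delta>)
  qed
  have cancel: "snorm (\<lambda>t. defect M a x t + of_real \<omega> * (\<Sum>p\<in>{p\<in>main. out p = x}. primitive b p t)) \<le> \<eta>"
    if x: "x \<in> Tg" for x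
  proof (cases "x = n")
    case True
    then show ?thesis using cancel_n \<omega>\<delta>_le by (simp add: order_trans)
  next
    case False
    then have e: "e1 \<noteq> e2" "x = - n" using x by (auto simp: Tg_def split: if_splits)
    then show ?thesis using cancel_neg[OF e(1)] by (simp add: fib_mirror(2)[OF e(1)])
  qed
  note size = snorm_of_cancelling_le[where c="of_real \<omega>", unfolded norm_of_real]
  have main_size: "(\<Sum>p\<in>main. pair_size b p)
      \<le> (\<Sum>x\<in>Tg. weight s x * (snorm (defect M a x) + \<eta>)) / \<bar>\<omega>\<bar>"
  proof -
    have "(\<Sum>p\<in>main. weight s (out p) * (\<bar>\<omega>\<bar> * snorm (primitive b p)))
        \<le> (\<Sum>x\<in>Tg. weight s x * (snorm (defect M a x) + \<eta>))"
    proof (cases "e1 = e2")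
      case True
      have half: "snorm (primitive b p) \<le> 1 / 2 * snorm P" if "p \<in> {(k, l), (l, k)}" for p
      proof -
        have "primitive b p = (\<lambda>t. \<kappa> * P t)"
          using that prim_lk_same[OF True] prim_kl by (auto simp: fun_eq_iff)
        then show ?thesis using snorm_cmult_le[OF P_cont, of \<kappa>] by (simp add: \<kappa>_same[OF True])
      qed
      have "\<bar>\<omega>\<bar> * snorm P \<le> snorm d + \<eta>"
        by (rule size[OF _ P_cont d_cont]) (use dP \<omega>\<delta>_le in simp)
      moreover have "\<bar>\<omega>\<bar> * snorm (primitive b (k, l)) + \<bar>\<omega>\<bar> * snorm (primitive b (l, k)) \<le> \<bar>\<omega>\<bar> * snorm P"
        using mult_left_mono[OF half[of "(k, l)"], of "\<bar>\<omega>\<bar>"] mult_left_mono[OF half[of "(l, k)"], of "\<bar>\<omega>\<bar>"] by simp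
      ultimately have "weight s n * (\<bar>\<omega>\<bar> * snorm (primitive b (k, l)) + \<bar>\<omega>\<bar> * snorm (primitive b (l, k)))
          \<le> weight s n * (snorm d + \<eta>)"
        by (intro mult_left_mono) auto
      then show ?thesis
        using True k_l out_kl out_lk by (simp add: main_def Tg_def d_def distrib_left)
    next
      case False
      have pc: "continuous_on {0..1} (primitive b p)" for p by (rule primitive_continuous[OF b_cont])
      have dc: "continuous_on {0..1} (defect M a x)" for x by (rule defect_continuous[OF a_cont])
      have "\<bar>\<omega>\<bar> * snorm (primitive b (k, l)) \<le> snorm (defect M a n) + \<eta>"
        by (rule size[OF _ pc dc]) (use cancel_n \<omega>\<delta>_le fib_mirror(1)[OF False] in simp)
      moreover have "\<bar>\<omega>\<bar> * snorm (primitive b (l, k)) \<le> snorm (defect M a (- n)) + \<eta>"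
        by (rule size[OF cancel_neg[OF False] pc dc])
      ultimately have "weight s n * (\<bar>\<omega>\<bar> * snorm (primitive b (k, l))) + weight s (- n) * (\<bar>\<omega>\<bar> * snorm (primitive b (l, k)))
          \<le> weight s n * (snorm (defect M a n) + \<eta>) + weight s (- n) * (snorm (defect M a (- n)) + \<eta>)"
        by (intro add_mono mult_left_mono) auto
      then show ?thesis
        using False k_l out_kl out_lk n[OF False] by (simp add: main_def Tg_def)
    qed
    then have "\<bar>\<omega>\<bar> * (\<Sum>p\<in>main. pair_size b p)
        \<le> (\<Sum>x\<in>Tg. weight s x * (snorm (defect M a x) + \<eta>))"
      by (simp add: sum_distrib_left mult.left_commute)
    then show ?thesis using \<omega>_nz by (simp add: field_simps)
  qed
  \<comment> \<open>All other interactions are at high frequency, or involve a small mirror mode.\<close>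
  have mirror_small: "norm (b x t) \<le> D / L" if e: "e1 \<noteq> e2" and x: "x \<in> {- k, - l}" and t: "t \<in> {0..1}" for x t
  proof -
    note mc = mirror_case[OF e]
    have "3 * B * q / of_int k \<le> D / L"
      by (rule frac_le) (use D L kL M0 in auto)
    moreover have "3 * B * 1 / of_int k \<le> 3 * B * q / of_int k"
      by (intro divide_right_mono mult_left_mono q) (use B mc in auto)
    moreover have "norm (mirror k bk t) \<le> 3 * B * 1 / of_int k"
    proof -
      have "bk = (\<lambda>t. cnj (\<beta> t * wave (of_int (2 * 0 * k)) t))"
        using mc \<beta>_real by (simp add: bk_def fun_eq_iff conj_sign_def wave_def)
      then show ?thesis using mirror_mode_le[OF \<beta> zero(1) B\<beta> _ _ t, of k 0] mc by simp
    qed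
    moreover have "norm (mirror l bl t) \<le> 3 * B * q / of_int k"
    proof -
      have "\<theta> = (l + n - l)\<^sup>2 - (l + n)\<^sup>2 + l\<^sup>2"
        unfolding \<theta>_def phase_def out_kl fst_conv snd_conv unfolding mc(5,6) using mc(1) by simp
      then have th: "- of_int \<theta> = real_of_int (2 * n * l)"
        by (simp add: power2_eq_square algebra_simps)
      have "bl = (\<lambda>t. cnj (\<gamma> t * wave (of_int (2 * n * l)) t))"
        unfolding th[symmetric] using mc e by (simp add: bl_def fun_eq_iff conj_sign_def \<kappa>_def)
      moreover have "l \<ge> 1" "n \<ge> 0" "l + n = k" using mc by auto
      ultimately show ?thesis
        using mirror_mode_le[OF \<gamma> zero(2) B\<gamma> _ _ t, of l n] mc(4) by (simp add: q_def)
    qed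
    moreover have "b (- k) t = - mirror k bk t" "b (- l) t = - mirror l bl t"
      using mc k_l e by (simp_all add: b_def)
    ultimately show ?thesis using x by auto
  qed
  have DL: "D / L \<le> D" using L(1) D(4) by (simp add: divide_le_eq mult_left_le mult_le_cancel_left1)
  have b_D: "norm (b x t) \<le> D" if t: "t \<in> {0..1}" for x t
  proof (cases "x = k \<or> x = l")
    case True
    have "norm (bk t) \<le> B" using B\<beta>(1)[OF t] by (simp add: bk_def)
    moreover have "norm (bl t) \<le> B"
      using B\<gamma>(1)[OF t] norm_ge_zero[of "\<gamma> t"] by (auto simp: bl_def norm_mult \<kappa>_def simp del: norm_ge_zero)
    ultimately show ?thesis using True b_k b_l D(3) by auto
  next
    case False
    show ?thesis
    proof (cases "x \<in> R")
      case True
      then have "e1 \<noteq> e2" "x \<in> {- k, - l}" using False by (auto simp: R_def split: if_splits)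
      from mirror_small[OF this t] DL show ?thesis by simp
    qed (simp add: b_out D(4))
  qed
  define a' where "a' = (\<lambda>x t. a x t + b x t)"
  have a'_cont: "continuous_on {0..1} (a' x)" for x
    unfolding a'_def by (intro continuous_intros a_cont b_cont)
  have a'_R: "a' x = b x" if "x \<in> R" for x
  proof -
    have "x \<notin> modes M" using that R_M by auto
    then show ?thesis by (simp add: a'_def a(4))
  qed
  have a'_D: "norm (a' x t) \<le> D" if "t \<in> {0..1}" for x t
  proof (cases "x \<in> R")
    case True
    then show ?thesis using a'_R b_D[OF that] by simp
  next
    case False
    then show ?thesis using A[OF that, of x] D(1) by (simp add: a'_def b_out)
  qed
  define new where "new = ((modes M \<union> R) \<times> (modes M \<union> R)) \<inter> admissible - pairs M - main"
  have new_small: "(\<Sum>p\<in>new. pair_size a' p) \<le> \<eta>"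
  proof -
    have "(\<Sum>p\<in>new. pair_size a' p) \<le> of_nat N * (D * D * (L powr s + 1 / L))"
    proof (rule high_pairs_sum_le[OF a'_cont])
      have "card new \<le> card ((modes M \<union> R) \<times> (modes M \<union> R))"
        by (rule card_mono) (use R_fin in \<open>auto simp: new_def\<close>)
      also have "\<dots> \<le> N"
        unfolding N_def card_cartesian_product
        by (intro mult_mono order_trans[OF card_Un_le] add_mono R_card) auto
      finally show "card new \<le> N" .
      show "L > 0" using L(1) by simp
      show "norm (a' x t) \<le> D" if "t \<in> {0..1}" for x t by (rule a'_D[OF that])
      fix p assume p: "p \<in> new"
      obtain x y where xy: "p = (x, y)" by (cases p)
      have in_xy: "x \<in> modes M \<union> R" "y \<in> modes M \<union> R" "(x, y) \<notin> main" "(x, y) \<in> admissible"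
        "x \<in> R \<or> y \<in> R"
        using p by (auto simp: xy new_def pairs_def)
      have low: "\<bar>z\<bar> \<le> M" if "z \<in> modes M" for z using that by (auto simp: modes_def)
      have "k - \<bar>n\<bar> - M \<le> \<bar>out p\<bar> \<or> (e1 \<noteq> e2 \<and> x \<in> R \<and> y \<in> R \<and> (x \<in> {- k, - l} \<or> y \<in> {- k, - l}))"
      proof (cases "x \<in> R \<and> y \<in> R")
        case False
        then have "(\<bar>x\<bar> \<ge> k - \<bar>n\<bar> \<and> \<bar>y\<bar> \<le> M) \<or> (\<bar>y\<bar> \<ge> k - \<bar>n\<bar> \<and> \<bar>x\<bar> \<le> M)"
          using in_xy R_abs low by blast
        moreover have "\<bar>out p\<bar> \<ge> \<bar>\<bar>x\<bar> - \<bar>y\<bar>\<bar>"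
          unfolding xy out_def using signs by auto
        ultimately show ?thesis by linarith
      next
        case True
        show ?thesis
        proof (cases "e1 = e2")
          case e: True
          then have "x = y" using True in_xy(3) by (auto simp: R_def main_def)
          moreover have "\<bar>x\<bar> \<ge> k - \<bar>n\<bar>" using R_abs True by simp
          moreover have "\<bar>out p\<bar> = \<bar>x + y\<bar>" unfolding xy out_def using e signs by auto
          ultimately show ?thesis using M0 by linarith
        next
          case e: False
          then show ?thesis using True in_xy(3,4) by (auto simp: R_def main_def admissible_def)
        qed
      qed
      then show "L \<le> \<bar>of_int (out p)\<bar> \<or>
          (\<forall>t\<in>{0..1}. norm (a' (fst p) t) * norm (a' (snd p) t) \<le> D * D / L)"
      proof
        assume "k - \<bar>n\<bar> - M \<le> \<bar>out p\<bar>"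
        then have "real_of_int (k - \<bar>n\<bar> - M) \<le> real_of_int \<bar>out p\<bar>" by (simp only: of_int_le_iff)
        then show ?thesis using kL by simp
      next
        assume h: "e1 \<noteq> e2 \<and> x \<in> R \<and> y \<in> R \<and> (x \<in> {- k, - l} \<or> y \<in> {- k, - l})"
        have "norm (b x t) * norm (b y t) \<le> D * D / L" if t: "t \<in> {0..1}" for t
        proof -
          have "norm (b x t) \<le> D / L \<or> norm (b y t) \<le> D / L"
            using h mirror_small[of _ t] t by blast
          then show ?thesis
          proof
            assume "norm (b x t) \<le> D / L"
            from mult_mono[OF this b_D[OF t, of y]] show ?thesis using D(4) L(1) by simp
          next
            assume "norm (b y t) \<le> D / L"
            from mult_mono[OF b_D[OF t, of x] this] show ?thesis using D(4) by simp
          qed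
        qed
        then show ?thesis using h a'_R by (simp add: xy)
      qed
    qed
    then show ?thesis using L(2) by (simp add: mult.assoc)
  qed
  have modes_small: "(\<Sum>x\<in>R. weight s x * snorm (b x)) \<le> \<eta>"
  proof -
    have "(\<Sum>x\<in>R. weight s x * snorm (b x)) \<le> of_nat (card R) * (L powr s * D)"
    proof (rule sum_bounded_above)
      fix x assume x: "x \<in> R"
      have "k - \<bar>n\<bar> - M \<le> \<bar>x\<bar>" using R_abs[OF x] M0 by linarith
      then have "real_of_int (k - \<bar>n\<bar> - M) \<le> real_of_int \<bar>x\<bar>" by (simp only: of_int_le_iff)
      then have "L \<le> \<bar>of_int x\<bar>" using kL by simp
      then have "weight s x \<le> L powr s" using L(1) by (intro weight_le_powr s_neg) auto
      moreover have "snorm (b x) \<le> D" by (rule snorm_least) (rule b_D)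
      ultimately show "weight s x * snorm (b x) \<le> L powr s * D"
        by (intro mult_mono snorm_nonneg b_cont) auto
    qed
    also have "\<dots> \<le> 4 * (L powr s * D)"
      by (rule mult_right_mono) (use R_card D(4) in auto)
    finally show ?thesis using L(3) by (simp add: mult_ac)
  qed
  have Tg: "finite Tg" "card Tg \<le> 2" "Tg \<subseteq> modes (2 * M')"
    using k0 M0 by (auto simp: Tg_def modes_def M'_def card_insert_if)
  have main: "main \<subseteq> (R \<times> R) \<inter> admissible" "out ` main \<subseteq> Tg"
    using k_l out_kl out_lk by (auto simp: main_def R_def admissible_def Tg_def)
  note block = add_block[OF st R_fin R_M R_M' M' b_cont b_0 b_out b_sym main Tg less_imp_le[OF \<eta>],
      folded a'_def, folded new_def, OF _ _ _ new_small modes_small cancel main_size]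
  have w: "weight s (- n) = weight s n" by (simp add: weight_def)
  have keep: "a' x = a x" if "x \<in> modes M" for x
  proof -
    have "x \<notin> R" using that R_M by auto
    then show ?thesis by (simp add: a'_def b_out)
  qed
  have "approximate_state M' a'" by (rule block(1)) auto
  moreover have "(\<Sum>p\<in>pairs M' - pairs M. pair_size a' p)
      \<le> (total_defect M a - total_defect M' a') / \<bar>\<omega>\<bar> + (2 + 5 / \<bar>\<omega>\<bar>) * \<eta>"
    by (rule block(2)) auto
  moreover have "(\<Sum>x\<in>modes M' - modes M. weight s x * snorm (a' x)) \<le> \<eta>"
    unfolding a'_def by (rule block(3)) auto
  moreover have target: "snorm (defect M' a' x) \<le> \<eta> + (1 + \<bar>\<omega>\<bar>) * \<eta> / weight s x" if "x \<in> Tg" for x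
    by (rule block(4)) (use that in auto)
  moreover have "snorm (defect M' a' n) \<le> \<eta> + (1 + \<bar>\<omega>\<bar>) * \<eta> / weight s n"
    by (rule target) (simp add: Tg_def)
  moreover have "snorm (defect M' a' (- n)) \<le> \<eta> + (1 + \<bar>\<omega>\<bar>) * \<eta> / weight s n" if "e1 \<noteq> e2"
    using target[of "- n"] that by (simp add: Tg_def w)
  ultimately show ?thesis
    using M' keep by blast
qed

end

section \<open>Iteration\<close>

lemma summable_on_exhaustion:
  fixes f :: "'a \<Rightarrow> real"
  assumes "\<And>x. x \<in> A \<Longrightarrow> 0 \<le> f x"
    and X: "\<And>J. finite (X J)" "\<And>J. X J \<subseteq> A"
    and cover: "\<And>F. finite F \<Longrightarrow> F \<subseteq> A \<Longrightarrow> \<exists>J. F \<subseteq> X J"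
    and bound: "\<And>J. sum f (X J) \<le> C"
  shows "f summable_on A"
proof (rule nonneg_bdd_above_summable_on)
  show "bdd_above (sum f ` {F. F \<subseteq> A \<and> finite F})"
  proof (rule bdd_aboveI2)
    fix F assume "F \<in> {F. F \<subseteq> A \<and> finite F}"
    then obtain J where J: "F \<subseteq> X J" using cover by blast
    have "sum f F \<le> sum f (X J)"
      by (rule sum_mono2[OF X(1) J]) (use X(2) assms(1) in blast)
    then show "sum f F \<le> C" using bound[of J] by linarith
  qed
qed (use assms(1) in auto)

context quadratic_equation
begin

text \<open>With different signs, positive frequencies are treated together with their negatives, and the mode \<open>0\<close>
  has no defect at all, so some other mode can be corrected in its place.\<close>

lemma improve_state:
  assumes st: "approximate_state M a" and \<epsilon>: "\<epsilon> > 0"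
  shows "\<exists>M' a'. M < M' \<and> approximate_state M' a' \<and> (\<forall>x\<in>modes M. a' x = a x) \<and>
    (\<Sum>p\<in>pairs M' - pairs M. pair_size a' p)
      \<le> (total_defect M a - total_defect M' a') / \<bar>\<omega>\<bar> + \<epsilon> \<and>
    (\<Sum>x\<in>modes M' - modes M. weight s x * snorm (a' x)) \<le> \<epsilon> \<and>
    snorm (defect M' a' n) \<le> \<epsilon>"
proof -
  define n' where "n' = (if e1 = e2 then n else if n = 0 then 1 else \<bar>n\<bar>)"
  define C where "C = (2 + 5 / \<bar>\<omega>\<bar>) + 1 + (1 + \<bar>\<omega>\<bar>) / weight s n'"
  have "0 \<le> 5 / \<bar>\<omega>\<bar>" "0 \<le> (1 + \<bar>\<omega>\<bar>) / weight s n'" by simp_all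
  then have C: "C \<ge> 1" "2 + 5 / \<bar>\<omega>\<bar> \<le> C" "1 + (1 + \<bar>\<omega>\<bar>) / weight s n' \<le> C"
    unfolding C_def by linarith+
  define \<eta> where "\<eta> = \<epsilon> / C"
  have \<eta>: "\<eta> > 0" using \<epsilon> C(1) by (simp add: \<eta>_def)
  have mult_\<eta>: "c * \<eta> \<le> \<epsilon>" if "c \<le> C" for c
    using mult_right_mono[OF that, of \<eta>] \<eta> C(1) by (simp add: \<eta>_def)
  have pos: "n' > 0" if "e1 \<noteq> e2" using that by (simp add: n'_def)
  obtain M' a' where new: "M < M'" "approximate_state M' a'" "\<forall>x\<in>modes M. a' x = a x"
    "(\<Sum>p\<in>pairs M' - pairs M. pair_size a' p)
      \<le> (total_defect M a - total_defect M' a') / \<bar>\<omega>\<bar> + (2 + 5 / \<bar>\<omega>\<bar>) * \<eta>"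
    "(\<Sum>x\<in>modes M' - modes M. weight s x * snorm (a' x)) \<le> \<eta>"
    "snorm (defect M' a' n') \<le> \<eta> + (1 + \<bar>\<omega>\<bar>) * \<eta> / weight s n'"
    "e1 \<noteq> e2 \<longrightarrow> snorm (defect M' a' (- n')) \<le> \<eta> + (1 + \<bar>\<omega>\<bar>) * \<eta> / weight s n'"
    using cancel_defect[OF st pos \<eta>] by blast
  have "\<eta> + (1 + \<bar>\<omega>\<bar>) * \<eta> / weight s n' = (1 + (1 + \<bar>\<omega>\<bar>) / weight s n') * \<eta>"
    by (simp add: algebra_simps add_divide_distrib)
  then have small: "\<eta> + (1 + \<bar>\<omega>\<bar>) * \<eta> / weight s n' \<le> \<epsilon>"
    using mult_\<eta>[OF C(3)] by simp
  have "snorm (defect M' a' n) \<le> \<epsilon>"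
  proof (cases "e1 \<noteq> e2 \<and> n = 0")
    case True
    \<comment> \<open>Removing the mean makes the mode \<open>0\<close> free of defects.\<close>
    have "{p\<in>pairs M'. out p = 0} = {}"
      using signs True by (auto simp: pairs_def admissible_def out_def)
    moreover have "a' 0 = (\<lambda>_. 0)" using approximate_stateD(5)[OF new(2)] True by simp
    ultimately have "defect M' a' n t = 0" for t
      using True unfolding defect_def by (simp only: sum.empty) simp
    then show ?thesis using \<epsilon> by (simp add: snorm_zero)
  next
    case False
    then have "n = n' \<or> (e1 \<noteq> e2 \<and> n = - n')" by (auto simp: n'_def)
    then show ?thesis using new(6,7) small by auto
  qed
  moreover have "(\<Sum>p\<in>pairs M' - pairs M. pair_size a' p)
      \<le> (total_defect M a - total_defect M' a') / \<bar>\<omega>\<bar> + \<epsilon>"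
    using new(4) mult_\<eta>[OF C(2)] by linarith
  moreover have "(\<Sum>x\<in>modes M' - modes M. weight s x * snorm (a' x)) \<le> \<epsilon>"
    using new(5) mult_\<eta>[OF C(1)] by simp
  ultimately show ?thesis using new(1-3) by blast
qed

text \<open>The initial mode is \<open>1\<close> because with different signs the mode \<open>0\<close> vanishes.\<close>

lemma initial_state:
  "\<exists>a. approximate_state 1 a \<and> a 1 1 = 1"
proof -
  define a :: "int \<Rightarrow> real \<Rightarrow> complex" where
    "a n = (if n = 1 then of_real else if e1 \<noteq> e2 \<and> n = - 1 then (\<lambda>t. - mirror 1 of_real t) else (\<lambda>_. 0))"
    for n
  have "continuous_on {0..1} (complex_of_real)" by (intro continuous_intros)
  then have "approximate_state 1 a"
    unfolding approximate_state_def
    by (auto simp: a_def modes_def mirror_zero mirror_at_0 intro!: continuous_intros continuous_on_mirror)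
  then show ?thesis by (intro exI[of _ a]) (simp add: a_def)
qed

text \<open>Each step keeps the modes already present, so the coefficients stabilize.  Summing \<open>new_pairs\<close> over
  the steps, the total defects telescope and the interactions are absolutely summable.  The defect
  in the mode \<open>n\<close> therefore converges, and it is at most \<open>(1 / 2) ^ j\<close> after each step \<open>j\<close> that treats \<open>n\<close>; there are
  infinitely many of these, so its limit is \<open>0\<close>.\<close>

lemma coefficients_exist:
  "\<exists>A. weighted_family s A \<and> (\<forall>n. A n 0 = 0) \<and> A 1 1 = 1 \<and>
    (\<lambda>p. pair_size A p) summable_on admissible \<and>
    (\<forall>n. \<forall>t\<in>{0..1}. \<i> * A n t + of_real \<omega> *
       (\<Sum>\<^sub>\<infinity>p\<in>{p\<in>admissible. out p = n}. primitive A p t) = 0)"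
proof -
  \<comment> \<open>An enumeration of the frequencies in which each one occurs infinitely often.\<close>
  define target :: "nat \<Rightarrow> int" where "target j = from_nat (fst (prod_decode j))" for j
  define P where "P j x \<longleftrightarrow> approximate_state (fst x) (snd x) \<and> int j < fst x \<and> snd x 1 1 = 1"
    for j :: nat and x :: "int \<times> (int \<Rightarrow> real \<Rightarrow> complex)"
  define R where "R j x y \<longleftrightarrow> fst x < fst y \<and> (\<forall>n\<in>modes (fst x). snd y n = snd x n) \<and>
    (\<Sum>p\<in>pairs (fst y) - pairs (fst x). pair_size (snd y) p)
      \<le> (total_defect (fst x) (snd x) - total_defect (fst y) (snd y)) / \<bar>\<omega>\<bar> + (1 / 2) ^ j \<and>
    (\<Sum>n\<in>modes (fst y) - modes (fst x). weight s n * snorm (snd y n)) \<le> (1 / 2) ^ j \<and>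
    snorm (defect (fst y) (snd y) (target j)) \<le> (1 / 2) ^ j"
    for j :: nat and x y :: "int \<times> (int \<Rightarrow> real \<Rightarrow> complex)"
  have start: "\<exists>x. P 0 x"
  proof -
    obtain a where "approximate_state 1 a" "a 1 1 = 1" using initial_state by blast
    then show ?thesis by (intro exI[of _ "(1, a)"]) (simp add: P_def)
  qed
  have step: "\<exists>y. P (Suc j) y \<and> R j x y" if "P j x" for j x
  proof -
    from that have x: "approximate_state (fst x) (snd x)" "int j < fst x" "snd x 1 1 = 1"
      by (auto simp: P_def)
    obtain M' a' where new: "fst x < M'" "approximate_state M' a'" "\<forall>n\<in>modes (fst x). a' n = snd x n"
      "(\<Sum>p\<in>pairs M' - pairs (fst x). pair_size a' p)
        \<le> (total_defect (fst x) (snd x) - total_defect M' a') / \<bar>\<omega>\<bar> + (1 / 2) ^ j"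
      "(\<Sum>n\<in>modes M' - modes (fst x). weight s n * snorm (a' n)) \<le> (1 / 2) ^ j"
      "snorm (defect M' a' (target j)) \<le> (1 / 2) ^ j"
      using improve_state[OF x(1), of "(1 / 2) ^ j" "target j"] by auto
    have "1 \<in> modes (fst x)" using x(2) by (auto simp: modes_def)
    then have "P (Suc j) (M', a')" using new x by (simp add: P_def)
    moreover have "R j x (M', a')" using new by (simp add: R_def)
    ultimately show ?thesis by blast
  qed
  obtain f where f: "\<And>j. P j (f j)" "\<And>j. R j (f j) (f (Suc j))"
    using dependent_nat_choice[of P R, OF start step] by blast
  define M where "M j = fst (f j)" for j
  define a where "a j = snd (f j)" for j
  have st: "approximate_state (M j) (a j)" and Mj: "int j < M j" and a11: "a j 1 1 = 1" for j
    using f(1)[of j] by (auto simp: P_def M_def a_def)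
  have M_Suc: "M j < M (Suc j)"
    and keep: "n \<in> modes (M j) \<Longrightarrow> a (Suc j) n = a j n"
    and new_pairs: "(\<Sum>p\<in>pairs (M (Suc j)) - pairs (M j). pair_size (a (Suc j)) p)
      \<le> (total_defect (M j) (a j) - total_defect (M (Suc j)) (a (Suc j))) / \<bar>\<omega>\<bar> + (1 / 2) ^ j"
    and new_modes: "(\<Sum>n\<in>modes (M (Suc j)) - modes (M j). weight s n * snorm (a (Suc j) n)) \<le> (1 / 2) ^ j"
    and hit: "snorm (defect (M (Suc j)) (a (Suc j)) (target j)) \<le> (1 / 2) ^ j" for j n
    using f(2)[of j] by (auto simp: R_def M_def a_def)
  have M_mono: "M i \<le> M j" if "i \<le> j" for i j
    using that M_Suc by (simp add: lift_Suc_mono_le less_imp_le)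
  have keep_le: "a j n = a i n" if "i \<le> j" "n \<in> modes (M i)" for i j n
    using that(1)
  proof (induction j rule: dec_induct)
    case (step j)
    have "n \<in> modes (M j)" using that(2) M_mono[OF step.hyps(1)] by (auto simp: modes_def)
    then show ?case using keep step.IH by simp
  qed simp
  define A where "A n = a (nat \<bar>n\<bar>) n" for n
  have in_modes: "n \<in> modes (M (nat \<bar>n\<bar>))" for n
    using Mj[of "nat \<bar>n\<bar>"] by (auto simp: modes_def)
  have A_eq: "A n = a j n" if "n \<in> modes (M j)" for n j
    unfolding A_def using keep_le[of "nat \<bar>n\<bar>" j n] keep_le[of j "nat \<bar>n\<bar>" n] that in_modes
    by (cases "j \<le> nat \<bar>n\<bar>") auto
  have A_cont: "continuous_on {0..1} (A n)" and A_0: "A n 0 = 0" for n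
    unfolding A_def by (rule approximate_stateD(2)[OF st], rule approximate_stateD(3)[OF st])
  have A_prim: "primitive A p = primitive (a j) p" if "p \<in> pairs (M j)" for p j
    by (rule primitive_cong) (use that A_eq in \<open>auto simp: pairs_def\<close>)
  note pc = primitive_continuous[of A, OF A_cont]
  have geometric: "(\<Sum>j<J. (1 / 2 :: real) ^ j) \<le> 2" for J :: nat
  proof -
    have "(\<Sum>j<J. (1 / 2 :: real) ^ j) = (1 - (1 / 2) ^ J) / (1 - 1 / 2)"
      by (subst sum_gp_strict) simp
    also have "\<dots> \<le> 2" by simp
    finally show ?thesis .
  qed
  define W where "W p = pair_size A p" for p
  have W0: "0 \<le> W p" for p by (simp add: W_def snorm_nonneg pc)
  have total0: "0 \<le> total_defect (M j) (a j)" for j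
    unfolding total_defect_def
    by (intro sum_nonneg mult_nonneg_nonneg snorm_nonneg defect_continuous approximate_stateD(2)[OF st]) simp
  have W_sum: "sum W (pairs (M J)) + total_defect (M J) (a J) / \<bar>\<omega>\<bar>
      \<le> sum W (pairs (M 0)) + total_defect (M 0) (a 0) / \<bar>\<omega>\<bar> + (\<Sum>j<J. (1 / 2) ^ j)" for J
  proof (induction J)
    case (Suc J)
    have "sum W (pairs (M (Suc J))) = sum W (pairs (M (Suc J)) - pairs (M J)) + sum W (pairs (M J))"
      by (rule sum.subset_diff) (use pairs_mono[OF less_imp_le[OF M_Suc[of J]]] in auto)
    also have "sum W (pairs (M (Suc J)) - pairs (M J)) =
        (\<Sum>p\<in>pairs (M (Suc J)) - pairs (M J). pair_size (a (Suc J)) p)"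
      by (intro sum.cong refl) (simp add: W_def A_prim[of _ "Suc J"])
    finally show ?case using new_pairs[of J] Suc.IH by (simp add: diff_divide_distrib)
  qed simp
  have W_summable: "W summable_on admissible"
  proof (rule summable_on_exhaustion[where X="\<lambda>J. pairs (M J)"])
    fix F assume F: "finite F" "F \<subseteq> admissible"
    obtain K where K: "\<And>p. p \<in> F \<Longrightarrow> \<bar>fst p\<bar> + \<bar>snd p\<bar> \<le> K"
      using F(1) finite_imageI[OF F(1), of "\<lambda>p. \<bar>fst p\<bar> + \<bar>snd p\<bar>"]
      by (metis (no_types, lifting) Max_ge imageI)
    have "F \<subseteq> pairs (M (nat K))"
    proof
      fix p assume p: "p \<in> F"
      have "\<bar>fst p\<bar> + \<bar>snd p\<bar> \<le> M (nat K)" using K[OF p] Mj[of "nat K"] by linarith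
      then show "p \<in> pairs (M (nat K))" using p F(2) by (auto simp: pairs_def modes_def mem_Times_iff)
    qed
    then show "\<exists>J. F \<subseteq> pairs (M J)" ..
  next
    show "sum W (pairs (M J)) \<le> sum W (pairs (M 0)) + total_defect (M 0) (a 0) / \<bar>\<omega>\<bar> + 2" for J
      using W_sum[of J] geometric[of J] divide_nonneg_nonneg[OF total0[of J] abs_ge_zero[of \<omega>]] by linarith
  qed (auto simp: W0 pairs_def)
  have A_sum: "(\<Sum>n\<in>modes (M J). weight s n * snorm (A n))
      \<le> (\<Sum>n\<in>modes (M 0). weight s n * snorm (A n)) + (\<Sum>j<J. (1 / 2) ^ j)" for J
  proof (induction J)
    case (Suc J)
    have "(\<Sum>n\<in>modes (M (Suc J)). weight s n * snorm (A n)) =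
        (\<Sum>n\<in>modes (M (Suc J)) - modes (M J). weight s n * snorm (A n)) + (\<Sum>n\<in>modes (M J). weight s n * snorm (A n))"
      by (rule sum.subset_diff) (use M_Suc[of J] in \<open>auto simp: modes_def\<close>)
    also have "(\<Sum>n\<in>modes (M (Suc J)) - modes (M J). weight s n * snorm (A n)) =
        (\<Sum>n\<in>modes (M (Suc J)) - modes (M J). weight s n * snorm (a (Suc J) n))"
      by (intro sum.cong refl) (simp add: A_eq[of _ "Suc J"])
    finally show ?case using new_modes[of J] Suc.IH by simp
  qed simp
  have A_family: "weighted_family s A"
    unfolding weighted_family_def
  proof (intro conjI allI A_cont)
    show "(\<lambda>n. weight s n * snorm (A n)) summable_on UNIV"
    proof (rule summable_on_exhaustion[where X="\<lambda>J. modes (M J)"])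
      fix F :: "int set" assume F: "finite F"
      obtain K where K: "\<And>n. n \<in> F \<Longrightarrow> \<bar>n\<bar> \<le> K"
        using finite_imageI[OF F, of abs] by (metis Max_ge imageI)
      have "F \<subseteq> modes (M (nat K))"
      proof
        fix n assume "n \<in> F"
        then have "\<bar>n\<bar> \<le> M (nat K)" using K[of n] Mj[of "nat K"] by linarith
        then show "n \<in> modes (M (nat K))" by (auto simp: modes_def)
      qed
      then show "\<exists>J. F \<subseteq> modes (M J)" ..
    next
      show "(\<Sum>n\<in>modes (M J). weight s n * snorm (A n)) \<le> (\<Sum>n\<in>modes (M 0). weight s n * snorm (A n)) + 2" for J
        using A_sum[of J] geometric[of J] by linarith
    qed (auto simp: snorm_nonneg A_cont)
  qed
  have "\<i> * A n t + of_real \<omega> * (\<Sum>\<^sub>\<infinity>p\<in>{p\<in>admissible. out p = n}. primitive A p t) = 0"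
    if t: "t \<in> {0..1}" for n t
  proof -
    define Adm where "Adm = {p\<in>admissible. out p = n}"
    define L where "L = \<i> * A n t + of_real \<omega> * (\<Sum>\<^sub>\<infinity>p\<in>Adm. primitive A p t)"
    have "(\<lambda>p. primitive A p t) summable_on Adm"
    proof (rule abs_summable_summable, rule Infinite_Sum.abs_summable_on_comparison_test')
      have "W summable_on Adm" by (rule summable_on_subset_banach[OF W_summable]) (auto simp: Adm_def)
      then show "(\<lambda>p. inverse (weight s n) * W p) summable_on Adm" by (rule summable_on_cmult_right)
      fix p assume "p \<in> Adm"
      then have "inverse (weight s n) * W p = snorm (primitive A p)"
        using weight_pos[of s n] by (simp add: Adm_def W_def)
      then show "norm (primitive A p t) \<le> inverse (weight s n) * W p"
        using snorm_upper[OF pc t] by simp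
    qed
    then have "((\<lambda>F. \<Sum>p\<in>F. primitive A p t) \<longlongrightarrow> (\<Sum>\<^sub>\<infinity>p\<in>Adm. primitive A p t)) (finite_subsets_at_top Adm)"
      by (rule infsum_tendsto)
    moreover have "filterlim (\<lambda>J. {p\<in>pairs (M J). out p = n}) (finite_subsets_at_top Adm) sequentially"
      unfolding filterlim_finite_subsets_at_top
    proof (intro allI impI)
      fix F assume F: "finite F \<and> F \<subseteq> Adm"
      obtain K where K: "\<And>p. p \<in> F \<Longrightarrow> \<bar>fst p\<bar> + \<bar>snd p\<bar> \<le> K"
        using finite_imageI[of F "\<lambda>p. \<bar>fst p\<bar> + \<bar>snd p\<bar>"] F by (metis (no_types, lifting) Max_ge imageI)
      show "\<forall>\<^sub>F J in sequentially. finite {p\<in>pairs (M J). out p = n} \<and> F \<subseteq> {p\<in>pairs (M J). out p = n}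
          \<and> {p\<in>pairs (M J). out p = n} \<subseteq> Adm"
        using eventually_ge_at_top[of "nat K"]
      proof eventually_elim
        case (elim J)
        have "p \<in> pairs (M J)" if p: "p \<in> F" for p
        proof -
          have "\<bar>fst p\<bar> + \<bar>snd p\<bar> \<le> M J" using K[OF p] Mj[of J] elim by linarith
          then show ?thesis using p F by (auto simp: pairs_def modes_def Adm_def mem_Times_iff)
        qed
        then show ?case using F by (auto simp: pairs_def Adm_def)
      qed
    qed
    ultimately have "(\<lambda>J. \<Sum>p\<in>{p\<in>pairs (M J). out p = n}. primitive A p t) \<longlonglongrightarrow> (\<Sum>\<^sub>\<infinity>p\<in>Adm. primitive A p t)"
      by (rule filterlim_compose)
    then have "(\<lambda>J. \<i> * A n t + of_real \<omega> * (\<Sum>p\<in>{p\<in>pairs (M J). out p = n}. primitive A p t)) \<longlonglongrightarrow> L"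
      unfolding L_def by (intro tendsto_intros)
    moreover have "\<forall>\<^sub>F J in sequentially. \<i> * A n t + of_real \<omega> * (\<Sum>p\<in>{p\<in>pairs (M J). out p = n}. primitive A p t)
        = defect (M J) (a J) n t"
      using eventually_ge_at_top[of "nat \<bar>n\<bar>"]
    proof eventually_elim
      case (elim J)
      have "\<bar>n\<bar> \<le> M J" using elim Mj[of J] by linarith
      then have "n \<in> modes (M J)" by (auto simp: modes_def)
      moreover have "(\<Sum>p\<in>{p\<in>pairs (M J). out p = n}. primitive A p t) =
          (\<Sum>p\<in>{p\<in>pairs (M J). out p = n}. primitive (a J) p t)"
        by (intro sum.cong refl) (simp add: A_prim[of _ J])
      ultimately show ?case unfolding defect_def by (simp add: A_eq[of n J])
    qed
    ultimately have lim: "(\<lambda>J. defect (M J) (a J) n t) \<longlonglongrightarrow> L"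
      by (rule Lim_transform_eventually)
    define r where "r i = prod_encode (to_nat n, i)" for i
    have r: "i \<le> r i" "target (r i) = n" for i
      by (simp_all add: r_def le_prod_encode_2 target_def)
    have "filterlim (\<lambda>i. Suc (r i)) at_top sequentially"
      by (rule filterlim_at_top_mono[OF filterlim_ident]) (use r in \<open>auto intro: le_SucI always_eventually\<close>)
    from filterlim_compose[OF lim this]
    have 1: "(\<lambda>i. defect (M (Suc (r i))) (a (Suc (r i))) n t) \<longlonglongrightarrow> L" .
    have 2: "(\<lambda>i. defect (M (Suc (r i))) (a (Suc (r i))) n t) \<longlonglongrightarrow> 0"
    proof (rule Lim_null_comparison)
      show "(\<lambda>i. (1 / 2 :: real) ^ i) \<longlonglongrightarrow> 0" by (rule LIMSEQ_power_zero) simp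
      have "norm (defect (M (Suc (r i))) (a (Suc (r i))) n t) \<le> (1 / 2) ^ i" for i
      proof -
        have "norm (defect (M (Suc (r i))) (a (Suc (r i))) n t) \<le> snorm (defect (M (Suc (r i))) (a (Suc (r i))) n)"
          by (rule snorm_upper[OF defect_continuous t]) (rule approximate_stateD(2)[OF st])
        also have "\<dots> \<le> (1 / 2) ^ r i" using hit[of "r i"] by (simp add: r(2))
        also have "\<dots> \<le> (1 / 2) ^ i" by (rule power_decreasing[OF r(1)]) auto
        finally show ?thesis .
      qed
      then show "\<forall>\<^sub>F i in sequentially. norm (defect (M (Suc (r i))) (a (Suc (r i))) n t) \<le> (1 / 2) ^ i"
        by simp
    qed
    show ?thesis using LIMSEQ_unique[OF 1 2] by (simp add: L_def Adm_def)
  qed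
  moreover have "A 1 1 = 1" unfolding A_def by (rule a11)
  ultimately show ?thesis
    using A_family A_0 W_summable by (intro exI[of _ A]) (simp add: W_def[abs_def])
qed

end

section \<open>The three nonlinearities in Fourier modes\<close>

context quadratic_interaction
begin

lemma product_expansion:
  assumes S: "finite S"
  shows "conj_sign e1 (\<Sum>k\<in>S. \<zeta> k * character k x) * conj_sign e2 (\<Sum>k\<in>S. \<zeta> k * character k x) =
    (\<Sum>p\<in>S \<times> S. conj_sign e1 (\<zeta> (fst p)) * conj_sign e2 (\<zeta> (snd p)) * character (out p) x)"
proof -
  have "conj_sign e1 (\<Sum>k\<in>S. \<zeta> k * character k x) * conj_sign e2 (\<Sum>k\<in>S. \<zeta> k * character k x) =
      (\<Sum>k\<in>S. \<Sum>l\<in>S. (conj_sign e1 (\<zeta> k) * character (e1 * k) x) * (conj_sign e2 (\<zeta> l) * character (e2 * l) x))"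
    by (simp add: conj_sign_sum conj_sign_mult conj_sign_character[OF sign1]
        conj_sign_character[OF sign2] sum_product)
  also have "\<dots> = (\<Sum>p\<in>S \<times> S. (conj_sign e1 (\<zeta> (fst p)) * character (e1 * fst p) x) *
      (conj_sign e2 (\<zeta> (snd p)) * character (e2 * snd p) x))"
    by (simp add: sum.cartesian_product split_beta)
  also have "\<dots> = (\<Sum>p\<in>S \<times> S. conj_sign e1 (\<zeta> (fst p)) * conj_sign e2 (\<zeta> (snd p)) * character (out p) x)"
    by (intro sum.cong refl) (simp add: out_def mult_ac flip: character_mult)
  finally show ?thesis .
qed

end

interpretation square: quadratic_interaction 1 1
  by unfold_locales simp

interpretation cnj_square: quadratic_interaction "- 1" "- 1"
  by unfold_locales simp

interpretation abs_square: quadratic_interaction 1 "- 1"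
  by unfold_locales simp

lemma Q_square_expansion:
  assumes "finite S"
  shows "Q_square (\<lambda>x. \<Sum>k\<in>S. \<zeta> k * character k x) = (\<lambda>x. \<Sum>p\<in>(S \<times> S) \<inter> square.admissible.
    conj_sign 1 (\<zeta> (fst p)) * conj_sign 1 (\<zeta> (snd p)) * character (square.out p) x)"
  using square.product_expansion[OF assms]
  by (simp add: Q_square_def square.admissible_def power2_eq_square conj_sign_def)

lemma Q_cnj_square_expansion:
  assumes "finite S"
  shows "Q_cnj_square (\<lambda>x. \<Sum>k\<in>S. \<zeta> k * character k x) = (\<lambda>x. \<Sum>p\<in>(S \<times> S) \<inter> cnj_square.admissible.
    conj_sign (- 1) (\<zeta> (fst p)) * conj_sign (- 1) (\<zeta> (snd p)) * character (cnj_square.out p) x)"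
  using cnj_square.product_expansion[OF assms]
  by (simp add: Q_cnj_square_def cnj_square.admissible_def power2_eq_square conj_sign_def)

lemma torus_mean_character:
  "torus_mean (character n) = (if n = 0 then 1 else 0)"
proof -
  have "torus_mean (character n) = torus_dist (character n) (character 0) / (2 * of_real pi)"
    by (simp add: torus_mean_def torus_dist_def character_def[abs_def])
  then show ?thesis by (simp add: torus_dist_character)
qed

text \<open>The mean of \<open>|f|\<^sup>2\<close> is the sum over the pairs \<open>(k, k)\<close>, which are exactly the inadmissible ones.\<close>

lemma Q_abs_square_expansion:
  assumes S: "finite S"
  shows "Q_abs_square (\<lambda>x. \<Sum>k\<in>S. \<zeta> k * character k x) = (\<lambda>x. \<Sum>p\<in>(S \<times> S) \<inter> abs_square.admissible.
    conj_sign 1 (\<zeta> (fst p)) * conj_sign (- 1) (\<zeta> (snd p)) * character (abs_square.out p) x)"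
proof -
  define c where "c p = conj_sign 1 (\<zeta> (fst p)) * conj_sign (- 1) (\<zeta> (snd p))" for p
  define f where "f x = (\<Sum>k\<in>S. \<zeta> k * character k x)" for x
  have sq: "of_real ((norm (f x))\<^sup>2) = (\<Sum>p\<in>S \<times> S. c p * character (abs_square.out p) x)" for x
  proof -
    have "of_real ((norm (f x))\<^sup>2) = conj_sign 1 (f x) * conj_sign (- 1) (f x)"
      by (simp add: conj_sign_def complex_norm_square[symmetric])
    then show ?thesis unfolding f_def c_def abs_square.product_expansion[OF S] .
  qed
  have "torus_mean (\<lambda>y. of_real ((norm (f y))\<^sup>2)) = (\<Sum>p\<in>S \<times> S. c p * torus_mean (character (abs_square.out p)))"
    unfolding sq torus_mean_def sum_divide_distrib times_divide_eq_right
    by (subst integral_sum)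
      (auto simp: sum_divide_distrib S intro!: integrable_continuous_interval continuous_intros)
  also have "\<dots> = (\<Sum>p\<in>(S \<times> S) - abs_square.admissible. c p)"
    unfolding torus_mean_character
    by (rule sum.mono_neutral_cong_right)
      (auto simp: S abs_square.out_def abs_square.admissible_def)
  also have "\<dots> = (\<Sum>p\<in>(S \<times> S) - abs_square.admissible. c p * character (abs_square.out p) x)" for x
    by (intro sum.cong refl)
      (auto simp: abs_square.out_def abs_square.admissible_def character_def)
  finally have mean: "torus_mean (\<lambda>y. of_real ((norm (f y))\<^sup>2)) =
      (\<Sum>p\<in>(S \<times> S) - abs_square.admissible. c p * character (abs_square.out p) x)" for x .
  have "of_real ((norm (f x))\<^sup>2) - torus_mean (\<lambda>y. of_real ((norm (f y))\<^sup>2)) =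
      (\<Sum>p\<in>(S \<times> S) \<inter> abs_square.admissible. c p * character (abs_square.out p) x)" for x
    unfolding sq mean[of x, unfolded sq]
    using sum.Int_Diff[of "S \<times> S" "\<lambda>p. c p * character (abs_square.out p) x" abs_square.admissible] S
    by simp
  then show ?thesis by (simp add: Q_abs_square_def f_def c_def)
qed

lemma nontrivial_solution:
  assumes e: "(e1, e2) \<in> {(1, 1), (- 1, - 1), (1, - 1)}" and s: "s < 0" and \<omega>: "\<omega> \<noteq> 0"
    and Q: "\<And>S \<zeta>. finite S \<Longrightarrow> Q (\<lambda>x. \<Sum>k\<in>S. \<zeta> k * character k x) =
      (\<lambda>x. \<Sum>p\<in>(S \<times> S) \<inter> quadratic_interaction.admissible e1 e2.
        conj_sign e1 (\<zeta> (fst p)) * conj_sign e2 (\<zeta> (snd p)) * character (quadratic_interaction.out e1 e2 p) x)"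
  shows "\<exists>u. extended_weak_solution s \<omega> Q (\<lambda>g. 0) u \<and>
    (\<exists>t\<in>{0..1}. \<exists>g\<in>torus_test. u t g \<noteq> 0) \<and>
    (\<forall>m. cutoff_sequence m \<longrightarrow>
      (\<exists>F. Cm1_tendsto s (\<lambda>N. ST_dist (\<lambda>t. free_propagator t (Q_cutoff Q (m N) u t))) F))"
proof -
  interpret quadratic_equation e1 e2 s \<omega>
    by unfold_locales (use e s \<omega> in auto)
  obtain A where A: "weighted_family s A" "\<And>n. A n 0 = 0" "A 1 1 = 1"
    "(\<lambda>p. weight s (out p) * snorm (primitive A p)) summable_on admissible"
    "\<And>n t. t \<in> {0..1} \<Longrightarrow> \<i> * A n t + of_real \<omega> *
       (\<Sum>\<^sub>\<infinity>p\<in>{p\<in>admissible. out p = n}. primitive A p t) = 0"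
    using coefficients_exist by blast
  define u where "u = curve (\<lambda>n t. free_phase n t * A n t)"
  have "fourier_coeff (u 1) 1 = free_phase 1 1"
    by (simp add: u_def curve_def A(3))
  then have "u 1 (character (- 1)) \<noteq> 0"
    using norm_free_phase[of 1 1] by (auto simp: fourier_coeff_def simp del: norm_free_phase)
  moreover have "character (- 1) \<in> torus_test" by (rule character_in_torus_test)
  ultimately have "\<exists>t\<in>{0..1}. \<exists>g\<in>torus_test. u t g \<noteq> 0" by (intro bexI[of _ 1]) auto
  then show ?thesis
    using solution_from_coefficients[of Q, OF Q \<omega> A(1,2,4,5), folded u_def] by blast
qed

theorem theorem2p4:
  fixes s \<omega> :: real
    and Q :: "(real \<Rightarrow> complex) \<Rightarrow> real \<Rightarrow> complex"
  assumes "s < 0" and "\<omega> \<noteq> 0"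
    and "Q \<in> {Q_square, Q_cnj_square, Q_abs_square}"
  shows "\<exists>u. extended_weak_solution s \<omega> Q (\<lambda>g. 0) u \<and>
             (\<exists>t\<in>{0..1}. \<exists>g\<in>torus_test. u t g \<noteq> 0) \<and>
             (\<forall>m. cutoff_sequence m \<longrightarrow>
                (\<exists>F. Cm1_tendsto s
                       (\<lambda>N. ST_dist (\<lambda>t. free_propagator t (Q_cutoff Q (m N) u t))) F))"
proof -
  from assms(3) consider "Q = Q_square" | "Q = Q_cnj_square" | "Q = Q_abs_square" by blast
  then show ?thesis
  proof cases
    case 1
    show ?thesis
      unfolding 1 by (rule nontrivial_solution[of 1 1, OF _ assms(1,2) Q_square_expansion]) simp_all
  next
    case 2
    show ?thesis
      unfolding 2 by (rule nontrivial_solution[of "- 1" "- 1", OF _ assms(1,2) Q_cnj_square_expansion]) simp_all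
  next
    case 3
    show ?thesis
      unfolding 3 by (rule nontrivial_solution[of 1 "- 1", OF _ assms(1,2) Q_abs_square_expansion]) simp_all
  qed
qed

end
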